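(* Let $G$ be a Zariski-dense subgroup of $\mathrm{SU}(n,1)$. (1) Let $f\in\mathrm{SU}(n,1)$ be a loxodromic element such that $M_f<1$. If $\langle f,g\rangle$ is discrete for every loxodromic element $g\in G$, then $G$ is discrete. (2) Let $f\in\mathrm{SU}(n,1)$ be a Heisenberg translation, written up to conjugacy as $T_{s,\zeta}$, such that $|\zeta|<\frac12$. If $\langle f,g\rangle$ is discrete for every loxodromic element $g\in G$, then $G$ is discrete. (3) Let $f\in\mathrm{SU}(n,1)$ be a regular elliptic element such that $\delta(f)<1$. If $\langle f,g\rangle$ is discrete for every loxodromic element $g\in G$, then $G$ is discrete.
   Context: $A^*=\bar A^t$. $\mathrm{SU}(n,1)=\{A\in\mathrm{SL}(n+1,\mathbb C): A^*JA=J\}$, where $J$ is a Hermitian form of signature $(n,1)$; one may use either $$J_2=\begin{pmatrix}0&-1&0\\-1&0&0\\0&0&I_{n-1}\end{pmatrix}\quad\text{or}\quad J_1=\begin{pmatrix}-1&0\\0&I_n\end{pmatrix},$$ which are equivalent. $\mathrm{SU}(n,1)$ acts by projective transformations as isometries of $n$-dimensional complex hyperbolic space $\mathbf H_{\mathbb C}^n$, and on its boundary $\partial\mathbf H_{\mathbb C}^n$. An element is elliptic if it has a fixed point in $\mathbf H_{\mathbb C}^n$, and regular elliptic if it has a unique fixed point in $\mathbf H_{\mathbb C}^n$. It is parabolic (respectively loxodromic) if it has no fixed point in $\mathbf H_{\mathbb C}^n$ and exactly one (respectively exactly two) fixed points on $\partial\mathbf H_{\mathbb C}^n$. A subgroup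 $G$ is called Zariski-dense if it has no global fixed point in $\mathbf H_{\mathbb C}^n\cup\partial\mathbf H_{\mathbb C}^n$ and does not preserve a proper totally geodesic subspace of $\mathbf H_{\mathbb C}^n$. Loxodromic invariant (form $J_2$): a loxodromic $f$ is conjugate to $\mathrm{diag}(\lambda_1,\bar\lambda_1^{-1},\lambda_3,\dots,\lambda_{n+1})$ with $|\lambda_1|>1$ and $|\lambda_i|=1$ for $i=3,\dots,n+1$. Put $$\delta_{cp}(f)=\max\{|\lambda_i-1|: i=3,\dots,n+1\},\qquad M_f=2\delta_{cp}(f)+|\lambda_1-1|+|\bar\lambda_1^{-1}-1|.$$ Heisenberg translation (form $J_2$): a unipotent parabolic element; up to conjugacy it is of the form $$T_{s,\zeta}=\begin{pmatrix}1&0&0\\ s&1&\zeta^*\\ \zeta&0&I\end{pmatrix},\qquad s\in\mathbb C,\ \zeta\in\mathbb C^{n-1},\ \mathrm{Re}(s)=\tfrac12|\zeta|^2.$$ Elliptic invariant (form $J_1$): an elliptic $f$ is conjugate to $\mathrm{diag}(\lambda_1,\dots,\lambda_{n+1})$ with all $|\lambda_i|=1$, where $\lambda_1$ is the negative-type eigenvalue (its eigenvector has negative Hermitian length) and $\lambda_2,\dots,\lambda_{n+1}$ are positive-type eigenvalues. Put $$\delta(f)=\max\{|\lambda_i-1|+|\lambda_1-1|: i=2,\dots,n+1\}.$$ *)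

theory Defs
  imports "HOL-Analysis.Analysis" "HOL-Algebra.Generated_Groups"
begin

text \<open>
  Vectors of \<open>\<complex>\<^sup>n\<^sup>+\<^sup>1\<close> are of type \<open>complex ^ 'm\<close> with \<open>CARD('m) = n + 1\<close>.  Two distinct
  indices \<open>p\<close> and \<open>q\<close> play the roles of the first and the second coordinate; the remaining
  \<open>n - 1\<close> indices are not ordered, and nothing below depends on an order.  The existence of
  \<open>p \<noteq> q\<close> amounts to \<open>n \<ge> 1\<close>.
\<close>

section \<open>The groups \<open>SU(n,1)\<close>\<close>

definition conj_transpose :: "complex^'m^'m \<Rightarrow> complex^'m^'m" where
  "conj_transpose A = (\<chi> i j. cnj (A $ j $ i))"

definition J1 :: "'m::finite \<Rightarrow> complex^'m^'m" where
  "J1 p = (\<chi> i j. if i = j then (if i = p then - 1 else 1) else 0)"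

definition J2 :: "'m::finite \<Rightarrow> 'm \<Rightarrow> complex^'m^'m" where
  "J2 p q = (\<chi> i j. if (i = p \<and> j = q) \<or> (i = q \<and> j = p) then - 1
                    else if i = j \<and> i \<noteq> p \<and> i \<noteq> q then 1 else 0)"

definition SU :: "complex^'m^'m \<Rightarrow> (complex^'m::finite^'m) monoid" where
  "SU J = \<lparr>carrier = {A. det A = 1 \<and> conj_transpose A ** J ** A = J},
           mult = (**), one = mat 1\<rparr>"

text \<open>The Hermitian form \<open>\<langle>v, w\<rangle> = w\<^sup>* J v\<close>.\<close>

definition herm :: "complex^'m^'m \<Rightarrow> complex^'m \<Rightarrow> complex^'m::finite \<Rightarrow> complex" where
  "herm J v w = (\<Sum>i\<in>UNIV. cnj (w $ i) * (J *v v) $ i)"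

section \<open>Complex hyperbolic space and its isometries\<close>

text \<open>
  Points of projective space are complex lines through the origin, as sets of vectors.
\<close>

definition cline :: "complex^'m \<Rightarrow> (complex^'m) set" where
  "cline v = range (\<lambda>c. c *s v)"

definition hyp_space :: "complex^'m^'m \<Rightarrow> (complex^'m::finite) set set" where
  "hyp_space J = {cline v | v. Re (herm J v v) < 0}"

definition hyp_boundary :: "complex^'m^'m \<Rightarrow> (complex^'m::finite) set set" where
  "hyp_boundary J = {cline v | v. v \<noteq> 0 \<and> herm J v v = 0}"

definition act :: "complex^'m^'m \<Rightarrow> (complex^'m::finite) set \<Rightarrow> (complex^'m) set" where
  "act A x = (\<lambda>v. A *v v) ` x"

definition elliptic :: "complex^'m^'m \<Rightarrow> complex^'m::finite^'m \<Rightarrow> bool" where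
  "elliptic J A \<longleftrightarrow> A \<in> carrier (SU J) \<and> (\<exists>x\<in>hyp_space J. act A x = x)"

definition regular_elliptic :: "complex^'m^'m \<Rightarrow> complex^'m::finite^'m \<Rightarrow> bool" where
  "regular_elliptic J A \<longleftrightarrow> elliptic J A \<and> (\<exists>!x. x \<in> hyp_space J \<and> act A x = x)"

definition parabolic :: "complex^'m^'m \<Rightarrow> complex^'m::finite^'m \<Rightarrow> bool" where
  "parabolic J A \<longleftrightarrow> A \<in> carrier (SU J) \<and> \<not> (\<exists>x\<in>hyp_space J. act A x = x) \<and>
     card {x \<in> hyp_boundary J. act A x = x} = 1"

definition loxodromic :: "complex^'m^'m \<Rightarrow> complex^'m::finite^'m \<Rightarrow> bool" where
  "loxodromic J A \<longleftrightarrow> A \<in> carrier (SU J) \<and> \<not> (\<exists>x\<in>hyp_space J. act A x = x) \<and>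
     card {x \<in> hyp_boundary J. act A x = x} = 2"

section \<open>Totally geodesic subspaces and Zariski density\<close>

text \<open>
  The Bergman metric \<open>\<rho>\<close>, normalised by
  \<open>cosh\<^sup>2 (\<rho> / 2) = (\<langle>v,w\<rangle> \<langle>w,v\<rangle>) / (\<langle>v,v\<rangle> \<langle>w,w\<rangle>)\<close> for any nonzero representatives
  \<open>v\<close>, \<open>w\<close> of the two points.
\<close>

definition hyp_dist ::
  "complex^'m^'m \<Rightarrow> (complex^'m::finite) set \<Rightarrow> (complex^'m) set \<Rightarrow> real" where
  "hyp_dist J x y =
     (let v = (SOME v. v \<in> x \<and> v \<noteq> 0); w = (SOME w. w \<in> y \<and> w \<noteq> 0)
      in 2 * arcosh (cmod (herm J v w) / sqrt (Re (herm J v v) * Re (herm J w w))))"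

text \<open>Complete geodesics with unit speed parametrisation.\<close>

definition hyp_geodesic ::
  "complex^'m^'m \<Rightarrow> (real \<Rightarrow> (complex^'m::finite) set) \<Rightarrow> bool" where
  "hyp_geodesic J \<gamma> \<longleftrightarrow> range \<gamma> \<subseteq> hyp_space J \<and> (\<forall>s t. hyp_dist J (\<gamma> s) (\<gamma> t) = \<bar>s - t\<bar>)"

text \<open>
  A totally geodesic subspace (complete and connected) contains the whole geodesic through any
  two of its distinct points.  Real, complex and zero-dimensional ones are all included; the
  empty set, which every group preserves, is not.
\<close>

definition totally_geodesic ::
  "complex^'m^'m \<Rightarrow> (complex^'m::finite) set set \<Rightarrow> bool" where
  "totally_geodesic J S \<longleftrightarrow> S \<noteq> {} \<and> S \<subseteq> hyp_space J \<and>
     (\<forall>\<gamma> s t. hyp_geodesic J \<gamma> \<and> s \<noteq> t \<and> \<gamma> s \<in> S \<and> \<gamma> t \<in> S \<longrightarrow> range \<gamma> \<subseteq> S)"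

definition zariski_dense_subgroup ::
  "complex^'m^'m \<Rightarrow> (complex^'m::finite^'m) set \<Rightarrow> bool" where
  "zariski_dense_subgroup J G \<longleftrightarrow> subgroup G (SU J) \<and>
     \<not> (\<exists>x \<in> hyp_space J \<union> hyp_boundary J. \<forall>A\<in>G. act A x = x) \<and>
     \<not> (\<exists>S. totally_geodesic J S \<and> S \<noteq> hyp_space J \<and> (\<forall>A\<in>G. act A ` S = S))"

section \<open>Normal forms and invariants\<close>

definition diag_matrix :: "('m::finite \<Rightarrow> complex) \<Rightarrow> complex^'m^'m" where
  "diag_matrix l = (\<chi> i j. if i = j then l i else 0)"

definition conjugate_in_SU ::
  "complex^'m^'m \<Rightarrow> complex^'m::finite^'m \<Rightarrow> complex^'m^'m \<Rightarrow> bool" where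
  "conjugate_in_SU J A B \<longleftrightarrow> (\<exists>C\<in>carrier (SU J). A = C ** B ** matrix_inv C)"

definition loxodromic_normal_form ::
  "'m::finite \<Rightarrow> 'm \<Rightarrow> complex^'m^'m \<Rightarrow> ('m \<Rightarrow> complex) \<Rightarrow> bool" where
  "loxodromic_normal_form p q f l \<longleftrightarrow> conjugate_in_SU (J2 p q) f (diag_matrix l) \<and>
     cmod (l p) > 1 \<and> l q = inverse (cnj (l p)) \<and> (\<forall>i. i \<noteq> p \<and> i \<noteq> q \<longrightarrow> cmod (l i) = 1)"

text \<open>
  The normal form is unique up to a permutation of the unimodular eigenvalues, so the
  choices below do not affect the invariants.  The extra \<open>0\<close> in the maximum only matters
  for \<open>n = 1\<close>, where there are no further eigenvalues.
\<close>

definition delta_cp :: "'m::finite \<Rightarrow> 'm \<Rightarrow> complex^'m^'m \<Rightarrow> real" where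
  "delta_cp p q f = (let l = (SOME l. loxodromic_normal_form p q f l)
     in Max (insert 0 {cmod (l i - 1) | i. i \<noteq> p \<and> i \<noteq> q}))"

definition lox_M :: "'m::finite \<Rightarrow> 'm \<Rightarrow> complex^'m^'m \<Rightarrow> real" where
  "lox_M p q f = (let l = (SOME l. loxodromic_normal_form p q f l)
     in 2 * delta_cp p q f + cmod (l p - 1) + cmod (inverse (cnj (l p)) - 1))"

definition unipotent :: "complex^'m::finite^'m \<Rightarrow> bool" where
  "unipotent A \<longleftrightarrow> (\<forall>c v. v \<noteq> 0 \<and> A *v v = c *s v \<longrightarrow> c = 1)"

definition heisenberg_translation ::
  "complex^'m^'m \<Rightarrow> complex^'m::finite^'m \<Rightarrow> bool" where
  "heisenberg_translation J A \<longleftrightarrow> parabolic J A \<and> unipotent A"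

text \<open>
  The matrix \<open>T\<^sub>s\<^sub>,\<^sub>\<zeta>\<close>; a vector \<open>\<zeta>\<close> of \<open>\<complex>\<^sup>n\<^sup>-\<^sup>1\<close> is given as a vector of \<open>\<complex>\<^sup>n\<^sup>+\<^sup>1\<close> whose
  entries at \<open>p\<close> and \<open>q\<close> vanish.
\<close>

definition heis_matrix ::
  "'m::finite \<Rightarrow> 'm \<Rightarrow> complex \<Rightarrow> complex^'m \<Rightarrow> complex^'m^'m" where
  "heis_matrix p q s \<zeta> = (\<chi> i j.
     if i = j then 1
     else if i = q \<and> j = p then s
     else if i = q then cnj (\<zeta> $ j)
     else if j = p then \<zeta> $ i
     else 0)"

definition heisenberg_normal_form ::
  "'m::finite \<Rightarrow> 'm \<Rightarrow> complex^'m^'m \<Rightarrow> complex \<Rightarrow> complex^'m \<Rightarrow> bool" where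
  "heisenberg_normal_form p q f s \<zeta> \<longleftrightarrow> \<zeta> $ p = 0 \<and> \<zeta> $ q = 0 \<and> Re s = (norm \<zeta>)\<^sup>2 / 2 \<and>
     conjugate_in_SU (J2 p q) f (heis_matrix p q s \<zeta>)"

text \<open>
  If \<open>f = C D C\<^sup>-\<^sup>1\<close> with \<open>C\<close> in \<open>SU (J1 p)\<close> and \<open>D\<close> diagonal, then column \<open>p\<close> of \<open>C\<close> is a
  negative eigenvector of \<open>f\<close> and the other columns are positive ones, so \<open>l p\<close> is the
  eigenvalue of negative type.  It is determined by \<open>f\<close>, as is the multiset of the others.
\<close>

definition elliptic_normal_form ::
  "'m::finite \<Rightarrow> complex^'m^'m \<Rightarrow> ('m \<Rightarrow> complex) \<Rightarrow> bool" where
  "elliptic_normal_form p f l \<longleftrightarrow> conjugate_in_SU (J1 p) f (diag_matrix l) \<and>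
     (\<forall>i. cmod (l i) = 1)"

definition ell_delta :: "'m::finite \<Rightarrow> complex^'m^'m \<Rightarrow> real" where
  "ell_delta p f = (let l = (SOME l. elliptic_normal_form p f l)
     in Max {cmod (l i - 1) + cmod (l p - 1) | i. i \<noteq> p})"

end

theory Submission
  imports Defs "HOL-Computational_Algebra.Fundamental_Theorem_Algebra"
begin

text \<open>
  Suppose that \<open>G\<close> is Zariski-dense but not discrete. The contradiction comes from loxodromic
  elements \<open>g\<close> of \<open>G\<close> arbitrarily close to \<open>1\<close>.

  A group without global fixed points contains a loxodromic element: it is unbounded, by a
  circumcentre argument, and renormalised limits of unbounded sequences have rank one, which
  yields elements of large trace. If \<open>h \<rightarrow> 1\<close> in \<open>G\<close> and \<open>A\<close> is a loxodromic element of \<open>G\<close> whose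
  repelling fixed point is moved by \<open>h\<close>, then suitable conjugates \<open>A\<^sup>m h A\<^sup>-\<^sup>m\<close> converge to a
  nontrivial Heisenberg translation \<open>T\<close> as close to \<open>1\<close> as desired. For a conjugate \<open>T'\<close> of \<open>T\<close>
  with another fixed point, one of \<open>T T'\<close> and \<open>T T'\<^sup>-\<^sup>1\<close> has a trace of modulus greater than
  \<open>n + 1\<close>, so it is a limit of loxodromic elements of \<open>G\<close> close to \<open>1\<close>.

  Given such a \<open>g\<close> in general position, iterating a word in \<open>f\<close> and \<open>g\<close> (\<open>f\<^sup>-\<^sup>1 [f, [f, g]] f\<close> if \<open>f\<close>
  is loxodromic, \<open>[f, g]\<close> if it is a Heisenberg translation, \<open>g f g\<^sup>-\<^sup>1\<close> if it is elliptic) is a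
  contraction. As \<open>\<langle>f, g\<rangle>\<close> is discrete, some iterate fixes the fixed points of \<open>f\<close>, and then,
  going back through the iteration, so does \<open>g\<close>: a contradiction.
\<close>

section \<open>Hermitian forms of signature \<open>(n, 1)\<close>\<close>

text \<open>Besides the absence of fixed points, Zariski density is used through two consequences:
  an invariant linear subspace with a negative vector is the whole space, and every boundary orbit
  has at least three points. Non-discreteness alone yields small elements of unknown type, possibly
  elliptic; the obstacle is to make them loxodromic. The limit \<open>T\<close> has a known shape
  but lies only in the closure of \<open>G\<close>. The criterion |trace| > n + 1 is chosen because
  it is open, so it descends to \<open>G\<close>, and because it forces an eigenvalue off the unit
  circle. Replacing \<open>T'\<close> by its inverse reverses the part of the trace that can have
  either sign.

  The bounds on \<open>f\<close> are contraction rates. For loxodromic \<open>f\<close>, M_f bounds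
  |l_i - l_j| / sqrt |l_i l_j|, whose squares are the multipliers of the linearised word. For
  elliptic \<open>f\<close>, delta(f) bounds |l_i - l_1|, so \<open>f\<close> displaces points near
  its fixed point by less than their distance from it. Contraction alone gives convergence;
  discreteness turns it into an equality, and only an equality can be traced back through the
  iteration.\<close>

lemma herm_alt: "herm J v w = (\<Sum>i\<in>UNIV. \<Sum>j\<in>UNIV. cnj (w $ i) * J $ i $ j * v $ j)"
  by (simp add: herm_def matrix_vector_mult_def sum_distrib_left mult.assoc)

lemma herm_add_left: "herm J (u + v) w = herm J u w + herm J v w"
  by (simp add: herm_def matrix_vector_right_distrib sum.distrib distrib_left)

lemma herm_add_right: "herm J u (v + w) = herm J u v + herm J u w"
  by (simp add: herm_def sum.distrib distrib_right)

lemma herm_scale_left: "herm J (c *s v) w = c * herm J v w"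
  by (simp add: herm_def vector_scalar_commute sum_distrib_left mult_ac)

lemma herm_scale_right: "herm J v (c *s w) = cnj c * herm J v w"
  by (simp add: herm_def sum_distrib_left mult_ac)

lemma herm_zero_left [simp]: "herm J 0 w = 0"
  and herm_zero_right [simp]: "herm J v 0 = 0"
  by (simp_all add: herm_def)

lemma herm_diff_left: "herm J (u - v) w = herm J u w - herm J v w"
  by (simp add: herm_def matrix_vector_mult_diff_distrib sum_subtractf right_diff_distrib)

lemma herm_diff_right: "herm J u (v - w) = herm J u v - herm J u w"
  by (simp add: herm_def sum_subtractf left_diff_distrib)

lemma herm_minus_left: "herm J (- v) w = - herm J v w"
  using herm_diff_left[of J 0 v w] by simp

lemma herm_minus_right: "herm J v (- w) = - herm J v w"
  using herm_diff_right[of J v 0 w] by simp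

lemmas herm_simps = herm_add_left herm_add_right herm_scale_left herm_scale_right
  herm_diff_left herm_diff_right herm_minus_left herm_minus_right

section \<open>Norms and continuity of the matrix operations\<close>

lemma scaleR_vec_complex: "r *\<^sub>R (v :: complex^'n) = complex_of_real r *s v"
  unfolding vec_eq_iff vector_scaleR_component vector_smult_component
  by (simp add: scaleR_conv_of_real)

lemma norm_vector_smult: "norm (c *s (v :: complex^'n)) = cmod c * norm v"
proof -
  have "norm (c *s v) = L2_set (\<lambda>i. cmod c * norm (v $ i)) UNIV"
    by (simp add: norm_vec_def norm_mult)
  then show ?thesis
    by (simp add: norm_vec_def L2_set_right_distrib)
qed

lemma bounded_bilinear_herm: "bounded_bilinear (herm J)"
proof (rule bounded_bilinear.intro)
  let ?K = "\<Sum>i\<in>UNIV. \<Sum>j\<in>UNIV. cmod (J $ i $ j)"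
  show "\<exists>K. \<forall>v w. norm (herm J v w) \<le> norm v * norm w * K"
  proof (intro exI allI)
    fix v w
    have "norm (herm J v w) \<le> (\<Sum>i\<in>UNIV. \<Sum>j\<in>UNIV. norm (cnj (w $ i) * J $ i $ j * v $ j))"
      unfolding herm_alt by (intro order_trans[OF norm_sum] sum_mono norm_sum)
    also have "\<dots> \<le> (\<Sum>i\<in>UNIV. \<Sum>j\<in>UNIV. norm w * cmod (J $ i $ j) * norm v)"
      unfolding norm_mult complex_mod_cnj
      by (intro sum_mono mult_mono) (auto simp: Finite_Cartesian_Product.norm_nth_le)
    also have "\<dots> = norm v * norm w * ?K"
      by (simp add: sum_distrib_left mult_ac)
    finally show "norm (herm J v w) \<le> norm v * norm w * ?K" .
  qed
qed (simp_all add: herm_simps scaleR_vec_complex scaleR_conv_of_real)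

lemmas continuous_herm [continuous_intros] =
  bounded_bilinear.continuous_on[OF bounded_bilinear_herm]
lemmas tendsto_herm [tendsto_intros] = bounded_bilinear.tendsto[OF bounded_bilinear_herm]

lemma bounded_bilinear_matrix_vector_mult_complex:
  "bounded_bilinear (\<lambda>A v. (A :: complex^'n^'m) *v v)"
proof (rule bounded_bilinear.intro)
  show "\<exists>K. \<forall>A v. norm ((A :: complex^'n^'m) *v v) \<le> norm A * norm v * K"
  proof (intro exI allI)
    fix A :: "complex^'n^'m" and v
    have "norm (A *v v) \<le> (\<Sum>i\<in>UNIV. norm ((A *v v) $ i))"
      unfolding norm_vec_def by (rule L2_set_le_sum) auto
    also have "\<dots> \<le> (\<Sum>i\<in>(UNIV::'m set). \<Sum>j\<in>(UNIV::'n set). norm (A $ i $ j * v $ j))"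
      unfolding matrix_vector_mult_def by (intro sum_mono) (simp add: norm_sum)
    also have "\<dots> \<le> (\<Sum>i\<in>(UNIV::'m set). \<Sum>j\<in>(UNIV::'n set). norm A * norm v)"
      unfolding norm_mult
      by (intro sum_mono mult_mono)
        (auto intro: order_trans[OF Finite_Cartesian_Product.norm_nth_le Finite_Cartesian_Product.norm_nth_le] simp: Finite_Cartesian_Product.norm_nth_le)
    also have "\<dots> = norm A * norm v * (CARD('m) * CARD('n))"
      by (simp add: mult_ac)
    finally show "norm (A *v v) \<le> norm A * norm v * (CARD('m) * CARD('n))" .
  qed
qed (simp_all add: vec_eq_iff matrix_vector_mult_def scaleR_sum_right sum.distrib
  distrib_left distrib_right)

lemmas continuous_matrix_vector_mult [continuous_intros] =
  bounded_bilinear.continuous_on[OF bounded_bilinear_matrix_vector_mult_complex]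
lemmas tendsto_matrix_vector_mult [tendsto_intros] =
  bounded_bilinear.tendsto[OF bounded_bilinear_matrix_vector_mult_complex]

lemma matrix_add_rdistrib: "(B + C) ** A = B ** A + C ** (A :: 'a::semiring_1^'n^'m)"
  by (simp add: vec_eq_iff matrix_matrix_mult_def sum.distrib distrib_right)

lemma matrix_diff_rdistrib: "(B - C) ** A = B ** A - C ** (A :: 'a::ring_1^'n^'m)"
  by (simp add: vec_eq_iff matrix_matrix_mult_def sum_subtractf left_diff_distrib)

lemma matrix_diff_ldistrib: "A ** (B - C) = A ** B - (A :: 'a::ring_1^'n^'m) ** C"
  by (simp add: vec_eq_iff matrix_matrix_mult_def sum_subtractf right_diff_distrib)

text \<open>The norm of a matrix is its Frobenius norm.\<close>

lemma norm_matrix_mult_le: "norm ((A :: complex^'n^'m) ** (B :: complex^'p^'n)) \<le> norm A * norm B"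
proof -
  have entry: "cmod ((A ** B) $ i $ j) \<le> norm (A $ i) * norm (\<chi> k. B $ k $ j)" for i j
  proof -
    have "cmod ((A ** B) $ i $ j) \<le> (\<Sum>k\<in>UNIV. cmod (A $ i $ k) * cmod (B $ k $ j))"
      unfolding matrix_matrix_mult_def by (simp add: norm_mult[symmetric] norm_sum)
    also have "\<dots> \<le> L2_set (\<lambda>k. cmod (A $ i $ k)) UNIV * L2_set (\<lambda>k. cmod (B $ k $ j)) UNIV"
      using L2_set_mult_ineq[of "\<lambda>k. cmod (A $ i $ k)" "\<lambda>k. cmod (B $ k $ j)" UNIV] by simp
    finally show ?thesis by (simp add: norm_vec_def)
  qed
  have sq: "(norm M)\<^sup>2 = (\<Sum>i\<in>UNIV. (norm (M $ i))\<^sup>2)" for M :: "'b::real_normed_vector^'k"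
    by (simp add: norm_vec_def L2_set_def sum_nonneg)
  have "(norm (A ** B))\<^sup>2 = (\<Sum>i\<in>UNIV. \<Sum>j\<in>UNIV. (cmod ((A ** B) $ i $ j))\<^sup>2)"
    by (simp add: sq)
  also have "\<dots> \<le> (\<Sum>i\<in>UNIV. \<Sum>j\<in>UNIV. (norm (A $ i) * norm (\<chi> k. B $ k $ j))\<^sup>2)"
    by (intro sum_mono power_mono entry) auto
  also have "\<dots> = (\<Sum>i\<in>UNIV. (norm (A $ i))\<^sup>2) * (\<Sum>j\<in>UNIV. (norm (\<chi> k. B $ k $ j))\<^sup>2)"
    by (simp add: power_mult_distrib sum_product)
  also have "(\<Sum>j\<in>UNIV. (norm (\<chi> k. B $ k $ j))\<^sup>2) = (\<Sum>j\<in>UNIV. \<Sum>k\<in>UNIV. (cmod (B $ k $ j))\<^sup>2)"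
    by (simp add: sq)
  also have "\<dots> = (\<Sum>k\<in>UNIV. \<Sum>j\<in>UNIV. (cmod (B $ k $ j))\<^sup>2)"
    by (rule sum.swap)
  also have "\<dots> = (norm B)\<^sup>2"
    by (simp add: sq)
  also have "(\<Sum>i\<in>UNIV. (norm (A $ i))\<^sup>2) = (norm A)\<^sup>2"
    by (simp add: sq)
  finally show ?thesis
    by (metis power_mult_distrib norm_ge_zero mult_nonneg_nonneg power2_le_imp_le)
qed

lemma scaleR_matrix_mult_left: "(r *\<^sub>R A) ** (B :: complex^'p^'n) = r *\<^sub>R (A ** B)"
  and scaleR_matrix_mult_right: "A ** (r *\<^sub>R (B :: complex^'p^'n)) = r *\<^sub>R (A ** B)"
  by (simp_all add: vec_eq_iff matrix_matrix_mult_def scaleR_sum_right)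

lemma bounded_bilinear_matrix_mult:
  "bounded_bilinear (\<lambda>(A :: complex^'n^'m) (B :: complex^'p^'n). A ** B)"
  by (rule bounded_bilinear.intro)
    (auto simp: matrix_add_rdistrib matrix_add_ldistrib scaleR_matrix_mult_left
      scaleR_matrix_mult_right intro!: exI[of _ 1] norm_matrix_mult_le)

lemmas continuous_matrix_mult [continuous_intros] =
  bounded_bilinear.continuous_on[OF bounded_bilinear_matrix_mult]
lemmas tendsto_matrix_mult [tendsto_intros] =
  bounded_bilinear.tendsto[OF bounded_bilinear_matrix_mult]

lemma conj_transpose_mult: "conj_transpose (A ** B) = conj_transpose B ** conj_transpose A"
  by (simp add: vec_eq_iff conj_transpose_def matrix_matrix_mult_def mult.commute)

lemma conj_transpose_conj_transpose [simp]: "conj_transpose (conj_transpose A) = A"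
  by (simp add: vec_eq_iff conj_transpose_def)

lemma conj_transpose_mat_1 [simp]: "conj_transpose (mat 1) = mat 1"
  by (simp add: vec_eq_iff conj_transpose_def mat_def)

lemma norm_conj_transpose [simp]: "norm (conj_transpose A) = norm A"
proof -
  have sq: "(norm M)\<^sup>2 = (\<Sum>i\<in>UNIV. \<Sum>j\<in>UNIV. (cmod (M $ i $ j))\<^sup>2)" for M :: "complex^'m^'m"
    by (simp add: norm_vec_def L2_set_def sum_nonneg)
  have "(norm (conj_transpose A))\<^sup>2 = (norm A)\<^sup>2"
    unfolding sq conj_transpose_def by (subst sum.swap) simp
  then show ?thesis by simp
qed

lemma bounded_linear_conj_transpose: "bounded_linear conj_transpose"
  by (rule bounded_linear_intro[where K = 1])
    (simp_all add: vec_eq_iff conj_transpose_def[of "_ + _"] conj_transpose_def[of "_ *\<^sub>R _"],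
      simp_all add: conj_transpose_def)

lemma det_conj_transpose:
  fixes A :: "complex^'m^'m::finite"
  shows "det (conj_transpose A) = cnj (det A)"
proof -
  have "conj_transpose A = map_matrix cnj (transpose A)"
    by (simp add: vec_eq_iff conj_transpose_def transpose_def)
  moreover have "det (map_matrix cnj B) = cnj (det B)" for B :: "complex^'m^'m"
    unfolding det_def by simp
  ultimately show ?thesis by (simp add: det_transpose)
qed

lemma cmod_eq_1I: "z * cnj z = 1 \<Longrightarrow> cmod z = 1"
  using complex_mod_sqrt_Re_mult_cnj[of z] by simp

lemma sum_if_axis: "(\<Sum>i\<in>UNIV. f i * (if i = k then 1 else 0)) = (f (k::'m::finite) :: complex)"
  by (subst sum.cong[OF refl, of _ _ "\<lambda>i. if i = k then f i else 0"]) auto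

lemma herm_matrix_eqI:
  fixes A B :: "complex^'m^'m::finite"
  assumes "\<And>v w. herm A v w = herm B v w"
  shows "A = B"
proof -
  have "herm M (axis j 1) (axis i 1) = M $ i $ j" for M :: "complex^'m^'m" and i j :: 'm
  proof -
    have "cnj (axis i 1 $ k) * (M *v axis j 1) $ k = (if k = i then M $ i $ j else 0)" for k
      by (auto simp: axis_def matrix_vector_mult_def sum_if_axis)
    then show ?thesis by (simp add: herm_def)
  qed
  then show ?thesis
    using assms by (metis vec_eq_iff)
qed

lemma herm_adjoint_gen:
  fixes J A B :: "complex^'m^'m::finite"
  shows "herm J (A *v v) (B *v w) = herm (conj_transpose B ** J ** A) v w"
proof -
  have move: "(\<Sum>i\<in>UNIV. cnj ((B *v w) $ i) * x $ i) = (\<Sum>i\<in>UNIV. cnj (w $ i) * (conj_transpose B *v x) $ i)"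
    for x :: "complex^'m"
  proof -
    have "(\<Sum>i\<in>UNIV. cnj ((B *v w) $ i) * x $ i) = (\<Sum>i\<in>UNIV. \<Sum>j\<in>UNIV. cnj (B $ i $ j) * cnj (w $ j) * x $ i)"
      by (simp add: matrix_vector_mult_def sum_distrib_right)
    also have "\<dots> = (\<Sum>j\<in>UNIV. \<Sum>i\<in>UNIV. cnj (B $ i $ j) * cnj (w $ j) * x $ i)"
      by (rule sum.swap)
    also have "\<dots> = (\<Sum>i\<in>UNIV. cnj (w $ i) * (conj_transpose B *v x) $ i)"
      by (simp add: matrix_vector_mult_def conj_transpose_def sum_distrib_left mult_ac)
    finally show ?thesis .
  qed
  show ?thesis
    unfolding herm_def move by (simp add: matrix_vector_mul_assoc matrix_mul_assoc)
qed

lemma cline_eqI: "c \<noteq> 0 \<Longrightarrow> cline (c *s v) = cline v"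
proof -
  assume c: "c \<noteq> 0"
  have "d *s v = (d / c) *s (c *s v)" for d
    using c by (simp add: vector_smult_assoc)
  then have "d *s v \<in> cline (c *s v)" for d
    unfolding cline_def by (metis rangeI)
  moreover have "d *s (c *s v) \<in> cline v" for d
    unfolding cline_def vector_smult_assoc by (rule rangeI)
  ultimately show ?thesis
    unfolding cline_def by blast
qed

lemma mem_cline: "w \<in> cline v \<longleftrightarrow> (\<exists>c. w = c *s v)"
  by (auto simp: cline_def)

lemma self_mem_cline [simp]: "v \<in> cline v"
  by (auto simp: mem_cline intro: exI[of _ 1])

lemma cline_eq_iff:
  assumes "v \<noteq> 0"
  shows "cline v = cline w \<longleftrightarrow> (\<exists>c. c \<noteq> 0 \<and> v = c *s w)"
proof
  assume "cline v = cline w"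
  then obtain c where "v = c *s w"
    using self_mem_cline[of v] by (auto simp: mem_cline)
  then show "\<exists>c. c \<noteq> 0 \<and> v = c *s w"
    using assms by auto
qed (auto simp: cline_eqI)

lemma act_cline: "act A (cline v) = cline (A *v v)"
  by (auto simp: act_def cline_def image_image vector_scalar_commute)

lemma act_act: "act A (act B x) = act (A ** B) x"
  by (simp add: act_def image_image matrix_vector_mul_assoc)

lemma act_mat_1 [simp]: "act (mat 1) x = x"
  by (simp add: act_def)

text \<open>Signature \<open>(n, 1)\<close> is encoded by one negative vector whose orthogonal
  complement is positive definite, so that both model forms are instances and the theory is
  developed once. Since \<open>J\<close> is an involution, adjoints need no matrix inverse.\<close>

locale hermitian_form =
  fixes J :: "complex^'m::finite^'m"
  assumes J_hermitian: "conj_transpose J = J"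
    and J_square: "J ** J = mat 1"
    and ex_negative: "\<exists>v. Re (herm J v v) < 0 \<and> (\<forall>w. herm J w v = 0 \<longrightarrow> w \<noteq> 0 \<longrightarrow> 0 < Re (herm J w w))"
begin

abbreviation H where "H \<equiv> herm J"
abbreviation U where "U \<equiv> carrier (SU J)"

lemma H_commute: "H w v = cnj (H v w)"
proof -
  have J: "cnj (J $ i $ j) = J $ j $ i" for i j
    by (subst (2) J_hermitian[symmetric]) (simp add: conj_transpose_def)
  show ?thesis
    unfolding herm_alt by (subst sum.swap) (simp add: J mult_ac)
qed

lemma H_self: "H v v = of_real (Re (H v v))"
  by (metis H_commute complex_cnj_cancel_iff complex_is_Real_iff of_real_Re Reals_cnj_iff)

lemma H_eq_0_commute: "H w v = 0 \<longleftrightarrow> H v w = 0"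
  by (metis H_commute complex_cnj_zero_iff)

lemma H_smult_self: "H (c *s v) (c *s v) = of_real ((cmod c)\<^sup>2) * H v v"
  by (simp add: herm_simps complex_norm_square mult.assoc[symmetric] del: of_real_power)

text \<open>Two orthogonal nonpositive vectors span a space on which the form is nonpositive. The
  combination \<open>u\<close> lies in it and also in the positive definite complement of
  \<open>z\<close>, so it vanishes. Most later uses of the signature go through this fact.\<close>

lemma nonpos_orthogonal_proportional:
  assumes v: "v \<noteq> 0" "Re (H v v) \<le> 0" and w: "Re (H w w) \<le> 0" and vw: "H v w = 0"
  shows "\<exists>c. w = c *s v"
proof -
  obtain z where z: "Re (H z z) < 0" "\<And>w. H w z = 0 \<Longrightarrow> w \<noteq> 0 \<Longrightarrow> 0 < Re (H w w)"
    using ex_negative by blast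
  have vz: "H v z \<noteq> 0"
    using z(2) v by force
  define u where "u = H w z *s v - H v z *s w"
  have "H u z = 0"
    by (simp add: u_def herm_simps)
  moreover have "H u u = of_real ((cmod (H w z))\<^sup>2) * H v v + of_real ((cmod (H v z))\<^sup>2) * H w w"
    using vw H_eq_0_commute[of w v]
    by (simp add: u_def herm_simps complex_norm_square algebra_simps del: of_real_power)
  then have "Re (H u u) \<le> 0"
    using v w by (simp add: mult_nonneg_nonpos add_nonpos_nonpos)
  ultimately have "u = 0"
    using z(2) by force
  then have "w = (H w z / H v z) *s v"
    using vz by (simp add: u_def vec_eq_iff field_simps)
  then show ?thesis by blast
qed

lemma negative_orthogonal_positive:
  assumes v: "Re (H v v) < 0" and vw: "H w v = 0" and "w \<noteq> 0"
  shows "0 < Re (H w w)"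
proof (rule ccontr)
  assume "\<not> 0 < Re (H w w)"
  then obtain c where c: "w = c *s v"
    using nonpos_orthogonal_proportional[of v w] v vw H_eq_0_commute by force
  then show False
    using vw v \<open>w \<noteq> 0\<close> by (auto simp: herm_simps)
qed

lemma null_nonorthogonal:
  assumes "a \<noteq> 0" "H a a = 0" "H b b = 0" "\<nexists>c. b = c *s a"
  shows "H a b \<noteq> 0"
  using nonpos_orthogonal_proportional[of a b] assms by auto

text \<open>Pairing \<open>v\<close> with \<open>J *v v\<close> gives its squared Euclidean norm,
  because \<open>J\<close> is an involution.\<close>

lemma herm_nondegenerate:
  assumes "\<And>u. H u v = 0"
  shows "v = 0"
proof (rule ccontr)
  assume "v \<noteq> 0"
  have "H (J *v u) v = (\<Sum>i\<in>UNIV. cnj (v $ i) * u $ i)" for u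
    by (simp add: herm_def matrix_vector_mul_assoc J_square)
  then have "(\<Sum>i\<in>UNIV. cnj (v $ i) * v $ i) = 0"
    using assms by metis
  moreover have "(\<Sum>i\<in>UNIV. cnj (v $ i) * v $ i) = of_real (\<Sum>i\<in>UNIV. (cmod (v $ i))\<^sup>2)"
    by (simp add: complex_norm_square mult.commute del: of_real_power)
  ultimately have "(\<Sum>i\<in>UNIV. (cmod (v $ i))\<^sup>2) = 0"
    by (metis of_real_eq_0_iff)
  then show False
    using \<open>v \<noteq> 0\<close> by (simp add: sum_nonneg_eq_0_iff vec_eq_iff)
qed

text \<open>The adjoint with respect to the form (see \<open>herm_dag\<close>). It inverts the
  elements of \<open>U\<close>, but it is defined, real-linear and continuous on all matrices, which
  is what estimates on differences such as \<open>x - mat 1\<close> need.\<close>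

definition dag :: "complex^'m^'m \<Rightarrow> complex^'m^'m" where
  "dag A = J ** conj_transpose A ** J"

lemma dag_mult: "dag (A ** B) = dag B ** dag A"
proof -
  have "dag B ** dag A = J ** conj_transpose B ** (J ** J) ** conj_transpose A ** J"
    by (simp only: dag_def matrix_mul_assoc)
  then show ?thesis
    by (simp add: J_square dag_def conj_transpose_mult matrix_mul_assoc)
qed

lemma dag_dag [simp]: "dag (dag A) = A"
proof -
  have "dag (dag A) = (J ** J) ** A ** (J ** J)"
    by (simp only: dag_def conj_transpose_mult J_hermitian conj_transpose_conj_transpose matrix_mul_assoc)
  then show ?thesis by (simp add: J_square)
qed

lemma dag_mat_1 [simp]: "dag (mat 1) = mat 1"
  by (simp add: dag_def J_square)

lemma bounded_linear_dag: "bounded_linear dag"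
  unfolding dag_def
  using bounded_linear_conj_transpose bounded_bilinear_matrix_mult
  by (intro bounded_linear_compose[OF bounded_bilinear.bounded_linear_left[OF bounded_bilinear_matrix_mult]]
      bounded_linear_compose[OF bounded_bilinear.bounded_linear_right[OF bounded_bilinear_matrix_mult]]) 

lemmas continuous_dag [continuous_intros] = bounded_linear.continuous_on[OF bounded_linear_dag]
lemmas tendsto_dag [tendsto_intros] = bounded_linear.tendsto[OF bounded_linear_dag]

lemma herm_dag: "H (A *v v) w = H v (dag A *v w)"
proof -
  have "conj_transpose (dag A) ** J = J ** A ** (J ** J)"
    by (simp only: dag_def conj_transpose_mult J_hermitian conj_transpose_conj_transpose matrix_mul_assoc)
  then show ?thesis
    using herm_adjoint_gen[of J A v "mat 1" w] herm_adjoint_gen[of J "mat 1" v "dag A" w]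
    by (simp add: J_square)
qed

lemma herm_dag_right: "H v (A *v w) = H (dag A *v v) w"
  by (simp add: herm_dag)

lemma U_iff: "g \<in> U \<longleftrightarrow> det g = 1 \<and> dag g ** g = mat 1"
proof -
  have "J ** (dag g ** g) = (J ** J) ** conj_transpose g ** J ** g"
    by (simp only: dag_def matrix_mul_assoc)
  then have "conj_transpose g ** J ** g = J ** (dag g ** g)"
    by (simp add: J_square)
  moreover have "J ** X = J \<longleftrightarrow> X = mat 1" for X
    using J_square by (metis matrix_mul_assoc matrix_mul_lid matrix_mul_rid)
  ultimately show ?thesis by (simp add: SU_def)
qed

lemma U_det: "g \<in> U \<Longrightarrow> det g = 1"
  and U_dag_left: "g \<in> U \<Longrightarrow> dag g ** g = mat 1"
  by (simp_all add: U_iff)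

lemma U_dag_right: "g \<in> U \<Longrightarrow> g ** dag g = mat 1"
  using U_dag_left matrix_left_right_inverse by blast

lemma U_herm: "g \<in> U \<Longrightarrow> H (g *v v) (g *v w) = H v w"
  by (simp add: herm_dag matrix_vector_mul_assoc U_dag_left)

lemma U_dag_cancel [simp]:
  "g \<in> U \<Longrightarrow> dag g *v (g *v v) = v" "g \<in> U \<Longrightarrow> g *v (dag g *v v) = v"
  by (simp_all add: matrix_vector_mul_assoc U_dag_left U_dag_right)

lemma U_cancel_mult [simp]:
  "g \<in> U \<Longrightarrow> dag g ** (g ** x) = x" "g \<in> U \<Longrightarrow> g ** (dag g ** x) = x"
  "g \<in> U \<Longrightarrow> x ** g ** dag g = x" "g \<in> U \<Longrightarrow> x ** dag g ** g = x"
  by (simp_all add: matrix_mul_assoc U_dag_left U_dag_right)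
    (simp_all add: U_dag_left U_dag_right flip: matrix_mul_assoc)

lemma mat_1_U [simp]: "mat 1 \<in> U"
  by (simp add: U_iff)

lemma mult_U [simp]: "g \<in> U \<Longrightarrow> h \<in> U \<Longrightarrow> g ** h \<in> U"
proof -
  assume "g \<in> U" "h \<in> U"
  moreover have "dag (g ** h) ** (g ** h) = dag h ** (dag g ** g) ** h"
    by (simp add: dag_mult matrix_mul_assoc)
  ultimately show "g ** h \<in> U"
    by (simp add: U_iff det_mul)
qed

lemma dag_U [simp]: "g \<in> U \<Longrightarrow> dag g \<in> U"
proof -
  assume g: "g \<in> U"
  have "det (dag g) * det g = det (dag g ** g)"
    by (simp add: det_mul)
  then have "det (dag g) = 1"
    using g by (simp add: U_dag_left U_det)
  then show ?thesis
    using U_dag_right[OF g] by (simp add: U_iff)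
qed

lemma mult_SU: "g \<otimes>\<^bsub>SU J\<^esub> h = g ** h" and one_SU: "\<one>\<^bsub>SU J\<^esub> = mat 1"
  by (simp_all add: SU_def)

lemma group_SU: "group (SU J)"
proof (rule groupI)
  fix g assume g: "g \<in> U"
  then show "\<exists>y\<in>U. y \<otimes>\<^bsub>SU J\<^esub> g = \<one>\<^bsub>SU J\<^esub>"
    unfolding mult_SU one_SU by (intro bexI[of _ "dag g"] U_dag_left dag_U)
qed (simp_all add: mult_SU one_SU matrix_mul_assoc)

lemma inv_SU: "g \<in> U \<Longrightarrow> inv\<^bsub>SU J\<^esub> g = dag g"
  by (intro group.inv_equality[OF group_SU]) (simp_all add: mult_SU one_SU U_dag_left)

lemma closed_U: "closed U"
proof -
  have "U = {g. det g = 1} \<inter> {g. dag g ** g = mat 1}"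
    by (auto simp: U_iff)
  moreover have "closed {g :: complex^'m^'m. det g = 1}"
    unfolding det_def by (intro closed_Collect_eq continuous_intros)
  moreover have "closed {g. dag g ** g = mat 1}"
    by (intro closed_Collect_eq continuous_intros)
  ultimately show ?thesis by auto
qed

section \<open>Null pairs: coordinates adapted to two boundary points\<close>

lemma null_pair_decomp:
  assumes "H a a = 0" "H b b = 0" "H a b = -1"
  obtains e where "v = (- H v b) *s a + (- H v a) *s b + e" "H e a = 0" "H e b = 0" "H a e = 0" "H b e = 0"
proof
  define e where "e = v - ((- H v b) *s a + (- H v a) *s b)"
  have ba: "H b a = -1"
    using H_commute[of b a] assms by simp
  show "v = (- H v b) *s a + (- H v a) *s b + e"
    by (simp add: e_def)
  show ea: "H e a = 0" and eb: "H e b = 0"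
    by (simp_all add: e_def herm_simps assms ba)
  show "H a e = 0" "H b e = 0"
    using ea eb H_eq_0_commute by blast+
qed

lemma null_pair_sum_negative:
  assumes "H a a = 0" "H b b = 0" "H a b = -1"
  shows "H (x *s a + y *s b) (x *s a + y *s b) = of_real (- 2 * Re (x * cnj y))"
proof -
  have "H b a = -1"
    using H_commute[of b a] assms by simp
  then have "H (x *s a + y *s b) (x *s a + y *s b) = - (x * cnj y + cnj (x * cnj y))"
    by (simp add: herm_simps assms)
  then show ?thesis
    by (simp only: complex_add_cnj) simp
qed

text \<open>The vector \<open>a + b\<close> is negative, and \<open>e\<close> is orthogonal to
  it.\<close>

lemma null_pair_perp_positive:
  assumes "H a a = 0" "H b b = 0" "H a b = -1" "H e a = 0" "H e b = 0" "e \<noteq> 0"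
  shows "0 < Re (H e e)"
proof (rule negative_orthogonal_positive)
  show "Re (H (1 *s a + 1 *s b) (1 *s a + 1 *s b)) < 0"
    using assms by (subst null_pair_sum_negative) auto
qed (use assms in \<open>simp_all add: herm_simps\<close>)

end

section \<open>Loxodromic elements\<close>

lemma ex_kernel_vector:
  fixes A :: "complex^'m^'m::finite"
  assumes "det A = 0"
  obtains v where "v \<noteq> 0" "A *v v = 0"
  using assms invertible_det_nz[of A] invertible_left_inverse[of A] matrix_left_invertible_ker[of A]
  by auto

lemma smult_mat_1_vector: "(\<chi> i j. if i = j then c else 0) *v v = c *s (v :: complex^'m::finite)"
  unfolding vec_eq_iff matrix_vector_mult_def
  by (simp add: if_distrib[of "\<lambda>x. x * _"] cong: if_cong)

text \<open>\<open>det (1 + x A)\<close> as a polynomial in \<open>x\<close>; its roots are the \<open>- 1 / c\<close> for the nonzero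
  eigenvalues \<open>c\<close> of \<open>A\<close>.\<close>

definition reverse_charpoly :: "complex^'m^'m::finite \<Rightarrow> complex poly" where
  "reverse_charpoly A = (\<Sum>\<sigma> | \<sigma> permutes (UNIV :: 'm set).
     [:of_int (sign \<sigma>):] * (\<Prod>i\<in>UNIV. [:if i = \<sigma> i then 1 else 0, A $ i $ \<sigma> i:]))"

lemma poly_reverse_charpoly:
  "poly (reverse_charpoly A) x = det (\<chi> i j. (if i = j then 1 else 0) + x * A $ i $ j)"
  by (simp add: reverse_charpoly_def det_def poly_sum poly_prod)

lemma degree_reverse_charpoly:
  fixes A :: "complex^'m^'m::finite"
  shows "degree (reverse_charpoly A) \<le> CARD('m)"
  unfolding reverse_charpoly_def
proof (rule degree_sum_le)
  fix \<sigma> :: "'m \<Rightarrow> 'm"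
  let ?f = "\<lambda>i. [:if i = \<sigma> i then 1 else 0, A $ i $ \<sigma> i:]"
  have "degree ([:of_int (sign \<sigma>):] * prod ?f UNIV) \<le> degree (prod ?f UNIV)"
    using degree_mult_le[of "[:of_int (sign \<sigma>):]" "prod ?f UNIV"] by simp
  also have "\<dots> \<le> (\<Sum>i\<in>UNIV. degree (?f i))"
    using degree_prod_sum_le[of UNIV ?f] by (simp add: comp_def)
  also have "\<dots> \<le> (\<Sum>i\<in>(UNIV :: 'm set). 1)"
    by (intro sum_mono) (simp add: degree_pCons_eq_if)
  finally show "degree ([:of_int (sign \<sigma>):] * prod ?f UNIV) \<le> CARD('m)"
    by simp
qed (simp add: finite_permutations)

lemma poly_reverse_charpoly_0: "poly (reverse_charpoly A) 0 = 1"
proof -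
  have "(\<chi> i j. (if i = j then 1 else 0) + 0 * A $ i $ j) = mat 1"
    by (simp add: mat_def)
  then show ?thesis
    unfolding poly_reverse_charpoly by simp
qed

text \<open>Differentiation at \<open>0\<close> removes one factor of each product. A permutation
  other than the identity moves at least two indices, so a factor without constant term remains, and
  only the identity contributes.\<close>

lemma coeff_1_reverse_charpoly:
  fixes A :: "complex^'m^'m::finite"
  shows "coeff (reverse_charpoly A) 1 = trace A"
proof -
  let ?f = "\<lambda>\<sigma> i. [:if i = \<sigma> i then 1 else 0, A $ i $ \<sigma> i:]"
  have summand: "poly (pderiv (prod (?f \<sigma>) UNIV)) 0 = (if \<sigma> = id then trace A else 0)"
    if \<sigma>: "\<sigma> permutes (UNIV :: 'm set)" for \<sigma>
  proof -
    have eq: "poly (pderiv (prod (?f \<sigma>) UNIV)) 0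
        = (\<Sum>i\<in>UNIV. (\<Prod>k\<in>UNIV - {i}. if k = \<sigma> k then 1 else 0) * A $ i $ \<sigma> i)"
      by (simp add: pderiv_prod poly_sum poly_prod pderiv_pCons mult.commute)
    show ?thesis
    proof (cases "\<sigma> = id")
      case True
      then show ?thesis
        unfolding eq by (simp add: trace_def)
    next
      case False
      then obtain k where k: "\<sigma> k \<noteq> k"
        by (metis eq_id_iff)
      have zero: "(\<Prod>k\<in>UNIV - {i}. if k = \<sigma> k then 1 else 0 :: complex) = 0" for i
      proof -
        have "\<exists>l\<in>UNIV - {i}. l \<noteq> \<sigma> l"
        proof (cases "i = k")
          case True
          have "\<sigma> (\<sigma> k) \<noteq> \<sigma> k"
            using k permutes_inj[OF \<sigma>] by (auto dest: injD)
          then show ?thesis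
            using k True by (intro bexI[of _ "\<sigma> k"]) auto
        qed (use k in force)
        then show ?thesis
          by (auto simp: prod_zero_iff)
      qed
      have "poly (pderiv (prod (?f \<sigma>) UNIV)) 0 = 0"
        unfolding eq by (intro sum.neutral ballI) (simp only: zero mult_zero_left)
      then show ?thesis
        using False by simp
    qed
  qed
  have coeff_1: "coeff p 1 = poly (pderiv p) 0" for p :: "complex poly"
    by (simp add: poly_0_coeff_0 coeff_pderiv)
  have "coeff (reverse_charpoly A) 1
      = (\<Sum>\<sigma> | \<sigma> permutes (UNIV :: 'm set). of_int (sign \<sigma>) * coeff (prod (?f \<sigma>) UNIV) 1)"
    by (simp add: reverse_charpoly_def coeff_sum)
  also have "\<dots> = (\<Sum>\<sigma> | \<sigma> permutes (UNIV :: 'm set). of_int (sign \<sigma>) * poly (pderiv (prod (?f \<sigma>) UNIV)) 0)"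
    by (simp only: coeff_1)
  also have "\<dots> = (\<Sum>\<sigma> | \<sigma> permutes (UNIV :: 'm set). if \<sigma> = id then trace A else 0)"
    by (intro sum.cong refl) (auto simp: summand sign_id)
  also have "\<dots> = trace A"
    by (simp add: sum.delta finite_permutations permutes_id)
  finally show ?thesis .
qed

text \<open>With roots \<open>r_i\<close>, the polynomial is the product of the
  \<open>1 - x / r_i\<close>, and its linear coefficient is minus the sum of the
  \<open>1 / r_i\<close>, each of modulus at most 1. The induction splits off one root at a time and
  keeps the constant term 1.\<close>

lemma coeff_1_le_degree:
  fixes q :: "complex poly"
  assumes "poly q 0 = 1" "\<And>x. poly q x = 0 \<Longrightarrow> 1 \<le> cmod x"
  shows "cmod (coeff q 1) \<le> degree q"
  using assms
proof (induction "degree q" arbitrary: q)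
  case 0
  then show ?case by (simp add: coeff_eq_0)
next
  case (Suc n)
  then have "\<not> constant (poly q)"
    by (simp add: constant_degree)
  then obtain r where r: "poly q r = 0"
    using fundamental_theorem_of_algebra by blast
  then obtain q' where q': "q = [:- r, 1:] * q'"
    by (metis dvdE poly_eq_0_iff_dvd)
  have r1: "1 \<le> cmod r" and r0: "r \<noteq> 0"
    using Suc.prems(2)[OF r] by auto
  define p where "p = smult (- r) q'"
  have qp: "q = [:1, - inverse r:] * p"
    using r0 by (simp add: q' p_def smult_add_right)
  have "q' \<noteq> 0"
    using Suc.hyps(2) q' by auto
  then have deg: "degree q = Suc (degree p)"
    using r0 by (simp add: q' p_def degree_mult_eq del: mult_pCons_left)
  have p0: "poly p 0 = 1"
    using Suc.prems(1) by (simp add: qp)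
  have "cmod (coeff p 1) \<le> degree p"
  proof (rule Suc.hyps(1))
    show "1 \<le> cmod x" if "poly p x = 0" for x
      using Suc.prems(2)[of x] that by (simp add: qp)
  qed (use deg Suc.hyps(2) p0 in auto)
  moreover have "coeff q 1 = coeff p 1 - inverse r"
    using p0 by (simp add: qp poly_0_coeff_0)
  moreover have "cmod (inverse r) \<le> 1"
    using r1 r0 by (simp add: norm_inverse inverse_le_1_iff)
  ultimately have "cmod (coeff q 1) \<le> real (degree p) + 1"
    by (metis norm_triangle_ineq4 add_mono order_trans)
  then show ?case by (simp add: deg)
qed

text \<open>A root of \<open>reverse_charpoly A\<close> in the open unit disc is
  \<open>- 1 / c\<close> for an eigenvalue \<open>c\<close> with \<open>1 < cmod c\<close>; without
  such a root \<open>coeff_1_le_degree\<close> bounds the trace.\<close>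

lemma ex_large_eigenvalue:
  fixes A :: "complex^'m^'m::finite"
  assumes "real CARD('m) < cmod (trace A)"
  obtains c v where "1 < cmod c" "v \<noteq> 0" "A *v v = c *s v"
proof -
  let ?q = "reverse_charpoly A"
  have "\<not> cmod (coeff ?q 1) \<le> degree ?q"
    unfolding coeff_1_reverse_charpoly using assms degree_reverse_charpoly[of A] by linarith
  then obtain x where x: "poly ?q x = 0" "cmod x < 1"
    using coeff_1_le_degree[OF poly_reverse_charpoly_0] by (metis linorder_not_le)
  have x0: "x \<noteq> 0"
    using x poly_reverse_charpoly_0[of A] by auto
  obtain v where v: "v \<noteq> 0" "(\<chi> i j. (if i = j then 1 else 0) + x * A $ i $ j) *v v = 0"
    using ex_kernel_vector[OF x(1)[unfolded poly_reverse_charpoly]] .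
  have "(\<chi> i j. (if i = j then 1 else 0) + x * A $ i $ j) *v v = v + x *s (A *v v)"
    unfolding vec_eq_iff matrix_vector_mult_def
    by (simp add: distrib_right sum.distrib if_distrib[of "\<lambda>x. x * _"] sum_distrib_left mult.assoc cong: if_cong)
  then have "v + x *s (A *v v) = 0"
    using v by simp
  then have "A *v v = (- inverse x) *s v"
    using x0 by (simp add: vec_eq_iff field_simps add_eq_0_iff)
  moreover have "1 < cmod (- inverse x)"
    using x x0 by (simp add: norm_inverse one_less_inverse_iff)
  ultimately show thesis
    using that v by blast
qed

context hermitian_form
begin

lemma act_fixed_iff:
  assumes "g \<in> U" "v \<noteq> 0"
  shows "act g (cline v) = cline v \<longleftrightarrow> (\<exists>c. g *v v = c *s v)"
proof
  assume "act g (cline v) = cline v"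
  then have "g *v v \<in> cline v"
    by (metis act_cline self_mem_cline)
  then show "\<exists>c. g *v v = c *s v"
    by (simp add: mem_cline)
next
  assume "\<exists>c. g *v v = c *s v"
  then obtain c where c: "g *v v = c *s v" ..
  moreover have "dag g *v (g *v v) = v"
    using assms by simp
  ultimately have "c \<noteq> 0"
    using assms by auto
  then show "act g (cline v) = cline v"
    by (simp add: act_cline c cline_eqI)
qed

lemma hyp_space_iff: "cline v \<in> hyp_space J \<longleftrightarrow> Re (H v v) < 0"
proof
  assume "cline v \<in> hyp_space J"
  then obtain w where w: "cline v = cline w" "Re (H w w) < 0"
    by (auto simp: hyp_space_def)
  then have "w \<noteq> 0" by auto
  then obtain c where "w = c *s v"
    using cline_eq_iff w by metis
  then show "Re (H v v) < 0"
    using w by (auto simp: H_smult_self mult_less_0_iff simp del: of_real_power)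
qed (auto simp: hyp_space_def)

lemma hyp_boundary_iff:
  assumes "v \<noteq> 0"
  shows "cline v \<in> hyp_boundary J \<longleftrightarrow> H v v = 0"
proof
  assume "cline v \<in> hyp_boundary J"
  then obtain w where w: "cline v = cline w" "w \<noteq> 0" "H w w = 0"
    by (auto simp: hyp_boundary_def)
  then obtain c where "v = c *s w"
    using cline_eq_iff assms by metis
  then show "H v v = 0"
    using w by (auto simp: H_smult_self)
qed (use assms in \<open>auto simp: hyp_boundary_def\<close>)

lemma eigenvectors_herm:
  assumes "g \<in> U" "g *v v = c *s v" "g *v w = d *s w" "H v w \<noteq> 0"
  shows "c * cnj d = 1"
  using U_herm[OF assms(1), of v w] assms by (simp add: herm_simps mult.commute)

text \<open>An eigenvector that pairs nontrivially with both \<open>a\<close> and \<open>b\<close>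
  would force the eigenvalues \<open>\<kappa>\<close> and \<open>\<mu>\<close> to be equal, hence of
  unit modulus. So it is orthogonal to one of them, and being nonpositive it is proportional to that
  one.\<close>

lemma null_pair_fixed:
  assumes g: "g \<in> U" and ab: "H a a = 0" "H b b = 0" "H a b = -1"
    and eig: "g *v a = \<kappa> *s a" "g *v b = \<mu> *s b" and \<kappa>: "cmod \<kappa> \<noteq> 1"
    and v: "g *v v = c *s v" "Re (H v v) \<le> 0"
  shows "(\<exists>d. v = d *s a) \<or> (\<exists>d. v = d *s b)"
proof -
  have nz: "a \<noteq> 0" "b \<noteq> 0"
    using ab by auto
  have \<kappa>\<mu>: "\<kappa> * cnj \<mu> = 1"
    using eigenvectors_herm[OF g eig] ab by simp
  have "H v a = 0 \<or> H v b = 0"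
  proof (rule ccontr)
    assume "\<not> ?thesis"
    then have "c * cnj \<kappa> = 1" "c * cnj \<mu> = 1"
      using eigenvectors_herm[OF g v(1)] eig by blast+
    then have "cnj \<kappa> = cnj \<mu>"
      by (metis mult_cancel_left mult_zero_left zero_neq_one)
    then have "\<kappa> * cnj \<kappa> = 1"
      using \<kappa>\<mu> by simp
    then show False
      using \<kappa> cmod_eq_1I by blast
  qed
  then show ?thesis
    using nonpos_orthogonal_proportional[of a v] nonpos_orthogonal_proportional[of b v] nz ab v H_eq_0_commute
    by auto
qed

lemma loxodromicI:
  assumes g: "g \<in> U" and ab: "H a a = 0" "H b b = 0" "H a b = -1"
    and eig: "g *v a = \<kappa> *s a" "g *v b = \<mu> *s b" and \<kappa>: "cmod \<kappa> \<noteq> 1"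
  shows "loxodromic J g" and "{x \<in> hyp_boundary J. act g x = x} = {cline a, cline b}"
proof -
  have nz: "a \<noteq> 0" "b \<noteq> 0"
    using ab by auto
  have fixed: "(\<exists>d. v = d *s a) \<or> (\<exists>d. v = d *s b)" if "act g (cline v) = cline v" "v \<noteq> 0" "Re (H v v) \<le> 0" for v
    using that null_pair_fixed[OF g ab eig \<kappa>] act_fixed_iff[OF g] by blast
  have noH: "\<not> (\<exists>x\<in>hyp_space J. act g x = x)"
  proof
    assume "\<exists>x\<in>hyp_space J. act g x = x"
    then obtain v where v: "act g (cline v) = cline v" "Re (H v v) < 0"
      by (auto simp: hyp_space_def)
    then have "v \<noteq> 0" by auto
    then have "H v v = 0"
      using fixed[OF v(1)] v(2) ab by (auto simp: herm_simps)
    then show False using v by simp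
  qed
  show eq: "{x \<in> hyp_boundary J. act g x = x} = {cline a, cline b}"
  proof
    show "{x \<in> hyp_boundary J. act g x = x} \<subseteq> {cline a, cline b}"
    proof
      fix x assume "x \<in> {x \<in> hyp_boundary J. act g x = x}"
      then obtain v where v: "x = cline v" "v \<noteq> 0" "H v v = 0" "act g (cline v) = cline v"
        by (auto simp: hyp_boundary_def)
      then obtain d where "v = d *s a \<or> v = d *s b"
        using fixed[of v] by auto
      then show "x \<in> {cline a, cline b}"
        using v cline_eqI[of d a] cline_eqI[of d b] by (cases "d = 0") auto
    qed
    show "{cline a, cline b} \<subseteq> {x \<in> hyp_boundary J. act g x = x}"
      using nz ab eig by (auto simp: hyp_boundary_iff act_fixed_iff[OF g])
  qed
  have "cline a \<noteq> cline b"
    using cline_eq_iff[OF nz(1), of b] ab by (auto simp: herm_simps)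
  then show "loxodromic J g"
    unfolding loxodromic_def eq using g noH by simp
qed

lemma null_pair_exists:
  assumes "a \<noteq> 0" "H a a = 0" "H b b = 0" "\<nexists>c. b = c *s a"
  obtains c where "c \<noteq> 0" "H a (c *s b) = -1" "H (c *s b) (c *s b) = 0"
proof -
  have "H a b \<noteq> 0"
    using null_nonorthogonal assms by blast
  then show thesis
    using that[of "- 1 / cnj (H a b)"] assms by (simp add: herm_simps)
qed

lemma loxodromicE:
  assumes "loxodromic J g"
  obtains a b \<kappa> \<mu> where "g \<in> U" "H a a = 0" "H b b = 0" "H a b = -1"
    "g *v a = \<kappa> *s a" "g *v b = \<mu> *s b" "1 < cmod \<kappa>" "\<kappa> * cnj \<mu> = 1" "cmod \<mu> < 1"
proof -
  have g: "g \<in> U" and noH: "\<not> (\<exists>x\<in>hyp_space J. act g x = x)"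
    and card: "card {x \<in> hyp_boundary J. act g x = x} = 2"
    using assms by (auto simp: loxodromic_def)
  obtain x y where xy: "{x \<in> hyp_boundary J. act g x = x} = {x, y}" "x \<noteq> y"
    using card by (auto simp: card_2_iff)
  then have "x \<in> hyp_boundary J" "act g x = x" "y \<in> hyp_boundary J" "act g y = y"
    by auto
  then obtain a b0 where a: "x = cline a" "a \<noteq> 0" "H a a = 0" "act g (cline a) = cline a"
    and b0: "y = cline b0" "b0 \<noteq> 0" "H b0 b0 = 0" "act g (cline b0) = cline b0"
    by (auto simp: hyp_boundary_def)
  have nprop: "\<nexists>c. b0 = c *s a"
    using xy a b0 cline_eq_iff[of b0 a] by auto
  obtain c where c: "c \<noteq> 0" "H a (c *s b0) = -1" "H (c *s b0) (c *s b0) = 0"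
    using null_pair_exists a b0 nprop by metis
  define b where "b = c *s b0"
  obtain \<kappa> where \<kappa>: "g *v a = \<kappa> *s a"
    using act_fixed_iff[OF g] a by auto
  obtain \<mu> where "g *v b0 = \<mu> *s b0"
    using act_fixed_iff[OF g] b0 by auto
  then have \<mu>: "g *v b = \<mu> *s b"
    by (simp add: b_def vector_scalar_commute vector_smult_assoc mult.commute)
  have ab: "H a a = 0" "H b b = 0" "H a b = -1" and ba: "H b a = -1"
    using a c H_commute[of b a] by (simp_all add: b_def)
  have prod: "\<kappa> * cnj \<mu> = 1"
    using eigenvectors_herm[OF g \<kappa> \<mu>] ab by simp
  then have prod': "\<mu> * cnj \<kappa> = 1"
    by (metis complex_cnj_cnj complex_cnj_mult complex_cnj_one mult.commute)
  have norm: "cmod \<kappa> * cmod \<mu> = 1"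
    using prod by (metis norm_mult complex_mod_cnj norm_one)
  consider "cmod \<kappa> = 1" | "1 < cmod \<kappa>" | "cmod \<kappa> < 1" by linarith
  then show thesis
  proof cases
    \<comment> \<open>Here the two eigenvalues coincide, so \<open>a + b\<close> is a negative
      eigenvector, which gives a fixed point inside hyperbolic space.\<close>
    case 1
    then have "\<kappa> * cnj \<kappa> = 1"
      by (simp add: complex_norm_square[symmetric])
    then have "\<mu> = \<kappa>"
      using prod' by (metis mult.commute mult_cancel_right mult_zero_right zero_neq_one)
    then have "g *v (1 *s a + 1 *s b) = \<kappa> *s (1 *s a + 1 *s b)"
      using \<kappa> \<mu> by (simp add: matrix_vector_right_distrib vector_add_ldistrib)
    moreover have neg: "Re (H (1 *s a + 1 *s b) (1 *s a + 1 *s b)) < 0"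
      by (subst null_pair_sum_negative[OF ab]) simp
    moreover have "1 *s a + 1 *s b \<noteq> 0"
      using neg by force
    ultimately have "act g (cline (1 *s a + 1 *s b)) = cline (1 *s a + 1 *s b)"
      "cline (1 *s a + 1 *s b) \<in> hyp_space J"
      using act_fixed_iff[OF g] hyp_space_iff by blast+
    then show thesis using noH by blast
  next
    case 2
    have "cmod \<mu> < 1"
    proof (rule ccontr)
      assume "\<not> cmod \<mu> < 1"
      then have "1 * 1 < cmod \<kappa> * cmod \<mu>"
        using 2 by (intro mult_less_le_imp_less) auto
      then show False using norm by simp
    qed
    then show thesis
      using that[OF g ab \<kappa> \<mu>] 2 prod by simp
  next
    case 3
    have "1 < cmod \<mu>"
    proof (rule ccontr)
      assume "\<not> 1 < cmod \<mu>"
      then have "cmod \<kappa> * cmod \<mu> \<le> cmod \<kappa> * 1"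
        by (intro mult_left_mono) auto
      then show False using norm 3 by simp
    qed
    then show thesis
      using that[OF g ab(2,1) ba \<mu> \<kappa>] 3 prod' by simp
  qed
qed

text \<open>The spectrum is symmetric under reflection in the unit circle: if \<open>g - c\<close>
  is singular, so is its adjoint, which yields an eigenvector for \<open>1 / cnj c\<close>.
  Eigenvectors for eigenvalues off the unit circle are null, so the two span a fixed null
  pair.\<close>

lemma loxodromic_if_large_trace:
  assumes g: "g \<in> U" and tr: "real CARD('m) < cmod (trace g)"
  shows "loxodromic J g"
proof -
  obtain c v where c: "1 < cmod c" and v: "v \<noteq> 0" "g *v v = c *s v"
    using ex_large_eigenvalue[OF tr] .
  define C :: "complex \<Rightarrow> complex^'m^'m" where "C = (\<lambda>c. \<chi> i j. if i = j then c else 0)"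
  have C: "C c *v w = c *s w" for c w
    by (simp add: C_def smult_mat_1_vector)
  have "det (g - C c) = 0"
  proof (rule ccontr)
    assume "det (g - C c) \<noteq> 0"
    then have "\<forall>x. (g - C c) *v x = 0 \<longrightarrow> x = 0"
      using invertible_det_nz invertible_left_inverse matrix_left_invertible_ker by metis
    moreover have "(g - C c) *v v = 0"
      using v C by (simp add: matrix_vector_mult_diff_rdistrib)
    ultimately show False using v by blast
  qed
  then have "det (dag (g - C c)) = 0"
    by (simp add: dag_def det_mul det_conj_transpose)
  then obtain w where w: "w \<noteq> 0" "dag (g - C c) *v w = 0"
    using ex_kernel_vector by blast
  have "H u (dag g *v w - cnj c *s w) = 0" for u
  proof -
    have "H ((g - C c) *v u) w = 0"
      using w by (simp add: herm_dag)
    then show ?thesis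
      by (simp add: herm_simps matrix_vector_mult_diff_rdistrib C herm_dag)
  qed
  then have "dag g *v w = cnj c *s w"
    using herm_nondegenerate[of "dag g *v w - cnj c *s w"] by simp
  then have "g *v (dag g *v w) = cnj c *s (g *v w)"
    by (simp add: vector_scalar_commute)
  then have gw: "g *v w = inverse (cnj c) *s w"
    using g c by (auto simp: vec_eq_iff field_simps)
  have null: "H u u = 0" if "g *v u = d *s u" "cmod d \<noteq> 1" for u d
  proof (rule ccontr)
    assume "H u u \<noteq> 0"
    then have "d * cnj d = 1"
      using eigenvectors_herm[OF g that(1) that(1)] by simp
    then show False
      using that cmod_eq_1I by blast
  qed
  have nv: "H v v = 0"
    using null v c by simp
  have nw: "H w w = 0"
    using null[OF gw] c by (simp add: norm_inverse)
  have nprop: "\<nexists>d. w = d *s v"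
  proof
    assume "\<exists>d. w = d *s v"
    then obtain d where d: "w = d *s v" ..
    then have "g *v w = c *s w"
      using v by (simp add: vector_scalar_commute vector_smult_assoc mult.commute)
    then have "c = inverse (cnj c)"
      using gw w by simp
    then have "cmod c = inverse (cmod c)"
      by (metis norm_inverse complex_mod_cnj)
    then show False
      using c by (metis inverse_less_1_iff less_asym' not_less_iff_gr_or_eq)
  qed
  obtain k where k: "k \<noteq> 0" "H v (k *s w) = -1" "H (k *s w) (k *s w) = 0"
    using null_pair_exists[OF v(1) nv nw nprop] .
  moreover have "g *v (k *s w) = inverse (cnj c) *s (k *s w)"
    by (simp add: gw vector_scalar_commute vector_smult_assoc mult.commute)
  ultimately show ?thesis
    using loxodromicI(1)[OF g nv k(3,2) v(2), of "inverse (cnj c)"] c by (metis less_irrefl)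
qed

end

section \<open>Totally geodesic subspaces\<close>

context hermitian_form
begin

lemma hyp_dist_cline:
  assumes "H v v = -1" "H w w = -1"
  shows "hyp_dist J (cline v) (cline w) = 2 * arcosh (cmod (H v w))"
proof -
  define v' where "v' = (SOME u. u \<in> cline v \<and> u \<noteq> 0)"
  define w' where "w' = (SOME u. u \<in> cline w \<and> u \<noteq> 0)"
  have "v \<noteq> 0" "w \<noteq> 0"
    using assms by auto
  then have "v' \<in> cline v \<and> v' \<noteq> 0" "w' \<in> cline w \<and> w' \<noteq> 0"
    unfolding v'_def w'_def
    using someI[of "\<lambda>u. u \<in> cline v \<and> u \<noteq> 0" v] someI[of "\<lambda>u. u \<in> cline w \<and> u \<noteq> 0" w] by auto
  then obtain c d where c: "v' = c *s v" "c \<noteq> 0" and d: "w' = d *s w" "d \<noteq> 0"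
    by (auto simp: mem_cline)
  have "Re (H v' v') * Re (H w' w') = (cmod c * cmod d)\<^sup>2"
    using assms by (simp add: c d H_smult_self power_mult_distrib del: of_real_power)
  then have "sqrt (Re (H v' v') * Re (H w' w')) = cmod c * cmod d"
    by simp
  moreover have "cmod (H v' w') = cmod c * cmod d * cmod (H v w)"
    by (simp add: c d herm_simps norm_mult)
  ultimately have "cmod (H v' w') / sqrt (Re (H v' v') * Re (H w' w')) = cmod (H v w)"
    using c d by simp
  then show ?thesis
    by (simp add: hyp_dist_def Let_def flip: v'_def w'_def)
qed

text \<open>The component \<open>u\<close> of \<open>w\<close> orthogonal to \<open>v\<close> has
  length \<open>|H v w|^2 - 1\<close>, and it is zero or positive. The plus sign in \<open>u\<close>
  comes from \<open>H v v = -1\<close>.\<close>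

lemma reverse_Cauchy_Schwarz:
  assumes v: "H v v = -1" and w: "H w w = -1"
  shows "1 \<le> cmod (H v w)" and "cmod (H v w) = 1 \<Longrightarrow> \<exists>c. w = c *s v"
proof -
  define u where "u = w + H w v *s v"
  have vw: "H v w = cnj (H w v)" by (rule H_commute)
  have uv: "H u v = 0"
    by (simp add: u_def herm_simps v)
  have "H u u = of_real ((cmod (H v w))\<^sup>2 - 1)"
    by (simp add: u_def herm_simps v w vw complex_norm_square algebra_simps del: of_real_power)
  then have uu: "Re (H u u) = (cmod (H v w))\<^sup>2 - 1"
    by simp
  have dich: "u = 0 \<or> 0 < Re (H u u)"
    using negative_orthogonal_positive[of v u] uv v by auto
  then have "1 \<le> (cmod (H v w))\<^sup>2"
    using uu by auto
  then show "1 \<le> cmod (H v w)"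
    using power2_le_imp_le[of 1 "cmod (H v w)"] by simp
  assume "cmod (H v w) = 1"
  then have "u = 0"
    using dich uu by auto
  then have "w = (- H w v) *s v"
    by (simp add: u_def eq_neg_iff_add_eq_0)
  then show "\<exists>c. w = c *s v" ..
qed

lemma cosh_half_hyp_dist:
  assumes "H v v = -1" "H w w = -1"
  shows "cmod (H v w) = cosh (hyp_dist J (cline v) (cline w) / 2)"
  using reverse_Cauchy_Schwarz(1)[OF assms] by (simp add: hyp_dist_cline[OF assms])

lemma normalize_negative:
  assumes "Re (H v v) < 0"
  obtains r :: real where "0 < r" "H (of_real r *s v) (of_real r *s v) = -1"
proof
  define r where "r = 1 / sqrt (- Re (H v v))"
  show "0 < r"
    using assms by (simp add: r_def)
  have "r\<^sup>2 * Re (H v v) = -1"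
    using assms by (simp add: r_def power_divide)
  then have "of_real (r\<^sup>2) * H v v = -1"
    by (subst H_self) (metis of_real_mult of_real_1 of_real_minus)
  then show "H (of_real r *s v) (of_real r *s v) = -1"
    by (simp add: herm_simps power2_eq_square mult.assoc)
qed

lemma hyp_space_normalized:
  assumes "x \<in> hyp_space J"
  obtains v where "x = cline v" "H v v = -1"
proof -
  obtain v where v: "x = cline v" "Re (H v v) < 0"
    using assms by (auto simp: hyp_space_def)
  obtain r :: real where "0 < r" "H (of_real r *s v) (of_real r *s v) = -1"
    using normalize_negative[OF v(2)] .
  then show thesis
    using that[of "of_real r *s v"] v cline_eqI[of "of_real r" v] by simp
qed

lemma ex_phase: "\<exists>c. cmod c = 1 \<and> c * z = - of_real (cmod z)"
proof (cases "z = 0")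
  case False
  have "cnj z * z = of_real (cmod z) * of_real (cmod z)"
    by (metis complex_norm_square mult.commute power2_eq_square of_real_mult)
  then show ?thesis
    using False by (intro exI[of _ "- cnj z / of_real (cmod z)"]) (simp add: norm_divide)
qed (intro exI[of _ 1], simp)

text \<open>A phase that makes the product real is what confines the geodesic through two points to
  the real span of their representatives.\<close>

lemma hyp_space_aligned:
  assumes "x \<in> hyp_space J" "H w w = -1"
  obtains v where "x = cline v" "H v v = -1" "H v w = - of_real (cmod (H v w))"
proof -
  obtain v where v: "x = cline v" "H v v = -1"
    using hyp_space_normalized[OF assms(1)] .
  obtain c where c: "cmod c = 1" "c * H v w = - of_real (cmod (H v w))"
    using ex_phase by blast
  have "c \<noteq> 0" using c by auto
  show thesis
  proof (rule that)
    show "x = cline (c *s v)"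
      using v cline_eqI[OF \<open>c \<noteq> 0\<close>, of v] by simp
    show "H (c *s v) (c *s v) = -1"
      using v c by (simp add: H_smult_self)
    show "H (c *s v) w = - of_real (cmod (H (c *s v) w))"
      using c by (simp add: herm_simps norm_mult)
  qed
qed

text \<open>With \<open>e\<close> the component of a point \<open>u\<close> of the geodesic orthogonal to \<open>v\<close> and \<open>w\<close>, additivity of
  the distances and the addition theorem for \<open>cosh\<close> give \<open>\<langle>e, e\<rangle> \<le> 0\<close>, hence \<open>e = 0\<close>.\<close>

lemma geodesic_in_real_span:
  assumes \<gamma>: "hyp_geodesic J \<gamma>" and "s \<noteq> t"
    and v: "\<gamma> s = cline v" "H v v = -1" and w: "\<gamma> t = cline w" "H w w = -1"
    and vw: "H v w = - of_real (cmod (H v w))"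
  obtains \<alpha> \<beta> :: real where "\<gamma> r = cline (of_real \<alpha> *s v + of_real \<beta> *s w)"
    "H (of_real \<alpha> *s v + of_real \<beta> *s w) (of_real \<alpha> *s v + of_real \<beta> *s w) = -1"
proof -
  have "\<gamma> r \<in> hyp_space J"
    using \<gamma> by (auto simp: hyp_geodesic_def)
  then obtain u where u: "\<gamma> r = cline u" "H u u = -1" and uv: "H u v = - of_real (cmod (H u v))"
    using hyp_space_aligned[OF _ v(2)] by metis
  have dist: "hyp_dist J (\<gamma> i) (\<gamma> j) = \<bar>i - j\<bar>" for i j
    using \<gamma> by (auto simp: hyp_geodesic_def)
  define a where "a = (r - s) / 2"
  define c where "c = (s - t) / 2"
  define x y z where "x = cosh a" and "y = cosh (a + c)" and "z = cosh c"
  have cosh_half: "cosh (\<bar>d\<bar> / 2) = cosh (d / 2)" for d :: real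
    by (cases "0 \<le> d") auto
  have "cmod (H u v) = x"
    using cosh_half_hyp_dist[OF u(2) v(2)] by (simp add: u(1)[symmetric] v(1)[symmetric] dist cosh_half x_def a_def)
  then have uv: "H u v = - of_real x"
    using uv by simp
  have "cmod (H v w) = z"
    using cosh_half_hyp_dist[OF v(2) w(2)] by (simp add: w(1)[symmetric] v(1)[symmetric] dist cosh_half z_def c_def)
  then have vw: "H v w = - of_real z"
    using vw by simp
  define p where "p = - H u w"
  have ac: "a + c = (r - t) / 2"
    by (simp add: a_def c_def field_simps)
  have p: "cmod p = y"
    using cosh_half_hyp_dist[OF u(2) w(2)]
    by (simp add: u(1)[symmetric] w(1)[symmetric] dist cosh_half y_def ac p_def)
  have uw: "H u w = - p"
    by (simp add: p_def)
  have wv: "H w v = - of_real z" and vu: "H v u = - of_real x" and wu: "H w u = - cnj p"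
    using H_commute[of w v] H_commute[of v u] H_commute[of w u] by (simp_all add: uv vw uw)
  have "sinh c \<noteq> 0"
    using \<open>s \<noteq> t\<close> by (simp add: c_def)
  then have z1: "0 < z\<^sup>2 - 1"
    by (simp add: z_def cosh_square_eq)
  then have z1c: "(of_real z)\<^sup>2 - 1 \<noteq> (0 :: complex)"
    by (metis of_real_power of_real_1 of_real_diff of_real_eq_0_iff less_irrefl)
  \<comment> \<open>The addition theorem with the product of the two sinh values squared;
    rearranged, it says that the Gram determinant of three collinear points vanishes.\<close>
  have "(y - x * z)\<^sup>2 = (x\<^sup>2 - 1) * (z\<^sup>2 - 1)"
    by (simp add: x_def y_def z_def cosh_add cosh_square_eq power_mult_distrib)
  then have identity: "2 * x * y * z = x\<^sup>2 + y\<^sup>2 + (z\<^sup>2 - 1)"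
    by (simp add: power2_eq_square algebra_simps)
  \<comment> \<open>Cramer's rule for the orthogonal projection of \<open>u\<close> to the span of
    \<open>v\<close> and \<open>w\<close>. Up to sign \<open>D\<close> is the Gram determinant,
    nonzero because \<open>s \<noteq> t\<close>.\<close>
  define D :: complex where "D = (of_real z)\<^sup>2 - 1"
  define \<alpha> where "\<alpha> = (of_real z * p - of_real x) / D"
  define \<beta> where "\<beta> = (of_real z * of_real x - p) / D"
  have D: "D \<noteq> 0" using z1c by (simp add: D_def)
  define e where "e = u - (\<alpha> *s v + \<beta> *s w)"
  have "\<alpha> * D + of_real z * (\<beta> * D) = of_real x * D"
    using D by (simp add: \<alpha>_def \<beta>_def) (simp add: D_def power2_eq_square algebra_simps)
  then have 1: "\<alpha> + of_real z * \<beta> = of_real x"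
    using D by (metis distrib_right mult.assoc mult_cancel_right)
  have "of_real z * (\<alpha> * D) + \<beta> * D = p * D"
    using D by (simp add: \<alpha>_def \<beta>_def) (simp add: D_def power2_eq_square algebra_simps)
  then have 2: "of_real z * \<alpha> + \<beta> = p"
    using D by (metis distrib_right mult.assoc mult_cancel_right)
  have ev: "H e v = 0"
    using 1 by (simp add: e_def herm_simps v uv wv algebra_simps)
  have ew: "H e w = 0"
    using 2 by (simp add: e_def herm_simps w uw vw algebra_simps)
  have "H e e = H e (u - (\<alpha> *s v + \<beta> *s w))"
    by (simp add: e_def)
  also have "\<dots> = H e u"
    using ev ew by (simp add: herm_simps)
  also have "\<dots> = -1 + \<alpha> * of_real x + \<beta> * cnj p"
    by (simp add: e_def herm_simps u vu wu)
  finally have he: "H e e = -1 + \<alpha> * of_real x + \<beta> * cnj p" .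
  have "H e e * D = - D + (\<alpha> * D) * of_real x + (\<beta> * D) * cnj p"
    unfolding he by (simp add: algebra_simps)
  then have "H e e * D = - D + (of_real z * p - of_real x) * of_real x + (of_real z * of_real x - p) * cnj p"
    using D by (simp add: \<alpha>_def \<beta>_def)
  also have "\<dots> = of_real (- (z\<^sup>2 - 1) - x\<^sup>2 - y\<^sup>2) + of_real (z * x) * (p + cnj p)"
    using complex_norm_square[of p] by (simp add: p D_def power2_eq_square algebra_simps)
  also have "\<dots> = of_real (2 * z * x * Re p - (x\<^sup>2 + y\<^sup>2 + (z\<^sup>2 - 1)))"
    by (simp only: complex_add_cnj of_real_mult[symmetric] of_real_add[symmetric]) (simp add: algebra_simps)
  also have "\<dots> = of_real (2 * z * x * (Re p - y))"
    unfolding identity[symmetric] by (rule arg_cong[of _ _ of_real]) (simp add: algebra_simps)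
  also have "D = of_real (z\<^sup>2 - 1)"
    by (simp add: D_def)
  finally have ee: "Re (H e e) * (z\<^sup>2 - 1) = 2 * z * x * (Re p - y)"
    by (metis H_self of_real_eq_iff of_real_mult)
  have zx: "0 < z * x"
    by (simp add: z_def x_def cosh_real_pos)
  have "Re p \<le> y"
    using p complex_Re_le_cmod by blast
  then have "Re (H e e) * (z\<^sup>2 - 1) \<le> 0"
    unfolding ee using zx by (intro mult_nonneg_nonpos) (simp_all add: mult.commute)
  then have "Re (H e e) \<le> 0"
    using z1 by (simp add: mult_le_0_iff)
  then have e0: "e = 0"
    using negative_orthogonal_positive[of v e] ev v by force
  \<comment> \<open>Equality in \<open>Re p \<le> cmod p\<close> makes \<open>p\<close> real, and
    with it both coefficients; so the span is real and not merely complex.\<close>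
  then have "Re p = y"
    using ee zx by auto
  then have "Im p = 0"
    using p cmod_power2[of p] by simp
  then have "p = of_real y"
    using \<open>Re p = y\<close> by (simp add: complex_eq_iff)
  then have "\<alpha> = of_real ((z * y - x) / (z\<^sup>2 - 1))" "\<beta> = of_real ((z * x - y) / (z\<^sup>2 - 1))"
    by (simp_all add: \<alpha>_def \<beta>_def D_def)
  moreover have "u = \<alpha> *s v + \<beta> *s w"
    using e0 by (simp add: e_def)
  ultimately show thesis
    using that u by metis
qed

text \<open>By \<open>geodesic_in_real_span\<close> a geodesic through two points of
  \<open>S\<close> consists of such real combinations, so no geodesic ever has to be
  constructed.\<close>

lemma totally_geodesicI:
  assumes "S \<noteq> {}" "S \<subseteq> hyp_space J"
    and span: "\<And>v w \<alpha> \<beta>. cline v \<in> S \<Longrightarrow> cline w \<in> S \<Longrightarrow> H v v = -1 \<Longrightarrow> H w w = -1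
      \<Longrightarrow> H v w = - of_real (cmod (H v w))
      \<Longrightarrow> H (of_real \<alpha> *s v + of_real \<beta> *s w) (of_real \<alpha> *s v + of_real \<beta> *s w) = -1
      \<Longrightarrow> cline (of_real \<alpha> *s v + of_real \<beta> *s w) \<in> S"
  shows "totally_geodesic J S"
  unfolding totally_geodesic_def
proof (intro conjI assms allI impI)
  fix \<gamma> s t assume A: "hyp_geodesic J \<gamma> \<and> s \<noteq> t \<and> \<gamma> s \<in> S \<and> \<gamma> t \<in> S"
  then obtain w where w: "\<gamma> t = cline w" "H w w = -1"
    using hyp_space_normalized assms(2) by blast
  obtain v where v: "\<gamma> s = cline v" "H v v = -1" "H v w = - of_real (cmod (H v w))"
    using A hyp_space_aligned[OF _ w(2), of "\<gamma> s"] assms(2) by blast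
  show "range \<gamma> \<subseteq> S"
  proof
    fix y assume "y \<in> range \<gamma>"
    then obtain r where y: "y = \<gamma> r" by blast
    obtain \<alpha> \<beta> :: real where "\<gamma> r = cline (of_real \<alpha> *s v + of_real \<beta> *s w)"
      "H (of_real \<alpha> *s v + of_real \<beta> *s w) (of_real \<alpha> *s v + of_real \<beta> *s w) = -1"
      using geodesic_in_real_span[of \<gamma> s t v w r] A v w by blast
    then show "y \<in> S"
      using span[of v w \<alpha> \<beta>] A v w y by metis
  qed
qed

section \<open>Consequences of Zariski density\<close>

lemma dense_mem_U: "zariski_dense_subgroup J G \<Longrightarrow> g \<in> G \<Longrightarrow> g \<in> U"
  and dense_mult: "zariski_dense_subgroup J G \<Longrightarrow> g \<in> G \<Longrightarrow> h \<in> G \<Longrightarrow> g ** h \<in> G"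
  and dense_one: "zariski_dense_subgroup J G \<Longrightarrow> mat 1 \<in> G"
  using subgroup.mem_carrier[of G "SU J" g] subgroup.m_closed[of G "SU J" g h] subgroup.one_closed[of G "SU J"]
  by (auto simp: zariski_dense_subgroup_def mult_SU one_SU)

lemma dense_dag: "zariski_dense_subgroup J G \<Longrightarrow> g \<in> G \<Longrightarrow> dag g \<in> G"
  using subgroup.m_inv_closed[of G "SU J" g] inv_SU[of g] dense_mem_U[of G g]
  by (auto simp: zariski_dense_subgroup_def)

lemma dense_no_fixed_point:
  assumes "zariski_dense_subgroup J G" "v \<noteq> 0" "Re (H v v) < 0 \<or> H v v = 0"
  shows "\<exists>g\<in>G. act g (cline v) \<noteq> cline v"
proof -
  have "cline v \<in> hyp_space J \<union> hyp_boundary J"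
    using assms hyp_space_iff hyp_boundary_iff by auto
  then show ?thesis
    using assms(1) unfolding zariski_dense_subgroup_def by blast
qed

text \<open>Inclusion suffices in the invariance hypothesis because \<open>G\<close> contains
  inverses.\<close>

lemma dense_no_invariant_subspace:
  assumes G: "zariski_dense_subgroup J G" and S: "totally_geodesic J S"
    and inv: "\<And>g x. g \<in> G \<Longrightarrow> x \<in> S \<Longrightarrow> act g x \<in> S"
  shows "S = hyp_space J"
proof (rule ccontr)
  assume "S \<noteq> hyp_space J"
  have "act g ` S = S" if g: "g \<in> G" for g
  proof
    show "act g ` S \<subseteq> S"
      using inv g by auto
    show "S \<subseteq> act g ` S"
    proof
      fix x assume x: "x \<in> S"
      have "x = act g (act (dag g) x)"
        using dense_mem_U[OF G g] by (simp add: act_act U_dag_right)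
      then show "x \<in> act g ` S"
        using inv[OF dense_dag[OF G g] x] by blast
    qed
  qed
  then have "\<exists>S. totally_geodesic J S \<and> S \<noteq> hyp_space J \<and> (\<forall>A\<in>G. act A ` S = S)"
    using S \<open>S \<noteq> hyp_space J\<close> by (intro exI[of _ S] conjI ballI)
  moreover have "\<not> (\<exists>S. totally_geodesic J S \<and> S \<noteq> hyp_space J \<and> (\<forall>A\<in>G. act A ` S = S))"
    using G unfolding zariski_dense_subgroup_def by (elim conjE)
  ultimately show False
    by (rule notE[rotated])
qed

text \<open>The negative lines in \<open>W\<close> form a nonempty invariant totally geodesic set,
  hence are all the negative lines. The negative cone is open, so \<open>W\<close> contains
  \<open>v + t e\<close> for every direction \<open>e\<close> and some \<open>t > 0\<close>, and
  therefore \<open>e\<close>.\<close>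

lemma dense_irreducible:
  assumes G: "zariski_dense_subgroup J G" and W: "vec.subspace W"
    and inv: "\<And>g w. g \<in> G \<Longrightarrow> w \<in> W \<Longrightarrow> g *v w \<in> W"
    and v: "v \<in> W" "Re (H v v) < 0"
  shows "W = UNIV"
proof -
  define S where "S = {cline w | w. w \<in> W \<and> Re (H w w) < 0}"
  have memS: "w \<in> W" if w: "cline w \<in> S" "w \<noteq> 0" for w
  proof -
    obtain u where u: "u \<in> W" "cline w = cline u"
      using w unfolding S_def by blast
    then obtain c where "w = c *s u"
      using cline_eq_iff w by metis
    then show ?thesis
      using u vec.subspace_scale[OF W] by auto
  qed
  have "totally_geodesic J S"
  proof (rule totally_geodesicI)
    show "S \<noteq> {}" "S \<subseteq> hyp_space J"
      using v by (auto simp: S_def hyp_space_def)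
    fix v w \<alpha> \<beta> assume vw: "cline v \<in> S" "cline w \<in> S" "H v v = -1" "H w w = -1"
      and neg: "H (of_real \<alpha> *s v + of_real \<beta> *s w) (of_real \<alpha> *s v + of_real \<beta> *s w) = -1"
    have "v \<noteq> 0" "w \<noteq> 0"
      using vw by auto
    then have "of_real \<alpha> *s v + of_real \<beta> *s w \<in> W"
      using vw memS W by (intro vec.subspace_add vec.subspace_scale) auto
    then show "cline (of_real \<alpha> *s v + of_real \<beta> *s w) \<in> S"
      using neg by (auto simp: S_def)
  qed
  moreover have "act g x \<in> S" if "g \<in> G" "x \<in> S" for g x
    using that inv U_herm[OF dense_mem_U[OF G that(1)]] by (fastforce simp: S_def act_cline)
  ultimately have S: "S = hyp_space J"
    using dense_no_invariant_subspace[OF G] by blast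
  have "open {x. Re (H x x) < 0}"
    by (intro open_Collect_less continuous_intros)
  then obtain \<epsilon> where \<epsilon>: "0 < \<epsilon>" "ball v \<epsilon> \<subseteq> {x. Re (H x x) < 0}"
    using v openE by blast
  have "e \<in> W" for e
  proof -
    define t where "t = \<epsilon> / (2 * (norm e + 1))"
    have t: "0 < t"
      using \<epsilon> by (simp add: t_def add_nonneg_pos)
    have "norm e < 2 * (norm e + 1)"
      using norm_ge_zero[of e] by (smt (verit))
    then have "t * norm e < \<epsilon>"
      using \<epsilon> by (simp add: t_def divide_less_eq add_nonneg_pos)
    then have "v + of_real t *s e \<in> ball v \<epsilon>"
      using t by (simp add: dist_norm norm_vector_smult)
    then have neg: "Re (H (v + of_real t *s e) (v + of_real t *s e)) < 0"
      using \<epsilon> by auto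
    then have "cline (v + of_real t *s e) \<in> S" "v + of_real t *s e \<noteq> 0"
      using S hyp_space_iff by auto
    then have "v + of_real t *s e \<in> W"
      using memS by blast
    then have "(1 / of_real t) *s ((v + of_real t *s e) - v) \<in> W"
      using v W by (intro vec.subspace_scale vec.subspace_diff)
    then show "e \<in> W"
      using t by (simp add: vector_smult_assoc)
  qed
  then show ?thesis by auto
qed

text \<open>If the orbit had only two points, the geodesic joining them would be an invariant
  totally geodesic set. It is not all of hyperbolic space, not even for
  \<open>n = 1\<close>.\<close>

lemma dense_boundary_orbit:
  assumes G: "zariski_dense_subgroup J G" and a: "a \<noteq> 0" "H a a = 0"
  obtains h1 h2 where "h1 \<in> G" "h2 \<in> G" "act h1 (cline a) \<noteq> cline a" "act h2 (cline a) \<noteq> cline a"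
    "act h1 (cline a) \<noteq> act h2 (cline a)"
proof (rule ccontr)
  note * = that
  assume "\<not> thesis"
  obtain h1 where h1: "h1 \<in> G" "act h1 (cline a) \<noteq> cline a"
    using dense_no_fixed_point[OF G] a by blast
  have h1U: "h1 \<in> U"
    using dense_mem_U[OF G h1(1)] .
  have orbit: "act h (cline a) = cline a \<or> act h (cline a) = act h1 (cline a)" if "h \<in> G" for h
    using *[of h1 h] that \<open>\<not> thesis\<close> h1 by metis
  define b0 where "b0 = h1 *v a"
  have b0: "H b0 b0 = 0" "cline b0 = act h1 (cline a)"
    using a by (simp_all add: b0_def U_herm[OF h1U] act_cline)
  have "\<nexists>c. b0 = c *s a"
    using act_fixed_iff[OF h1U a(1)] h1 by (simp add: b0_def)
  then obtain k where k: "k \<noteq> 0" "H a (k *s b0) = -1" "H (k *s b0) (k *s b0) = 0"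
    using null_pair_exists[OF a b0(1)] by blast
  define b where "b = k *s b0"
  have ab: "H a a = 0" "H b b = 0" "H a b = -1" and ba: "H b a = -1"
    using a k H_commute[of b a] by (simp_all add: b_def)
  have clb: "cline b = act h1 (cline a)"
    by (simp add: b_def cline_eqI[OF k(1)] b0)
  have b: "b \<noteq> 0" using ab by auto
  \<comment> \<open>The geodesic with end points \<open>[a]\<close> and \<open>[b]\<close>.\<close>
  define S where "S = {cline (of_real r *s a + of_real s *s b) | r s :: real. 0 < r \<and> 0 < s}"
  have neg: "Re (H (of_real r *s a + of_real s *s b) (of_real r *s a + of_real s *s b)) = - 2 * (r * s)" for r s :: real
    by (simp add: null_pair_sum_negative[OF ab])
  have memS: "\<exists>c r s. v = c *s (of_real r *s a + of_real s *s b) \<and> 0 < r \<and> 0 < s \<and> c \<noteq> 0"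
    if S: "cline v \<in> S" and v: "v \<noteq> 0" for v
  proof -
    obtain r s :: real where rs: "cline v = cline (of_real r *s a + of_real s *s b)" "0 < r" "0 < s"
      using S by (auto simp: S_def)
    then show ?thesis
      using cline_eq_iff[OF v] by metis
  qed
  have mem_S: "cline (of_real r *s a + of_real s *s b) \<in> S" if "0 < r" "0 < s" for r s :: real
    unfolding S_def using that by blast
  have "totally_geodesic J S"
  proof (rule totally_geodesicI)
    show "S \<noteq> {}"
      unfolding S_def using zero_less_one by blast
    show "S \<subseteq> hyp_space J"
      using neg by (auto simp: S_def hyp_space_iff)
    fix v w \<alpha> \<beta> assume vw: "cline v \<in> S" "cline w \<in> S" "H v v = -1" "H w w = -1"
      and Hvw: "H v w = - of_real (cmod (H v w))"
      and uu: "H (of_real \<alpha> *s v + of_real \<beta> *s w) (of_real \<alpha> *s v + of_real \<beta> *s w) = -1"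
    have "v \<noteq> 0" "w \<noteq> 0"
      using vw by auto
    then obtain c r s d r' s' where v: "v = c *s (of_real r *s a + of_real s *s b)" "0 < r" "0 < s" "c \<noteq> 0"
      and w: "w = d *s (of_real r' *s a + of_real s' *s b)" "0 < r'" "0 < s'" "d \<noteq> 0"
      using memS vw by metis
    \<comment> \<open>Because the representatives are aligned, \<open>c * cnj d\<close> is real, so
      \<open>c\<close> and \<open>d\<close> differ by a real factor \<open>k\<close>. Real
      combinations of \<open>v\<close> and \<open>w\<close> are then real combinations of
      \<open>a\<close> and \<open>b\<close> up to the common factor \<open>d\<close>.\<close>
    have "H v w = - (c * cnj d * of_real (r * s' + s * r'))"
      by (simp add: v w herm_simps ab ba algebra_simps)
    then have "c * cnj d * of_real (r * s' + s * r') = of_real (cmod (H v w))"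
      using Hvw by simp
    moreover have q: "of_real (r * s' + s * r') \<noteq> (0 :: complex)"
      unfolding of_real_eq_0_iff using v w by (metis add_pos_pos mult_pos_pos less_irrefl)
    ultimately have "c * cnj d = of_real (cmod (H v w)) / of_real (r * s' + s * r')"
      by (metis nonzero_mult_div_cancel_right)
    then have "c * cnj d = of_real (cmod (H v w) / (r * s' + s * r'))"
      by simp
    then obtain p :: real where p: "c * cnj d = of_real p" by blast
    have "c * (cnj d * d) = of_real p * d"
      using p by (simp add: mult.assoc[symmetric])
    moreover have "cnj d * d = of_real ((cmod d)\<^sup>2)"
      by (simp add: complex_norm_square mult.commute del: of_real_power)
    ultimately have "c * of_real ((cmod d)\<^sup>2) = of_real p * d"
      by simp
    moreover have "of_real ((cmod d)\<^sup>2) \<noteq> (0 :: complex)"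
      using w by simp
    ultimately have "c = of_real p * d / of_real ((cmod d)\<^sup>2)"
      by (metis nonzero_mult_div_cancel_right)
    then have "c = of_real (p / (cmod d)\<^sup>2) * d"
      by simp
    then obtain k :: real where k: "c = of_real k * d" by blast
    define X where "X = \<alpha> * k * r + \<beta> * r'"
    define Y where "Y = \<alpha> * k * s + \<beta> * s'"
    have eq: "of_real \<alpha> *s v + of_real \<beta> *s w = d *s (of_real X *s a + of_real Y *s b)"
      by (simp add: v w k X_def Y_def vec_eq_iff algebra_simps)
    have "Re (H (d *s (of_real X *s a + of_real Y *s b)) (d *s (of_real X *s a + of_real Y *s b))) < 0"
      using uu by (simp add: eq)
    then have "0 < X * Y"
      by (simp only: H_smult_self) (simp add: neg mult_less_0_iff zero_less_mult_iff)
    then consider "0 < X" "0 < Y" | "0 < -X" "0 < -Y"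
      by (auto simp: zero_less_mult_iff)
    then show "cline (of_real \<alpha> *s v + of_real \<beta> *s w) \<in> S"
    proof cases
      case 1
      then show ?thesis
        unfolding eq cline_eqI[OF w(4)] S_def by blast
    next
      case 2
      have "of_real X *s a + of_real Y *s b = (-1) *s (of_real (-X) *s a + of_real (-Y) *s b)"
        by (simp add: vec_eq_iff)
      then have "cline (of_real X *s a + of_real Y *s b) = cline (of_real (-X) *s a + of_real (-Y) *s b)"
        using cline_eqI[of "-1"] by (metis neg_equal_0_iff_equal one_neq_zero)
      then show ?thesis
        unfolding eq cline_eqI[OF w(4)] S_def using 2 by blast
    qed
  qed
  moreover have "act g x \<in> S" if g: "g \<in> G" and x: "x \<in> S" for g x
  proof -
    have gU: "g \<in> U" using dense_mem_U[OF G g] .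
    obtain r s :: real where rs: "x = cline (of_real r *s a + of_real s *s b)" "0 < r" "0 < s"
      using x by (auto simp: S_def)
    have inj: "act g y = act g z \<Longrightarrow> y = z" for y z
      by (metis act_act act_mat_1 U_dag_left[OF gU])
    have ga: "act g (cline a) \<in> {cline a, cline b}"
      using orbit[OF g] clb by auto
    have gb: "act g (cline b) \<in> {cline a, cline b}"
      using orbit[OF dense_mult[OF G g h1(1)]] clb by (auto simp: act_act)
    have nab: "cline a \<noteq> cline b"
      using h1 clb by simp
    \<comment> \<open>Numbers with \<open>\<mu> * cnj \<nu> = 1\<close> have the same argument;
      dividing by the common phase leaves positive coefficients.\<close>
    have polar: "cline (of_real r *s (\<mu> *s u) + of_real s *s (\<nu> *s u')) = cline (of_real (r * cmod \<mu>) *s u + of_real (s / cmod \<mu>) *s u')"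
      if "\<mu> * cnj \<nu> = 1" for \<mu> \<nu> u u'
    proof -
      have \<mu>: "\<mu> \<noteq> 0" using that by auto
      have "cnj \<mu> * \<nu> = 1"
        using that by (metis complex_cnj_cnj complex_cnj_mult complex_cnj_one)
      then have "\<mu> * (cnj \<mu> * \<nu>) = \<mu>" by simp
      then have "of_real ((cmod \<mu>)\<^sup>2) * \<nu> = \<mu>"
        by (simp only: complex_norm_square mult.assoc)
      then have \<nu>: "\<nu> = \<mu> / of_real (cmod \<mu>) * of_real (1 / cmod \<mu>)"
        using \<mu> by (simp add: field_simps power2_eq_square)
      have eq: "of_real r *s (\<mu> *s u) + of_real s *s (\<nu> *s u')
          = (\<mu> / of_real (cmod \<mu>)) *s (of_real (r * cmod \<mu>) *s u + of_real (s / cmod \<mu>) *s u')"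
        unfolding \<nu> using \<mu> by (simp add: vec_eq_iff algebra_simps)
      show ?thesis
        unfolding eq by (rule cline_eqI) (use \<mu> in simp)
    qed
    have "act g (cline a) \<noteq> act g (cline b)"
      using inj[of "cline a" "cline b"] nab by auto
    then consider (id) "act g (cline a) = cline a" "act g (cline b) = cline b"
      | (swap) "act g (cline a) = cline b" "act g (cline b) = cline a"
      using ga gb by auto
    then show ?thesis
    proof cases
      case id
      then obtain \<mu> \<nu> where eig: "g *v a = \<mu> *s a" "g *v b = \<nu> *s b"
        using act_fixed_iff[OF gU] a b by meson
      then have \<mu>\<nu>: "\<mu> * cnj \<nu> = 1"
        using eigenvectors_herm[OF gU eig] ab by simp
      then have "\<mu> \<noteq> 0" by auto
      have "act g x = cline (of_real (r * cmod \<mu>) *s a + of_real (s / cmod \<mu>) *s b)"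
        unfolding rs act_cline polar[OF \<mu>\<nu>, symmetric]
        by (simp add: matrix_vector_right_distrib vector_scalar_commute eig)
      then show ?thesis
        by (rule ssubst) (rule mem_S, use rs \<open>\<mu> \<noteq> 0\<close> in auto)
    next
      case swap
      have "g *v a \<in> cline b" "g *v b \<in> cline a"
        using swap by (metis act_cline self_mem_cline)+
      then obtain \<mu> \<nu> where eig: "g *v a = \<mu> *s b" "g *v b = \<nu> *s a"
        by (auto simp: mem_cline)
      have \<mu>\<nu>: "\<mu> * cnj \<nu> = 1"
        using U_herm[OF gU, of a b] by (simp add: eig herm_simps ab ba mult.commute)
      then have "\<mu> \<noteq> 0" by auto
      have "act g x = cline (of_real (r * cmod \<mu>) *s b + of_real (s / cmod \<mu>) *s a)"
        unfolding rs act_cline polar[OF \<mu>\<nu>, symmetric]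
        by (simp add: matrix_vector_right_distrib vector_scalar_commute eig)
      also have "\<dots> = cline (of_real (s / cmod \<mu>) *s a + of_real (r * cmod \<mu>) *s b)"
        by (simp add: add.commute)
      finally show ?thesis
        by (rule ssubst) (rule mem_S, use rs \<open>\<mu> \<noteq> 0\<close> in auto)
    qed
  qed
  ultimately have S: "S = hyp_space J"
    using dense_no_invariant_subspace[OF G] by blast
  \<comment> \<open>A negative vector whose coefficients have a non-real ratio lies off the
    geodesic.\<close>
  define v where "v = 1 *s a + (1 + \<i>) *s b"
  have "Re (H v v) < 0"
    unfolding v_def null_pair_sum_negative[OF ab] by simp
  then have "cline v \<in> S" "v \<noteq> 0"
    using S hyp_space_iff by auto
  then obtain c r s where v: "v = c *s (of_real r *s a + of_real s *s b)" "0 < r" "0 < s"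
    using memS by blast
  have "H v b = -1" "H v a = - (1 + \<i>)"
    by (simp_all add: v_def herm_simps ab ba)
  moreover have "H v b = - (c * of_real r)" "H v a = - (c * of_real s)"
    by (simp_all add: v herm_simps ab ba)
  ultimately have "c * of_real r = 1" "c * of_real s = 1 + \<i>"
    by (metis neg_equal_iff_equal)+
  then have "of_real s = (1 + \<i>) * of_real r"
    by (metis mult.commute mult.left_commute mult_1)
  then show False
    using v by (simp add: complex_eq_iff)
qed

end

section \<open>Existence of loxodromic elements\<close>

lemma herm_sum_left: "herm J (\<Sum>i\<in>A. f i) w = (\<Sum>i\<in>A. herm J (f i) w)"
  by (induction A rule: infinite_finite_induct) (simp_all add: herm_add_left)

lemma scaleR_matrix_vector_complex: "(r *\<^sub>R (A :: complex^'n^'m)) *v u = of_real r *s (A *v u)"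
  using bounded_bilinear.scaleR_left[OF bounded_bilinear_matrix_vector_mult_complex]
  by (simp add: scaleR_vec_complex)

lemma trace_rank_one:
  fixes M :: "complex^'m^'m::finite"
  assumes "\<And>u. M *v u = herm J u y *s z"
  shows "trace M = herm J z y"
proof -
  have "M $ i $ i = (M *v axis i 1) $ i" for i
    by (simp add: matrix_vector_mult_def axis_def sum_if_axis)
  then have "trace M = (\<Sum>i\<in>UNIV. herm J (z $ i *s axis i 1) y)"
    by (simp add: trace_def assms herm_scale_left mult.commute)
  also have "\<dots> = herm J z y"
    by (simp flip: herm_sum_left add: basis_expansion)
  finally show ?thesis .
qed

lemma continuous_trace [continuous_intros]:
  "continuous_on S f \<Longrightarrow> continuous_on S (\<lambda>x. trace (f x :: complex^'m^'m::finite))"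
  unfolding trace_def by (intro continuous_intros)

lemma tendsto_trace [tendsto_intros]:
  "(f \<longlongrightarrow> l) F \<Longrightarrow> ((\<lambda>x. trace (f x :: complex^'m^'m::finite)) \<longlongrightarrow> trace l) F"
  unfolding trace_def by (intro tendsto_intros)

context hermitian_form
begin

text \<open>Reversing the sign along \<open>z\<close> makes the form positive definite: the
  right-hand side equals \<open>H e e + |H v z|^2\<close> with \<open>e\<close> orthogonal to
  \<open>z\<close>. Compactness of the unit sphere and homogeneity give the constant.\<close>

lemma form_coercive:
  assumes z: "H z z = -1"
  obtains c where "0 < c" "\<And>v. c * (norm v)\<^sup>2 \<le> Re (H v v) + 2 * (cmod (H v z))\<^sup>2"
proof -
  define P where "P = (\<lambda>v. Re (H v v) + 2 * (cmod (H v z))\<^sup>2)"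
  have pos: "0 < P v" if "v \<noteq> 0" for v
  proof -
    define e where "e = v + H v z *s z"
    have ez: "H e z = 0"
      by (simp add: e_def herm_simps z)
    have vz: "H z v = cnj (H v z)" by (rule H_commute)
    have "H e e = H v v + of_real ((cmod (H v z))\<^sup>2)"
      by (simp add: e_def herm_simps z vz complex_norm_square algebra_simps del: of_real_power)
    then have "P v = Re (H e e) + (cmod (H v z))\<^sup>2"
      by (simp add: P_def)
    moreover have "0 < Re (H e e)" if "e \<noteq> 0"
      using negative_orthogonal_positive[of z e] ez z that by simp
    moreover have "0 < (cmod (H v z))\<^sup>2" if "e = 0"
      using that \<open>v \<noteq> 0\<close> by (auto simp: e_def)
    ultimately show ?thesis
      by (cases "e = 0") (auto simp: add_pos_nonneg)
  qed
  have "continuous_on (sphere 0 1) P"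
    unfolding P_def by (intro continuous_intros)
  moreover have "sphere (0 :: complex^'m) 1 \<noteq> {}"
    by simp
  ultimately obtain u where u: "u \<in> sphere 0 1" "\<And>w. w \<in> sphere 0 1 \<Longrightarrow> P u \<le> P w"
    using continuous_attains_inf[OF compact_sphere] by metis
  show thesis
  proof (rule that)
    show "0 < P u"
      using u by (intro pos) auto
    fix v
    have "P u * (norm v)\<^sup>2 \<le> P v"
    proof (cases "v = 0")
      case False
      define w where "w = of_real (1 / norm v) *s v"
      have "w \<in> sphere 0 1"
        using False by (simp add: w_def norm_vector_smult norm_divide)
      then have "P u \<le> P w"
        using u by blast
      moreover have v: "v = of_real (norm v) *s w"
        using False by (simp add: w_def vector_smult_assoc)
      have "P (of_real t *s w) = t\<^sup>2 * P w" for t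
        by (simp add: P_def herm_scale_left herm_scale_right norm_mult power_mult_distrib
            power2_eq_square algebra_simps)
      then have "P v = (norm v)\<^sup>2 * P w"
        using arg_cong[OF v, of P] by simp
      ultimately show ?thesis
        by (simp add: mult.commute[of "(norm v)\<^sup>2"] mult_right_mono)
    qed (simp add: P_def)
    then show "P u * (norm v)\<^sup>2 \<le> Re (H v v) + 2 * (cmod (H v z))\<^sup>2"
      by (simp add: P_def)
  qed
qed

lemma ex_unit_negative: "\<exists>z. H z z = -1"
  using ex_negative normalize_negative by metis

text \<open>The fixed point is the circumcentre of an orbit: the function
  \<open>F v = sup\<^sub>g |\<langle>v, g z\<rangle>|\<close> attains its minimum on \<open>\<langle>v, v\<rangle> = - 1\<close>, and only on one line because
  the midpoint of two points is strictly closer to the orbit.\<close>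

lemma bounded_group_fixed_point:
  assumes G: "G \<subseteq> U" "mat 1 \<in> G" "\<And>g h. g \<in> G \<Longrightarrow> h \<in> G \<Longrightarrow> g ** h \<in> G" "\<And>g. g \<in> G \<Longrightarrow> dag g \<in> G"
    and "bounded G"
  shows "\<exists>v. Re (H v v) < 0 \<and> (\<forall>g\<in>G. act g (cline v) = cline v)"
proof -
  obtain z where z: "H z z = -1"
    using ex_unit_negative by blast
  obtain B where B: "\<And>g. g \<in> G \<Longrightarrow> norm g \<le> B"
    using \<open>bounded G\<close> by (auto simp: bounded_iff)
  obtain K where K: "0 < K" "\<And>v w. norm (H v w) \<le> norm v * norm w * K"
    using bounded_bilinear.pos_bounded[OF bounded_bilinear_herm[of J]] by blast
  obtain K' where K': "0 < K'" "\<And>(A :: complex^'m^'m) v. norm (A *v v) \<le> norm A * norm v * K'"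
    using bounded_bilinear.pos_bounded[OF bounded_bilinear_matrix_vector_mult_complex] by blast
  have B0: "0 \<le> B"
    using B[OF G(2)] norm_ge_zero order_trans by blast
  define L where "L = B * norm z * K' * K"
  have L0: "0 \<le> L"
    using B0 K K' by (simp add: L_def)
  have bound: "cmod (H v (g *v z)) \<le> norm v * L" if "g \<in> G" for v g
  proof -
    have "norm (g *v z) \<le> B * norm z * K'"
      using K'(2)[of g z] B[OF that] K'(1)
      by (meson mult_right_mono norm_ge_zero order_trans less_imp_le)
    then have "norm v * norm (g *v z) * K \<le> norm v * (B * norm z * K') * K"
      using K by (intro mult_right_mono mult_left_mono) auto
    then show ?thesis
      using K(2)[of v "g *v z"] by (simp add: L_def mult.assoc)
  qed
  define F where "F = (\<lambda>v. SUP g\<in>G. cmod (H v (g *v z)))"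
  have F_ge: "cmod (H v (g *v z)) \<le> F v" if "g \<in> G" for v g
    unfolding F_def using bound that by (intro cSUP_upper bdd_aboveI2[where M = "norm v * L"])
  have F_le: "F v \<le> M" if "\<And>g. g \<in> G \<Longrightarrow> cmod (H v (g *v z)) \<le> M" for v M
    unfolding F_def using G(2) that by (intro cSUP_least) auto
  have "F v \<le> F w + L * norm (v - w)" for v w
  proof (rule F_le)
    fix g assume g: "g \<in> G"
    have "H v (g *v z) = H w (g *v z) + H (v - w) (g *v z)"
      by (simp add: herm_diff_left)
    then have "cmod (H v (g *v z)) \<le> cmod (H w (g *v z)) + cmod (H (v - w) (g *v z))"
      by (metis norm_triangle_ineq)
    also have "\<dots> \<le> F w + L * norm (v - w)"
      using F_ge[OF g] bound[OF g, of "v - w"] by (simp add: mult.commute add_mono)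
    finally show "cmod (H v (g *v z)) \<le> F w + L * norm (v - w)" .
  qed
  then have "L-lipschitz_on UNIV F"
    by (intro lipschitz_onI L0)
      (smt (verit) dist_norm dist_real_def norm_minus_commute)
  then have contF: "continuous_on S F" for S
    using lipschitz_on_continuous_on continuous_on_subset by blast
  \<comment> \<open>By \<open>form_coercive\<close> this part of the hyperboloid is compact. Outside
    it \<open>F v \<ge> |H v z|\<close> already exceeds \<open>F z\<close>, so a minimum on
    \<open>S\<close> is a global one.\<close>
  define S where "S = {v. H v v = -1 \<and> cmod (H v z) \<le> F z}"
  have Fz: "cmod (H v z) \<le> F v" for v
    using F_ge[OF G(2), of v] by simp
  have "compact S"
  proof -
    have "closed S"
      unfolding S_def by (intro closed_Collect_conj closed_Collect_eq closed_Collect_le continuous_intros)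
    moreover obtain c where c: "0 < c" "\<And>v. c * (norm v)\<^sup>2 \<le> Re (H v v) + 2 * (cmod (H v z))\<^sup>2"
      using form_coercive[OF z] by metis
    have "norm v \<le> sqrt (2 * (F z)\<^sup>2 / c)" if "v \<in> S" for v
    proof -
      have "(cmod (H v z))\<^sup>2 \<le> (F z)\<^sup>2"
        using that by (intro power_mono) (auto simp: S_def)
      then have "c * (norm v)\<^sup>2 \<le> 2 * (F z)\<^sup>2"
        using c(2)[of v] that by (auto simp: S_def)
      then have "(norm v)\<^sup>2 \<le> 2 * (F z)\<^sup>2 / c"
        using c by (simp add: pos_le_divide_eq mult.commute)
      then show ?thesis
        by (rule real_le_rsqrt)
    qed
    then have "bounded S"
      unfolding bounded_iff by blast
    ultimately show ?thesis
      by (simp add: compact_eq_bounded_closed)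
  qed
  moreover have "S \<noteq> {}"
    using z Fz[of z] by (auto simp: S_def)
  ultimately obtain v where v: "v \<in> S" and min: "\<And>w. w \<in> S \<Longrightarrow> F v \<le> F w"
    using continuous_attains_inf[OF _ _ contF] by metis
  have vv: "H v v = -1"
    using v by (simp add: S_def)
  have glob: "F v \<le> F w" if "H w w = -1" for w
  proof (cases "w \<in> S")
    case False
    then have "F z < cmod (H w z)"
      using that by (simp add: S_def)
    moreover have "F v \<le> F z"
      using min[of z] z Fz[of z] by (simp add: S_def)
    ultimately show ?thesis
      using Fz[of w] by simp
  qed (rule min)
  have "1 \<le> cmod (H v z)"
    using reverse_Cauchy_Schwarz(1)[OF vv z] .
  then have Fv: "0 < F v"
    using Fz[of v] by simp
  have "act h (cline v) = cline v" if h: "h \<in> G" for h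
  proof -
    have hU: "h \<in> U" using h G by auto
    define w where "w = h *v v"
    have ww: "H w w = -1"
      by (simp add: w_def U_herm[OF hU] vv)
    have Fw: "cmod (H w (g *v z)) \<le> F v" if "g \<in> G" for g
      using F_ge[of "dag h ** g" v] G(3)[OF G(4)[OF h] that]
      by (simp add: w_def herm_dag matrix_vector_mul_assoc)
    define p where "p = cmod (H w v)"
    have "p \<le> 1"
    proof (rule ccontr)
      \<comment> \<open>The sum \<open>m\<close> of aligned representatives has length
        \<open>- (2 + 2 p)\<close>, so normalising divides by \<open>q > 2\<close>, while the
        products of \<open>m\<close> with the orbit are at most \<open>2 F v\<close>. The midpoint
        would beat the minimum.\<close>
      assume p1: "\<not> p \<le> 1"
      obtain c where c: "cmod c = 1" "c * H w v = - of_real p"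
        using ex_phase[of "H w v"] by (auto simp: p_def)
      define m where "m = v + c *s w"
      have vw: "H v w * cnj c = - of_real p"
        using c(2) by (metis H_commute complex_cnj_complex_of_real complex_cnj_minus complex_cnj_mult mult.commute)
      have cc: "c * cnj c = 1"
        using c(1) by (simp add: complex_norm_square[symmetric])
      have "H m m = H v v + H v w * cnj c + c * H w v + (c * cnj c) * H w w"
        by (simp add: m_def herm_simps algebra_simps)
      then have Hm: "H m m = of_real (- (2 + 2 * p))"
        unfolding c(2) vw cc vv ww by simp
      define q where "q = sqrt (2 + 2 * p)"
      have q: "2 < q"
        using p1 by (simp add: q_def real_less_rsqrt)
      have q2: "q\<^sup>2 = 2 + 2 * p"
        using p1 by (simp add: q_def)
      have "H (of_real (1 / q) *s m) (of_real (1 / q) *s m) = of_real ((1 / q)\<^sup>2) * H m m"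
        by (simp add: herm_simps power2_eq_square)
      also have "\<dots> = of_real ((1 / q)\<^sup>2 * - q\<^sup>2)"
        by (simp only: Hm q2 of_real_mult)
      also have "(1 / q)\<^sup>2 * - q\<^sup>2 = -1"
        using q by (simp add: power_divide)
      finally have mm: "H (of_real (1 / q) *s m) (of_real (1 / q) *s m) = -1"
        by simp
      have "F (of_real (1 / q) *s m) \<le> 2 * F v / q"
      proof (rule F_le)
        fix g assume g: "g \<in> G"
        have "cmod (H m (g *v z)) \<le> cmod (H v (g *v z)) + cmod (H w (g *v z))"
          using norm_triangle_ineq[of "H v (g *v z)" "c * H w (g *v z)"]
          by (simp add: m_def herm_add_left herm_scale_left norm_mult c(1))
        also have "\<dots> \<le> 2 * F v"
          using add_mono[OF F_ge[OF g, of v] Fw[OF g]] by simp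
        finally show "cmod (H (of_real (1 / q) *s m) (g *v z)) \<le> 2 * F v / q"
          using q by (simp add: herm_scale_left norm_mult norm_divide divide_right_mono)
      qed
      moreover have "2 * F v / q < F v"
        using q Fv by (simp add: divide_less_eq)
      ultimately show False
        using glob[OF mm] by simp
    qed
    moreover have "1 \<le> cmod (H v w)" "cmod (H v w) = p"
      using reverse_Cauchy_Schwarz(1)[OF vv ww] H_commute[of v w] by (simp_all add: p_def)
    ultimately obtain c where "w = c *s v"
      using reverse_Cauchy_Schwarz(2)[OF vv ww] by auto
    then show ?thesis
      using act_fixed_iff[OF hU, of v] vv by (force simp: w_def)
  qed
  then show ?thesis
    using vv by (intro exI[of _ v]) simp
qed

text \<open>Renormalised unbounded sequences converge to rank one matrices \<open>u \<mapsto> \<langle>u, y\<rangle> x\<close> with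
  \<open>x\<close> and \<open>y\<close> null.\<close>

lemma unbounded_group_large_trace:
  assumes G: "G \<subseteq> U" "mat 1 \<in> G" "\<And>g h. g \<in> G \<Longrightarrow> h \<in> G \<Longrightarrow> g ** h \<in> G"
    and unb: "\<not> bounded G"
    and nofix: "\<And>v. v \<noteq> 0 \<Longrightarrow> H v v = 0 \<Longrightarrow> \<exists>h\<in>G. act h (cline v) \<noteq> cline v"
  shows "\<exists>g\<in>G. M < cmod (trace g)"
proof -
  have "\<exists>g\<in>G. real k < norm g" for k :: nat
    using unb by (force simp: bounded_iff not_le)
  then obtain g where g: "\<And>k. g k \<in> G" "\<And>k :: nat. real k < norm (g k)"
    by metis
  have n0: "norm (g k) > 0" for k
    using g(2)[of k] by (meson less_le_trans of_nat_0_le_iff not_le le_less_trans)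
  have gU: "g k \<in> U" for k using g G by auto
  define R where "R = (\<lambda>k. (1 / norm (g k)) *\<^sub>R g k)"
  have "R k \<in> sphere 0 1" for k
    using n0[of k] by (auto simp: R_def)
  then obtain L r where L: "L \<in> sphere 0 1" and r: "strict_mono r" and lim: "(R \<circ> r) \<longlonglongrightarrow> L"
    using compact_sphere[of "0 :: complex^'m^'m" 1, unfolded compact_def] by metis
  have lim': "(\<lambda>k. R (r k)) \<longlonglongrightarrow> L"
    using lim by (simp add: comp_def)
  have grow: "filterlim (\<lambda>k. norm (g k)) at_top sequentially"
    by (rule filterlim_at_top_mono[OF filterlim_real_sequentially]) (intro always_eventually allI less_imp_le g(2))
  then have grow': "filterlim (\<lambda>k. norm (g (r k))) at_top sequentially"
    using filterlim_compose[OF _ filterlim_subseq[OF r]] by blast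
  have small: "(\<lambda>k. of_real (1 / norm (g (r k))) * (of_real (1 / norm (g (r k))) * c)) \<longlonglongrightarrow> 0" for c :: complex
  proof -
    have inv: "(\<lambda>k. 1 / norm (g (r k))) \<longlonglongrightarrow> 0"
      using tendsto_divide_0[OF tendsto_const] filterlim_at_top_imp_at_infinity[OF grow'] by blast
    have "(\<lambda>k. complex_of_real (1 / norm (g (r k)))) \<longlonglongrightarrow> 0"
      using tendsto_of_real[OF inv, where 'a = complex] by simp
    from tendsto_mult[OF this tendsto_mult[OF this tendsto_const[of c]]] show ?thesis
      by simp
  qed
  have Ru: "R k *v u = of_real (1 / norm (g k)) *s (g k *v u)" for k u
    by (simp only: R_def scaleR_matrix_vector_complex)
  have dagR: "dag (R k) = (1 / norm (g k)) *\<^sub>R dag (g k)" for k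
    using linear_simps(5)[OF bounded_linear_dag] by (simp add: R_def)
  have dagRu: "dag (R k) *v u = of_real (1 / norm (g k)) *s (dag (g k) *v u)" for k u
    by (simp only: dagR scaleR_matrix_vector_complex)
  \<comment> \<open>Elements of \<open>U\<close> preserve the form, so after division by norms
    tending to infinity all products vanish in the limit. The range of \<open>L\<close> is therefore
    totally isotropic, that is, a line.\<close>
  have iso: "H (L *v u) (L *v w) = 0" for u w
  proof (rule LIMSEQ_unique)
    show "(\<lambda>k. H (R (r k) *v u) (R (r k) *v w)) \<longlonglongrightarrow> H (L *v u) (L *v w)"
      by (intro tendsto_intros lim')
    show "(\<lambda>k. H (R (r k) *v u) (R (r k) *v w)) \<longlonglongrightarrow> 0"
      unfolding Ru herm_scale_left herm_scale_right U_herm[OF gU] complex_cnj_complex_of_real by (rule small)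
  qed
  have dag_iso: "H (dag L *v u) (dag L *v w) = 0" for u w
  proof (rule LIMSEQ_unique)
    show "(\<lambda>k. H (dag (R (r k)) *v u) (dag (R (r k)) *v w)) \<longlonglongrightarrow> H (dag L *v u) (dag L *v w)"
      by (intro tendsto_intros lim')
    show "(\<lambda>k. H (dag (R (r k)) *v u) (dag (R (r k)) *v w)) \<longlonglongrightarrow> 0"
      unfolding dagRu herm_scale_left herm_scale_right U_herm[OF dag_U[OF gU]] complex_cnj_complex_of_real by (rule small)
  qed
  have "L \<noteq> 0" using L by auto
  then obtain u0 where "L *v u0 \<noteq> 0"
    using matrix_eq[of L 0] by auto
  define x where "x = L *v u0"
  have x: "x \<noteq> 0" "H x x = 0"
    using \<open>L *v u0 \<noteq> 0\<close> iso by (auto simp: x_def)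
  have "\<exists>w. H w x \<noteq> 0"
    using herm_nondegenerate[of x] x by blast
  then obtain w0 where "H x w0 \<noteq> 0"
    using H_eq_0_commute by blast
  then have "H x ((1 / cnj (H x w0)) *s w0) = 1"
    by (simp add: herm_simps)
  then obtain w where w: "H x w = 1" by blast
  define y where "y = dag L *v w"
  have Lu: "L *v u = H u y *s x" for u
  proof -
    obtain c where c: "L *v u = c *s x"
      using nonpos_orthogonal_proportional[of x "L *v u"] x iso by (auto simp: x_def)
    have "H u y = c"
      unfolding y_def herm_dag[symmetric] by (simp add: c herm_simps w)
    then show ?thesis
      using c by simp
  qed
  have y: "y \<noteq> 0" "H y y = 0"
    using Lu[of u0] x dag_iso by (auto simp: x_def[symmetric] y_def)
  \<comment> \<open>This product is the trace of \<open>h ** L\<close>. If it vanishes for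
    \<open>h = mat 1\<close>, then \<open>y\<close> is a multiple of \<open>x\<close>, and an
    \<open>h\<close> that moves \<open>[x]\<close> makes it nonzero. Undoing the division by the
    norm then sends the traces to infinity.\<close>
  have "\<exists>h\<in>G. H (h *v x) y \<noteq> 0"
  proof (cases "H x y = 0")
    case True
    then obtain c where c: "y = c *s x"
      using nonpos_orthogonal_proportional[of x y] x y by auto
    then have "c \<noteq> 0" using y by auto
    obtain h where h: "h \<in> G" "act h (cline x) \<noteq> cline x"
      using nofix x by blast
    have hU: "h \<in> U" using h G by auto
    have "\<nexists>d. h *v x = d *s x"
      using h act_fixed_iff[OF hU x(1)] by blast
    then have "H x (h *v x) \<noteq> 0"
      using null_nonorthogonal[of x "h *v x"] x U_herm[OF hU, of x x] by auto
    then have "H (h *v x) y \<noteq> 0"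
      using \<open>c \<noteq> 0\<close> H_eq_0_commute by (auto simp: c herm_simps)
    then show ?thesis using h by blast
  qed (use G(2) in \<open>auto intro!: bexI[of _ "mat 1"]\<close>)
  then obtain h where h: "h \<in> G" "H (h *v x) y \<noteq> 0" by blast
  have "trace (h ** L) = H (h *v x) y"
    by (rule trace_rank_one) (simp add: matrix_vector_mul_assoc[symmetric] Lu vector_scalar_commute)
  then have "(\<lambda>k. cmod (trace (h ** R (r k)))) \<longlonglongrightarrow> cmod (H (h *v x) y)"
    by (metis (no_types) tendsto_norm tendsto_trace tendsto_matrix_mult[OF tendsto_const lim'])
  then have "filterlim (\<lambda>k. cmod (trace (h ** R (r k))) * norm (g (r k))) at_top sequentially"
    using filterlim_tendsto_pos_mult_at_top[OF _ _ grow'] h by simp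
  moreover have "cmod (trace (h ** R (r k))) * norm (g (r k)) = cmod (trace (h ** g (r k)))" for k
  proof -
    have "h ** R (r k) = (1 / norm (g (r k))) *\<^sub>R (h ** g (r k))"
      by (simp add: R_def scaleR_matrix_mult_right)
    then have "trace (h ** R (r k)) = (1 / norm (g (r k))) *\<^sub>R trace (h ** g (r k))"
      by (simp only: trace_def vector_scaleR_component scaleR_sum_right)
    then show ?thesis
      using n0[of "r k"] by simp
  qed
  ultimately have "\<forall>\<^sub>F k in sequentially. M < cmod (trace (h ** g (r k)))"
    by (simp add: filterlim_at_top_dense)
  then obtain k where "M < cmod (trace (h ** g (r k)))"
    by (meson eventually_happens trivial_limit_sequentially)
  then show ?thesis
    using G(3)[OF h(1) g(1)] by blast
qed

lemma dense_ex_loxodromic: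
  assumes G: "zariski_dense_subgroup J G"
  obtains g where "g \<in> G" "loxodromic J g"
proof -
  have GU: "G \<subseteq> U"
    using dense_mem_U[OF G] by blast
  have "\<not> bounded G"
  proof
    assume "bounded G"
    then obtain v where "Re (H v v) < 0" "\<forall>g\<in>G. act g (cline v) = cline v"
      using bounded_group_fixed_point[OF GU dense_one[OF G] dense_mult[OF G] dense_dag[OF G]] by blast
    moreover have "v \<noteq> 0"
      using calculation by force
    ultimately show False
      using dense_no_fixed_point[OF G] by blast
  qed
  then obtain g where "g \<in> G" "real CARD('m) < cmod (trace g)"
    using unbounded_group_large_trace[OF GU dense_one[OF G] dense_mult[OF G]]
      dense_no_fixed_point[OF G] by blast
  then show thesis
    using that loxodromic_if_large_trace GU by blast
qed

end

section \<open>Elements near the identity\<close>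

context hermitian_form
begin

lemma nondiscrete_near_one:
  assumes G: "zariski_dense_subgroup J G" and "\<not> discrete G" "0 < \<delta>"
  obtains h where "h \<in> G" "h \<noteq> mat 1" "norm (h - mat 1) < \<delta>"
proof -
  obtain x where x: "x \<in> G" "\<not> x isolated_in G"
    using assms(2) by (auto simp: discrete_def)
  define e where "e = \<delta> / (norm (dag x) + 1)"
  have "0 < e"
    using \<open>0 < \<delta>\<close> by (simp add: e_def add_nonneg_pos)
  then obtain y where y: "y \<in> G" "dist x y < e" "y \<noteq> x"
    using x by (auto simp: isolated_in_dist_Ex_iff)
  have xU: "x \<in> U"
    using dense_mem_U[OF G] x by blast
  show thesis
  proof (rule that)
    show "y ** dag x \<in> G"
      using dense_mult[OF G] dense_dag[OF G] x y by blast
    show "y ** dag x \<noteq> mat 1"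
    proof
      assume "y ** dag x = mat 1"
      then have "(y ** dag x) ** x = x"
        by simp
      then show False
        using y xU by simp
    qed
    have "norm (y ** dag x - mat 1) = norm ((y - x) ** dag x)"
      by (simp add: matrix_diff_rdistrib U_dag_right[OF xU])
    also have "\<dots> \<le> norm (y - x) * norm (dag x)"
      by (rule norm_matrix_mult_le)
    also have "\<dots> \<le> norm (y - x) * (norm (dag x) + 1)"
      by (intro mult_left_mono) auto
    also have "\<dots> < e * (norm (dag x) + 1)"
      using y by (intro mult_strict_right_mono) (auto simp: dist_norm norm_minus_commute add_nonneg_pos)
    also have "\<dots> = \<delta>"
      using norm_ge_zero[of "dag x"] by (simp add: e_def add_nonneg_eq_0_iff)
    finally show "norm (y ** dag x - mat 1) < \<delta>" .
  qed
qed

lemma loxodromic_conj: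
  assumes g: "loxodromic J g" and h: "h \<in> U"
  shows "loxodromic J (h ** g ** dag h)"
proof -
  obtain a b \<kappa> \<mu> where gU: "g \<in> U" and ab: "H a a = 0" "H b b = 0" "H a b = -1"
    and eig: "g *v a = \<kappa> *s a" "g *v b = \<mu> *s b" and \<kappa>: "1 < cmod \<kappa>"
    using loxodromicE[OF g] by metis
  have conj: "(h ** g ** dag h) *v (h *v v) = h *v (g *v v)" for v
    using h by (simp flip: matrix_vector_mul_assoc)
  show ?thesis
    by (rule loxodromicI(1)[of _ "h *v a" "h *v b" \<kappa> \<mu>])
      (use gU h ab \<kappa> eig in \<open>simp_all add: conj U_herm vector_scalar_commute\<close>)
qed

lemma loxodromic_dag:
  assumes g: "loxodromic J g"
  shows "loxodromic J (dag g)"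
proof -
  obtain a b \<kappa> \<mu> where gU: "g \<in> U" and ab: "H a a = 0" "H b b = 0" "H a b = -1"
    and eig: "g *v a = \<kappa> *s a" "g *v b = \<mu> *s b" and \<kappa>: "1 < cmod \<kappa>" "\<kappa> * cnj \<mu> = 1"
    using loxodromicE[OF g] by metis
  have "\<kappa> \<noteq> 0" "\<mu> \<noteq> 0"
    using \<kappa> by auto
  have inv: "dag g *v v = (1 / c) *s v" if "g *v v = c *s v" "c \<noteq> 0" for v c
  proof -
    have "dag g *v (g *v v) = v"
      using gU by simp
    then have "c *s (dag g *v v) = v"
      using that by (simp add: vector_scalar_commute)
    then have "(1 / c) *s (c *s (dag g *v v)) = (1 / c) *s v"
      by simp
    then show ?thesis
      using that by (simp add: vector_smult_assoc)
  qed
  show ?thesis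
    by (rule loxodromicI(1)[of _ a b "1 / \<kappa>" "1 / \<mu>"])
      (use gU ab inv eig \<kappa> \<open>\<kappa> \<noteq> 0\<close> \<open>\<mu> \<noteq> 0\<close> in \<open>simp_all add: norm_divide\<close>)
qed

text \<open>Vectors rather than boundary points, so that their linear span can be taken.\<close>

definition lox_fixed :: "(complex^'m^'m) set \<Rightarrow> (complex^'m) set" where
  "lox_fixed G = {v. v \<noteq> 0 \<and> H v v = 0 \<and> (\<exists>g\<in>G. loxodromic J g \<and> act g (cline v) = cline v)}"

lemma lox_fixed_image:
  assumes G: "zariski_dense_subgroup J G" and h: "h \<in> G" and v: "v \<in> lox_fixed G"
  shows "h *v v \<in> lox_fixed G"
proof -
  have hU: "h \<in> U" using dense_mem_U[OF G h] .
  obtain g where g: "g \<in> G" "loxodromic J g" "act g (cline v) = cline v" and v0: "v \<noteq> 0" "H v v = 0"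
    using v by (auto simp: lox_fixed_def)
  have "h *v v \<noteq> 0"
    using U_dag_cancel(1)[OF hU, of v] v0 by auto
  moreover have "act (h ** g ** dag h) (cline (h *v v)) = act h (act g (act (dag h ** h) (cline v)))"
    by (simp add: act_cline[symmetric] act_act matrix_mul_assoc)
  then have "act (h ** g ** dag h) (cline (h *v v)) = cline (h *v v)"
    unfolding U_dag_left[OF hU] act_mat_1 g(3) by (simp only: act_cline)
  moreover have "h ** g ** dag h \<in> G"
    using dense_mult[OF G] dense_dag[OF G] g h by blast
  ultimately show ?thesis
    using v0 loxodromic_conj[OF g(2) hU] by (auto simp: lox_fixed_def U_herm[OF hU])
qed

lemma ex_lox_fixed_pair:
  assumes G: "zariski_dense_subgroup J G"
  obtains a b where "a \<in> lox_fixed G" "b \<in> lox_fixed G" "H a b = -1"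
proof -
  obtain g where g: "g \<in> G" "loxodromic J g"
    using dense_ex_loxodromic[OF G] .
  obtain a b \<kappa> \<mu> where gU: "g \<in> U" and ab: "H a a = 0" "H b b = 0" "H a b = -1"
    and eig: "g *v a = \<kappa> *s a" "g *v b = \<mu> *s b"
    using loxodromicE[OF g(2)] by metis
  have "a \<noteq> 0" "b \<noteq> 0"
    using ab by auto
  then have "a \<in> lox_fixed G" "b \<in> lox_fixed G"
    using g ab eig act_fixed_iff[OF gU] by (auto simp: lox_fixed_def)
  then show thesis
    using that ab by blast
qed

text \<open>The span is invariant and contains the negative vector \<open>a + b\<close>, so
  irreducibility applies.\<close>

lemma span_lox_fixed:
  assumes G: "zariski_dense_subgroup J G"
  shows "vec.span (lox_fixed G) = UNIV"
proof -
  obtain a b where ab: "a \<in> lox_fixed G" "b \<in> lox_fixed G" "H a b = -1"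
    using ex_lox_fixed_pair[OF G] .
  show ?thesis
  proof (rule dense_irreducible[OF G vec.subspace_span])
    show "1 *s a + 1 *s b \<in> vec.span (lox_fixed G)"
      using ab by (intro vec.span_add vec.span_scale vec.span_base)
    show "Re (H (1 *s a + 1 *s b) (1 *s a + 1 *s b)) < 0"
      using ab by (subst null_pair_sum_negative) (auto simp: lox_fixed_def)
    fix g w assume g: "g \<in> G" and w: "w \<in> vec.span (lox_fixed G)"
    have "vec.subspace {w. g *v w \<in> vec.span (lox_fixed G)}"
      by (auto simp: vec.subspace_def matrix_vector_right_distrib vector_scalar_commute
          intro: vec.span_add vec.span_scale vec.span_zero)
    moreover have "lox_fixed G \<subseteq> {w. g *v w \<in> vec.span (lox_fixed G)}"
      using lox_fixed_image[OF G g] by (auto intro: vec.span_base)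
    ultimately show "g *v w \<in> vec.span (lox_fixed G)"
      using vec.span_minimal w by blast
  qed
qed

text \<open>Two null eigenvectors on different lines have eigenvalues with \<open>\<mu> \<mu>'\<^sup>* = 1\<close>, so three null
  eigenvectors have the same eigenvalue.\<close>

lemma scalar_if_fixes_spanning:
  assumes h: "h \<in> U"
    and F: "\<And>v. v \<in> F \<Longrightarrow> v \<noteq> 0 \<and> H v v = 0 \<and> act h (cline v) = cline v"
    and span: "vec.span F = UNIV"
    and x: "x \<in> F" "y \<in> F" "z \<in> F" "cline x \<noteq> cline y" "cline x \<noteq> cline z" "cline y \<noteq> cline z"
  obtains c where "c ^ CARD('m) = 1" "h = mat c"
proof -
  have "\<exists>c. h *v v = c *s v" if "v \<in> F" for v
    using F[OF that] act_fixed_iff[OF h] by blast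
  then obtain \<mu> where \<mu>: "\<And>v. v \<in> F \<Longrightarrow> h *v v = \<mu> v *s v"
    by metis
  have prod: "\<mu> v * cnj (\<mu> w) = 1" if "v \<in> F" "w \<in> F" "cline v \<noteq> cline w" for v w
  proof (rule eigenvectors_herm[OF h \<mu>[OF that(1)] \<mu>[OF that(2)]])
    have "\<nexists>c. w = c *s v"
      using that F[OF that(2)] cline_eqI[of _ v] by auto
    then show "H v w \<noteq> 0"
      using null_nonorthogonal F that by blast
  qed
  have cancel: "w = w'" if "u * w = 1" "u * w' = 1" for u w w' :: complex
    using that by (metis mult.assoc mult.commute mult_1)
  have yz: "\<mu> y = \<mu> z"
    using cancel[OF prod[OF x(1,2,4)] prod[OF x(1,3,5)]] by simp
  have "cnj (\<mu> z) * \<mu> x = 1" "cnj (\<mu> z) * \<mu> y = 1"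
    using prod[OF x(1,3,5)] prod[OF x(2,3,6)] by (simp_all only: mult.commute)
  then have xy: "\<mu> x = \<mu> y"
    by (rule cancel)
  define c where "c = \<mu> x"
  have cc: "c * cnj c = 1"
    using prod[OF x(1,2,4)] xy by (simp add: c_def)
  have c0: "cnj c \<noteq> 0"
    using cc by auto
  have c_unique: "u = c" if "u * cnj c = 1" for u
    using that cc c0 mult_cancel_right[of u "cnj c" c] by simp
  have yc: "\<mu> y = c"
    using xy by (simp add: c_def)
  have eq: "\<mu> v = c" if "v \<in> F" for v
  proof (cases "cline v = cline x")
    case True
    then have "\<mu> v * cnj (\<mu> y) = 1"
      using prod[OF that x(2)] x(4) by simp
    then show ?thesis
      using c_unique yc by simp
  next
    case False
    then have "\<mu> v * cnj c = 1"
      using prod[OF that x(1)] by (simp add: c_def)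
    then show ?thesis
      using c_unique by simp
  qed
  have "vec.subspace {w. h *v w = c *s w}"
    by (auto simp: vec.subspace_def matrix_vector_right_distrib vector_scalar_commute
        vector_add_ldistrib vector_smult_assoc mult.commute)
  moreover have "F \<subseteq> {w. h *v w = c *s w}"
    using \<mu> eq by auto
  ultimately have hc: "h *v w = c *s w" for w
    using vec.span_minimal span by blast
  have "mat c *v w = c *s w" for w :: "complex^'m"
    using smult_mat_1_vector[of c w] by (simp add: mat_def)
  then have hm: "h = mat c"
    using hc by (simp add: matrix_eq)
  have "det h = c ^ CARD('m)"
    unfolding hm by (subst det_diagonal) (simp_all add: mat_def)
  then show thesis
    using that hm U_det[OF h] by simp
qed

text \<open>Otherwise all sufficiently small elements fix any prescribed finite part of
  \<open>lox_fixed G\<close>. A basis together with three distinct lines forces them to be scalar,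
  and scalars of determinant 1 are roots of unity, isolated from 1.\<close>

lemma ex_moved_lox_fixed:
  assumes G: "zariski_dense_subgroup J G" and nd: "\<not> discrete G"
  obtains b where "b \<in> lox_fixed G"
    "\<And>\<delta>. 0 < \<delta> \<Longrightarrow> \<exists>h\<in>G. norm (h - mat 1) < \<delta> \<and> act h (cline b) \<noteq> cline b"
proof (rule ccontr)
  note * = that
  assume "\<not> thesis"
  then have "\<exists>\<delta>>0. \<forall>h\<in>G. norm (h - mat 1) < \<delta> \<longrightarrow> act h (cline b) = cline b" if "b \<in> lox_fixed G" for b
    using that * by blast
  then obtain d where d: "\<And>b. b \<in> lox_fixed G \<Longrightarrow> 0 < d b"
    "\<And>b h. b \<in> lox_fixed G \<Longrightarrow> h \<in> G \<Longrightarrow> norm (h - mat 1) < d b \<Longrightarrow> act h (cline b) = cline b"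
    by metis
  obtain B where B: "B \<subseteq> lox_fixed G" "vec.independent B" "lox_fixed G \<subseteq> vec.span B"
    using vec.maximal_independent_subset by blast
  have finB: "finite B"
    using vec.finiteI_independent B by blast
  have spanB: "vec.span B = UNIV"
    using vec.span_mono[OF B(3)] span_lox_fixed[OF G] by (simp add: vec.span_span top_le)
  obtain a where a: "a \<in> lox_fixed G"
    using ex_lox_fixed_pair[OF G] by blast
  obtain h1 h2 where h: "h1 \<in> G" "h2 \<in> G" "act h1 (cline a) \<noteq> cline a" "act h2 (cline a) \<noteq> cline a"
    "act h1 (cline a) \<noteq> act h2 (cline a)"
    using dense_boundary_orbit[OF G, of a] a by (auto simp: lox_fixed_def)
  define F where "F = B \<union> {a, h1 *v a, h2 *v a}"
  have F: "finite F" "F \<subseteq> lox_fixed G"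
    using finB B a lox_fixed_image[OF G] h by (auto simp: F_def)
  have spanF: "vec.span F = UNIV"
    using vec.span_mono[of B F] spanB by (auto simp: F_def)
  obtain \<rho> where \<rho>: "0 < \<rho>" "\<And>c. c \<in> {z :: complex. z ^ CARD('m) = 1} \<Longrightarrow> c \<noteq> 1 \<Longrightarrow> \<rho> \<le> dist 1 c"
    using finite_set_avoid[OF finite_roots_unity[of "CARD('m)"], of 1] by auto
  define \<delta> where "\<delta> = Min (insert \<rho> (d ` F))"
  have \<delta>: "0 < \<delta>" "\<delta> \<le> \<rho>" "\<And>b. b \<in> F \<Longrightarrow> \<delta> \<le> d b"
    using F \<rho> d(1) unfolding \<delta>_def by (auto simp: Min_gr_iff)
  obtain g where g: "g \<in> G" "g \<noteq> mat 1" "norm (g - mat 1) < \<delta>"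
    using nondiscrete_near_one[OF G nd \<delta>(1)] .
  have "v \<noteq> 0 \<and> H v v = 0 \<and> act g (cline v) = cline v" if v: "v \<in> F" for v
  proof -
    have "v \<in> lox_fixed G" using F v by blast
    moreover have "norm (g - mat 1) < d v"
      using g \<delta>(3)[OF v] by simp
    ultimately show ?thesis
      using d(2)[OF _ g(1)] by (auto simp: lox_fixed_def)
  qed
  then obtain c where c: "c ^ CARD('m) = 1" "g = mat c"
    using scalar_if_fixes_spanning[OF dense_mem_U[OF G g(1)] _ spanF, of a "h1 *v a" "h2 *v a"] h
    by (auto simp: F_def act_cline)
  have "c \<noteq> 1" using c g by auto
  have "c - 1 = (g - mat 1) $ i $ i" for i :: 'm
    by (simp add: c mat_def)
  then have "cmod (c - 1) \<le> norm (g - mat 1)"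
    by (metis order_trans Finite_Cartesian_Product.norm_nth_le)
  also have "\<dots> < \<rho>"
    using g \<delta> by simp
  finally show False
    using \<rho>(2)[of c] c \<open>c \<noteq> 1\<close> by (simp add: dist_norm norm_minus_commute)
qed

text \<open>If the given loxodromic element expands \<open>b\<close>, its inverse is taken
  instead.\<close>

lemma lox_fixed_repelling:
  assumes G: "zariski_dense_subgroup J G" and b: "b \<in> lox_fixed G"
  obtains g a b' \<kappa> \<mu> where "g \<in> G" "H a a = 0" "H b' b' = 0" "H a b' = -1" "cline b' = cline b"
    "g *v a = \<kappa> *s a" "g *v b' = \<mu> *s b'" "1 < cmod \<kappa>" "\<kappa> * cnj \<mu> = 1"
proof -
  note result = that
  have *: thesis if g: "g \<in> G" "loxodromic J g" and gb: "act g (cline b) = cline b"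
    and no: "\<And>\<kappa> v. 1 < cmod \<kappa> \<Longrightarrow> g *v v = \<kappa> *s v \<Longrightarrow> cline b \<noteq> cline v" for g
  proof -
    obtain a b' \<kappa> \<mu> where gU: "g \<in> U" and ab: "H a a = 0" "H b' b' = 0" "H a b' = -1"
      and eig: "g *v a = \<kappa> *s a" "g *v b' = \<mu> *s b'" and \<kappa>: "1 < cmod \<kappa>" "\<kappa> * cnj \<mu> = 1"
      using loxodromicE[OF g(2)] by metis
    have "{x \<in> hyp_boundary J. act g x = x} = {cline a, cline b'}"
      by (rule loxodromicI(2)[OF gU ab eig]) (use \<kappa> in auto)
    moreover have "cline b \<in> {x \<in> hyp_boundary J. act g x = x}"
      using gb b hyp_boundary_iff by (auto simp: lox_fixed_def)
    ultimately have "cline b' = cline b"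
      using no[OF \<kappa>(1) eig(1)] by auto
    then show thesis
      using result[OF g(1) ab _ eig \<kappa>] by blast
  qed
  obtain g where g: "g \<in> G" "loxodromic J g" "act g (cline b) = cline b"
    using b by (auto simp: lox_fixed_def)
  have gU: "g \<in> U" using dense_mem_U[OF G g(1)] .
  obtain c where c: "g *v b = c *s b"
    using g b act_fixed_iff[OF gU] by (auto simp: lox_fixed_def)
  have b0: "b \<noteq> 0" using b by (auto simp: lox_fixed_def)
  show thesis
  proof (cases "1 < cmod c")
    case False
    show thesis
    proof (rule *[OF g])
      fix \<kappa> v assume \<kappa>: "1 < cmod \<kappa>" "g *v v = \<kappa> *s v"
      show "cline b \<noteq> cline v"
      proof
        assume "cline b = cline v"
        then obtain d where d: "b = d *s v"
          using cline_eq_iff[OF b0] by blast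
        then have "g *v b = \<kappa> *s b"
          using \<kappa> by (simp add: vector_scalar_commute vector_smult_assoc mult.commute)
        then show False
          using c False \<kappa> b0 by simp
      qed
    qed
  next
    case True
    have fixd: "act (dag g) (cline b) = cline b"
      using g(3) by (metis act_act act_mat_1 U_dag_left[OF gU])
    show thesis
    proof (rule *[OF dense_dag[OF G g(1)] loxodromic_dag[OF g(2)] fixd])
      fix \<kappa> v assume \<kappa>: "1 < cmod \<kappa>" "dag g *v v = \<kappa> *s v"
      show "cline b \<noteq> cline v"
      proof
        assume "cline b = cline v"
        then obtain d where d: "b = d *s v"
          using cline_eq_iff[OF b0] by blast
        then have "dag g *v b = \<kappa> *s b"
          using \<kappa> by (simp add: vector_scalar_commute vector_smult_assoc mult.commute)
        then have "b = (\<kappa> * c) *s b"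
          using c U_dag_cancel(1)[OF gU, of b] by (simp add: vector_scalar_commute vector_smult_assoc mult.commute)
        then have "1 *s b = (\<kappa> * c) *s b"
          by simp
        then have "\<kappa> * c = 1"
          using b0 by (metis vector_mul_rcancel)
        then have "cmod \<kappa> * cmod c = 1"
          by (metis norm_mult norm_one)
        moreover have "1 * 1 < cmod \<kappa> * cmod c"
          using \<kappa> True by (intro mult_strict_mono) auto
        ultimately show False by simp
      qed
    qed
  qed
qed

end

section \<open>Unipotent limits\<close>

context hermitian_form
begin

section \<open>Rank one operators and Heisenberg translations\<close>

definition rank_one :: "complex^'m \<Rightarrow> complex^'m \<Rightarrow> complex^'m^'m" where
  "rank_one u y = (\<chi> i j. u $ i * H (axis j 1) y)"

lemma rank_one_vector: "rank_one u y *v v = H v y *s u"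
proof -
  have "(\<Sum>j\<in>UNIV. H (axis j 1) y * v $ j) = H (\<Sum>j\<in>UNIV. v $ j *s axis j 1) y"
    by (simp add: herm_sum_left herm_scale_left mult.commute)
  then have "(\<Sum>j\<in>UNIV. H (axis j 1) y * v $ j) = H v y"
    by (simp add: basis_expansion)
  then have "(\<Sum>j\<in>UNIV. u $ i * H (axis j 1) y * v $ j) = H v y * u $ i" for i
    unfolding mult.assoc sum_distrib_left[symmetric] by (simp add: mult.commute)
  then show ?thesis
    by (simp add: vec_eq_iff rank_one_def matrix_vector_mult_def)
qed

lemma trace_rank_one_eq: "trace (rank_one u y) = H u y"
  by (rule trace_rank_one) (rule rank_one_vector)

lemma rank_one_mult: "rank_one u y ** rank_one u' y' = rank_one (H u' y *s u) y'"
  by (simp add: matrix_eq matrix_vector_mul_assoc[symmetric] rank_one_vector herm_scale_left vector_smult_assoc)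

text \<open>\<open>T\<close> is the Heisenberg translation with fixed vector \<open>a\<close>; when \<open>a = e\<^sub>q\<close> in the form \<open>J\<^sub>2\<close>
  it is \<open>T\<^sub>s\<^sub>,\<^sub>-\<^sub>\<zeta>\<close>.\<close>

definition heisenberg :: "complex^'m^'m \<Rightarrow> complex^'m \<Rightarrow> complex^'m \<Rightarrow> complex \<Rightarrow> bool" where
  "heisenberg T a \<zeta> s \<longleftrightarrow> T = mat 1 + rank_one \<zeta> a - rank_one a \<zeta> - rank_one (s *s a) a
     \<and> a \<noteq> 0 \<and> H a a = 0 \<and> H \<zeta> a = 0 \<and> s + cnj s = H \<zeta> \<zeta>"

lemma heisenberg_vector:
  "heisenberg T a \<zeta> s \<Longrightarrow> T *v v = v + H v a *s \<zeta> - H v \<zeta> *s a - (s * H v a) *s a"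
  by (simp add: heisenberg_def matrix_vector_mult_add_rdistrib matrix_vector_mult_diff_rdistrib
      rank_one_vector vector_smult_assoc mult.commute)

lemma heisenbergI:
  assumes "\<And>v. T *v v = v + H v a *s \<zeta> - H v \<zeta> *s a - (s * H v a) *s a"
    and "a \<noteq> 0" "H a a = 0" "H \<zeta> a = 0" "s + cnj s = H \<zeta> \<zeta>"
  shows "heisenberg T a \<zeta> s"
  using assms
  by (simp add: heisenberg_def matrix_eq matrix_vector_mult_add_rdistrib matrix_vector_mult_diff_rdistrib
      rank_one_vector vector_smult_assoc mult.commute)

lemma heisenberg_conj:
  assumes T: "heisenberg T a \<zeta> s" and h: "h \<in> U"
  shows "heisenberg (h ** T ** dag h) (h *v a) (h *v \<zeta>) s"
proof (rule heisenbergI)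
  show "h *v a \<noteq> 0"
    using T U_dag_cancel(1)[OF h, of a] by (auto simp: heisenberg_def)
  fix v
  have "(h ** T ** dag h) *v v = h *v (T *v (dag h *v v))"
    by (simp add: matrix_vector_mul_assoc matrix_mul_assoc)
  also have "\<dots> = v + H v (h *v a) *s (h *v \<zeta>) - H v (h *v \<zeta>) *s (h *v a) - (s * H v (h *v a)) *s (h *v a)"
    unfolding heisenberg_vector[OF T] herm_dag_right
    by (simp add: matrix_vector_right_distrib matrix_vector_mult_diff_distrib vector_scalar_commute h)
  finally show "(h ** T ** dag h) *v v
      = v + H v (h *v a) *s (h *v \<zeta>) - H v (h *v \<zeta>) *s (h *v a) - (s * H v (h *v a)) *s (h *v a)" .
qed (use T h in \<open>auto simp: heisenberg_def U_herm\<close>)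

lemma heisenberg_dag:
  assumes T: "heisenberg T a \<zeta> s" and TU: "T \<in> U"
  shows "heisenberg (dag T) a (- \<zeta>) (cnj s)"
proof (rule heisenbergI)
  have aa: "H a a = 0" and za: "H \<zeta> a = 0" "H a \<zeta> = 0" and ss: "s + cnj s = H \<zeta> \<zeta>"
    using T H_eq_0_commute by (auto simp: heisenberg_def)
  fix v
  let ?w = "v + H v a *s (- \<zeta>) - H v (- \<zeta>) *s a - (cnj s * H v a) *s a"
  have cs: "cnj s = H \<zeta> \<zeta> - s"
    using ss by (simp add: algebra_simps)
  have "T *v ?w = v"
    unfolding heisenberg_vector[OF T]
    by (simp add: herm_simps aa za cs vec_eq_iff algebra_simps)
  then have "dag T *v (T *v ?w) = dag T *v v"
    by simp
  then show "dag T *v v = ?w"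
    using TU by simp
qed (use T in \<open>auto simp: heisenberg_def herm_simps add.commute\<close>)

text \<open>\<open>T\<close> determines \<open>\<zeta>\<close> only modulo \<open>a\<close>; this
  freedom serves to make \<open>\<zeta>\<close> orthogonal to a second null vector.\<close>

lemma heisenberg_shift:
  assumes T: "heisenberg T a \<zeta> s"
  shows "heisenberg T a (\<zeta> + c *s a) (s + c - cnj c)"
proof (rule heisenbergI)
  have aa: "H a a = 0" and za: "H \<zeta> a = 0" "H a \<zeta> = 0" and ss: "s + cnj s = H \<zeta> \<zeta>"
    using T H_eq_0_commute by (auto simp: heisenberg_def)
  show "H a a = 0" "H (\<zeta> + c *s a) a = 0" "a \<noteq> 0"
    "s + c - cnj c + cnj (s + c - cnj c) = H (\<zeta> + c *s a) (\<zeta> + c *s a)"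
    using T by (simp_all add: herm_simps aa za ss[symmetric] heisenberg_def)
  show "T *v v = v + H v a *s (\<zeta> + c *s a) - H v (\<zeta> + c *s a) *s a - ((s + c - cnj c) * H v a) *s a" for v
    unfolding heisenberg_vector[OF T] by (simp add: herm_simps vec_eq_iff algebra_simps)
qed

lemma heisenberg_scale:
  assumes T: "heisenberg T a \<zeta> s" and k: "k \<noteq> 0"
  shows "heisenberg T (k *s a) ((1 / cnj k) *s \<zeta>) (s / (k * cnj k))"
proof (rule heisenbergI)
  have aa: "H a a = 0" and za: "H \<zeta> a = 0" and ss: "s + cnj s = H \<zeta> \<zeta>"
    using T by (auto simp: heisenberg_def)
  show "H (k *s a) (k *s a) = 0" "H ((1 / cnj k) *s \<zeta>) (k *s a) = 0" "k *s a \<noteq> 0"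
    using T k by (auto simp: herm_simps aa za heisenberg_def)
  have "s / (k * cnj k) + cnj (s / (k * cnj k)) = (s + cnj s) / (k * cnj k)"
    by (simp add: add_divide_distrib mult.commute)
  then show "s / (k * cnj k) + cnj (s / (k * cnj k)) = H ((1 / cnj k) *s \<zeta>) ((1 / cnj k) *s \<zeta>)"
    by (simp add: herm_simps ss mult.commute)
  show "T *v v = v + H v (k *s a) *s ((1 / cnj k) *s \<zeta>) - H v ((1 / cnj k) *s \<zeta>) *s (k *s a)
      - (s / (k * cnj k) * H v (k *s a)) *s (k *s a)" for v
    unfolding heisenberg_vector[OF T] using k by (simp add: herm_simps vec_eq_iff)
qed

lemma trace_heisenberg_mult:
  assumes T: "heisenberg T a \<zeta> s" and T': "heisenberg T' b \<eta> t"
    and ab: "H a b = -1" and zb: "H \<zeta> b = 0" and ea: "H \<eta> a = 0"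
  shows "trace (T ** T') = of_nat CARD('m) + of_real (2 * Re (H \<zeta> \<eta>)) + s * t"
proof -
  have aa: "H a a = 0" and za: "H \<zeta> a = 0" "H a \<zeta> = 0" and bb: "H b b = 0" and eb: "H \<eta> b = 0" "H b \<eta> = 0"
    using T T' H_eq_0_commute by (auto simp: heisenberg_def)
  have ba: "H b a = -1" and bz: "H b \<zeta> = 0" and ae: "H a \<eta> = 0"
    using H_commute[of b a] ab zb ea H_eq_0_commute by auto
  have "H \<zeta> \<eta> + H \<eta> \<zeta> = of_real (2 * Re (H \<zeta> \<eta>))"
    unfolding H_commute[of \<eta> \<zeta>] by (simp only: complex_add_cnj)
  moreover have "trace (T ** T') = of_nat CARD('m) + (H \<zeta> \<eta> + H \<eta> \<zeta>) + s * t"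
    using T T' unfolding heisenberg_def
    by (simp add: matrix_add_rdistrib matrix_diff_rdistrib matrix_add_ldistrib matrix_diff_ldistrib
        rank_one_mult trace_add trace_sub trace_rank_one_eq trace_I herm_simps
        aa za bb eb ab ba zb bz ea ae)
  ultimately show ?thesis by simp
qed

text \<open>Inverting \<open>T'\<close> replaces \<open>\<eta>\<close> by \<open>- \<eta>\<close>
  and \<open>t\<close> by \<open>cnj t\<close>, so the real parts of the two traces are
  \<open>n + 1 + Q + P\<close> and \<open>n + 1 + Q - P\<close> with \<open>Q \<ge> 0\<close>. If
  \<open>P = Q = 0\<close>, then \<open>\<zeta>\<close> or \<open>\<eta>\<close> vanishes, the other
  translation is not vertical, and the imaginary part of \<open>s t\<close> is nonzero.\<close>

lemma trace_heisenberg_large_aux: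
  assumes T: "heisenberg T a \<zeta> s" "T \<in> U" "T \<noteq> mat 1" and T': "heisenberg T' b \<eta> t" "T' \<in> U" "T' \<noteq> mat 1"
    and ab: "H a b = -1" and zb: "H \<zeta> b = 0" and ea: "H \<eta> a = 0"
  shows "real CARD('m) < cmod (trace (T ** T')) \<or> real CARD('m) < cmod (trace (T ** dag T'))"
proof -
  let ?n = "real CARD('m)"
  let ?P = "2 * Re (H \<zeta> \<eta>) - Im s * Im t"
  let ?Q = "Re s * Re t"
  have tr: "trace (T ** T') = of_nat CARD('m) + of_real (2 * Re (H \<zeta> \<eta>)) + s * t"
    by (rule trace_heisenberg_mult[OF T(1) T'(1) ab zb ea])
  have "trace (T ** dag T') = of_nat CARD('m) + of_real (2 * Re (H \<zeta> (- \<eta>))) + s * cnj t"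
    by (rule trace_heisenberg_mult[OF T(1) heisenberg_dag[OF T'(1,2)] ab zb]) (simp add: herm_simps ea)
  then have re: "Re (trace (T ** T')) = ?n + ?Q + ?P" "Re (trace (T ** dag T')) = ?n + ?Q - ?P"
    and im: "Im (trace (T ** T')) = Re s * Im t + Im s * Re t"
    by (simp_all add: tr herm_simps)
  have null: "H a a = 0" "H b b = 0" "H \<zeta> a = 0" "H \<eta> b = 0"
    using T T' by (auto simp: heisenberg_def)
  have Re2: "2 * Re s = Re (H \<zeta> \<zeta>)" "2 * Re t = Re (H \<eta> \<eta>)"
    using T T' unfolding heisenberg_def by (metis Re_complex_of_real complex_add_cnj)+
  have pos: "0 < Re s" if "\<zeta> \<noteq> 0"
    using null_pair_perp_positive[OF null(1,2) ab null(3) zb that] Re2 by simp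
  have pos': "0 < Re t" if "\<eta> \<noteq> 0"
    using null_pair_perp_positive[OF null(1,2) ab ea null(4) that] Re2 by simp
  have s0: "s \<noteq> 0" if "\<zeta> = 0"
    using T that by (auto simp: heisenberg_def matrix_eq matrix_vector_mult_add_rdistrib
        matrix_vector_mult_diff_rdistrib rank_one_vector)
  have t0: "t \<noteq> 0" if "\<eta> = 0"
    using T' that by (auto simp: heisenberg_def matrix_eq matrix_vector_mult_add_rdistrib
        matrix_vector_mult_diff_rdistrib rank_one_vector)
  have zeta0: "Re s = 0" if "\<zeta> = 0"
    using Re2 that by auto
  have eta0: "Re t = 0" if "\<eta> = 0"
    using Re2 that by auto
  have Re_ge: "0 \<le> Re s" "0 \<le> Re t"
    using pos pos' zeta0 eta0 by (metis less_imp_le order_refl)+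
  then have Q: "0 \<le> ?Q" by simp
  show ?thesis
  proof (cases "0 < ?Q \<or> ?P \<noteq> 0")
    case True
    then have "?n < ?n + ?Q + ?P \<or> ?n < ?n + ?Q - ?P"
      using Q by linarith
    then show ?thesis
      unfolding re[symmetric] by (meson complex_Re_le_cmod order_less_le_trans)
  next
    case False
    then have P0: "?P = 0" and Q0: "?Q = 0"
      using Q by auto
    have "Im (trace (T ** T')) \<noteq> 0"
    proof (cases "Re s = 0")
      case True
      then have "\<zeta> = 0" using pos by force
      then have "Im s \<noteq> 0" "Im t = 0"
        using s0 True P0 by (auto simp: complex_eq_iff)
      moreover have "Re t \<noteq> 0"
        using t0 pos' \<open>Im t = 0\<close> by (cases "\<eta> = 0") (auto simp: complex_eq_iff)
      ultimately show ?thesis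
        using True by (simp add: im)
    next
      case False
      then have "Re t = 0" "\<eta> = 0"
        using Q0 pos' by force+
      then have "Im t \<noteq> 0" "Im s = 0"
        using t0 P0 by (auto simp: complex_eq_iff)
      then show ?thesis
        using False by (simp add: im)
    qed
    then have "?n\<^sup>2 < (Re (trace (T ** T')))\<^sup>2 + (Im (trace (T ** T')))\<^sup>2"
      by (simp add: re P0 Q0)
    then have "?n\<^sup>2 < (cmod (trace (T ** T')))\<^sup>2"
      by (simp add: cmod_power2)
    then show ?thesis
      using power2_less_imp_less by force
  qed
qed

text \<open>A rescaling and two shifts bring translations with distinct fixed points into the
  position of \<open>trace_heisenberg_large_aux\<close>.\<close>

lemma trace_heisenberg_large:
  assumes T: "heisenberg T a \<zeta> s" "T \<in> U" "T \<noteq> mat 1" and T': "heisenberg T' b \<eta> t" "T' \<in> U" "T' \<noteq> mat 1"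
    and ab: "\<nexists>c. b = c *s a"
  shows "real CARD('m) < cmod (trace (T ** T')) \<or> real CARD('m) < cmod (trace (T ** dag T'))"
proof -
  have "a \<noteq> 0" "H a a = 0" "H b b = 0"
    using T T' by (auto simp: heisenberg_def)
  then obtain k where k: "k \<noteq> 0" "H a (k *s b) = -1"
    using null_pair_exists ab by metis
  note T'k = heisenberg_scale[OF T'(1) k(1)]
  define b' where "b' = k *s b"
  have ab': "H a b' = -1" and ba': "H b' a = -1"
    using k H_commute[of b' a] by (simp_all add: b'_def)
  define \<eta>' where "\<eta>' = (1 / cnj k) *s \<eta>"
  show ?thesis
  proof (rule trace_heisenberg_large_aux[OF heisenberg_shift[OF T(1), of "H \<zeta> b'"] T(2,3)
        heisenberg_shift[OF T'k[folded b'_def \<eta>'_def], of "H \<eta>' a"] T'(2,3) ab'])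
    show "H (\<zeta> + H \<zeta> b' *s a) b' = 0" "H (\<eta>' + H \<eta>' a *s b') a = 0"
      by (simp_all add: herm_simps ab' ba')
  qed
qed

text \<open>The hypotheses make \<open>Y\<close> strictly triangular for the flag formed by
  \<open>a\<close>, its orthogonal complement and the whole space. Preservation of the form then
  ties \<open>Y *v e\<close> to \<open>z\<close> and the real part of \<open>\<sigma>\<close> to
  \<open>H z z\<close>.\<close>

lemma heisenberg_from_blocks:
  assumes TU: "mat 1 + Y \<in> U" and ab: "H a a = 0" "H b b = 0" "H a b = -1"
    and Ya: "\<And>w. H (Y *v a) w = 0" and Yb: "H (Y *v b) a = 0"
    and Ye: "\<And>e. H e a = 0 \<Longrightarrow> H e b = 0 \<Longrightarrow> H (Y *v e) a = 0"
      "\<And>e e'. H e a = 0 \<Longrightarrow> H e b = 0 \<Longrightarrow> H e' a = 0 \<Longrightarrow> H e' b = 0 \<Longrightarrow> H (Y *v e) e' = 0"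
  shows "\<exists>\<zeta> s. heisenberg (mat 1 + Y) a \<zeta> s"
proof -
  have ba: "H b a = -1"
    using ab H_commute[of b a] by simp
  have a0: "a \<noteq> 0" using ab by auto
  have Ya0: "Y *v a = 0"
    using herm_nondegenerate[of "Y *v a"] Ya H_eq_0_commute by blast
  obtain z where z: "Y *v b = (- H (Y *v b) b) *s a + (- H (Y *v b) a) *s b + z" "H z a = 0" "H z b = 0"
    using null_pair_decomp[OF ab] by metis
  define \<sigma> where "\<sigma> = - H (Y *v b) b"
  have Yb_eq: "Y *v b = \<sigma> *s a + z"
    using z Yb by (simp add: \<sigma>_def)
  have az: "H a z = 0" "H b z = 0"
    using z H_eq_0_commute by blast+
  have T: "H (v + Y *v v) (w + Y *v w) = H v w" for v w
    using U_herm[OF TU, of v w] by (simp add: matrix_vector_mult_add_rdistrib)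
  have e_eq: "Y *v e = H e z *s a" if e: "H e a = 0" "H e b = 0" for e
  proof -
    obtain f where f: "Y *v e = (- H (Y *v e) b) *s a + (- H (Y *v e) a) *s b + f" "H f a = 0" "H f b = 0"
      using null_pair_decomp[OF ab] by metis
    have Yef: "Y *v e = (- H (Y *v e) b) *s a + f"
      using f(1) Ye(1)[OF e] by simp
    have "H (Y *v e) f = 0"
      using Ye(2)[OF e f(2,3)] .
    then have "H f f = 0"
      using f H_eq_0_commute[of f a] by (subst (asm) Yef) (simp add: herm_simps)
    then have "f = 0"
      using null_pair_perp_positive[OF ab f(2,3)] by force
    then have "Y *v e = (- H (Y *v e) b) *s a"
      using Yef by simp
    then obtain c where c: "Y *v e = c *s a"
      by blast
    have "H (e + c *s a) (b + (\<sigma> *s a + z)) = 0"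
      using T[of e b] by (simp add: c Yb_eq e)
    then have "c = H e z"
      by (simp add: herm_simps e ab az)
    then show ?thesis using c by simp
  qed
  have ss: "\<sigma> + cnj \<sigma> = H z z"
    using T[of b b] by (simp add: Yb_eq herm_simps ab ba az z algebra_simps add_eq_0_iff)
  have "heisenberg (mat 1 + Y) a (- z) \<sigma>"
  proof (rule heisenbergI)
    fix v
    obtain e where e: "v = (- H v b) *s a + (- H v a) *s b + e" "H e a = 0" "H e b = 0"
      using null_pair_decomp[OF ab] by metis
    have "H v z = H e z"
      by (subst e(1)) (simp add: herm_simps az)
    moreover have "Y *v v = (- H v a) *s (\<sigma> *s a + z) + H e z *s a"
      by (subst e(1)) (simp only: matrix_vector_right_distrib vector_scalar_commute Ya0 Yb_eq e_eq[OF e(2,3)]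
          vector_smult_rzero add_0_left)
    ultimately show "(mat 1 + Y) *v v = v + H v a *s (- z) - H v (- z) *s a - (\<sigma> * H v a) *s a"
      by (simp add: matrix_vector_mult_add_rdistrib herm_simps vec_eq_iff algebra_simps)
  qed (use ab z a0 ss in \<open>simp_all add: herm_simps\<close>)
  then show ?thesis by blast
qed

text \<open>Conjugating a small element of \<open>G\<close> that moves \<open>[b]\<close> by the powers of \<open>A\<close> expands it. Stopped
  as soon as it leaves the ball of radius \<open>\<epsilon>\<close>, it has all its mass in the expanding blocks, up to
  an error bounded by its initial size.\<close>

lemma heisenberg_limit:
  assumes G: "zariski_dense_subgroup J G" and A: "A \<in> G"
    and ab: "H a a = 0" "H b b = 0" "H a b = -1"
    and eig: "A *v a = \<kappa> *s a" "A *v b = \<mu> *s b" and \<kappa>: "1 < cmod \<kappa>" "\<kappa> * cnj \<mu> = 1"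
    and moves: "\<And>\<delta>. 0 < \<delta> \<Longrightarrow> \<exists>h\<in>G. norm (h - mat 1) < \<delta> \<and> act h (cline b) \<noteq> cline b"
    and "0 < \<epsilon>"
  shows "\<exists>T\<in>closure G. \<exists>\<zeta> s. heisenberg T a \<zeta> s \<and> T \<noteq> mat 1 \<and> norm (T - mat 1) \<le> \<epsilon>"
proof -
  have AU: "A \<in> U" using dense_mem_U[OF G A] .
  have b0: "b \<noteq> 0" using ab by auto
  have k0: "\<kappa> \<noteq> 0" "\<mu> \<noteq> 0" using \<kappa> by auto
  have \<mu>norm: "cmod \<kappa> * cmod \<mu> = 1"
    using \<kappa>(2) by (metis norm_mult complex_mod_cnj norm_one)
  have ba: "H b a = -1"
    using ab H_commute[of b a] by simp
  define C where "C = (\<lambda>X. A ** X ** dag A)"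
  define P where "P = (\<lambda>u. dag A *v u)"
  \<comment> \<open>Entries of the conjugate are entries of \<open>X\<close> at vectors pulled back
    by powers of \<open>A\<close>. Pulling back shrinks \<open>a\<close>, expands \<open>b\<close>
    and stays bounded on the complement of both, so the growth of each block can be read
    off.\<close>
  have pull: "H ((C ^^ m) X *v u) w = H (X *v ((P ^^ m) u)) ((P ^^ m) w)" for m X u w
  proof (induction m arbitrary: u w)
    case (Suc m)
    have "H ((C ^^ Suc m) X *v u) w = H (A *v ((C ^^ m) X *v (P u))) w"
      by (simp add: C_def P_def matrix_vector_mul_assoc matrix_mul_assoc)
    also have "\<dots> = H ((C ^^ m) X *v (P u)) (P w)"
      by (simp add: herm_dag P_def)
    also have "\<dots> = H (X *v ((P ^^ m) (P u))) ((P ^^ m) (P w))"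
      by (rule Suc)
    finally show ?case
      by (simp add: funpow_swap1)
  qed simp
  have C_G: "mat 1 + (C ^^ m) X \<in> G" if "mat 1 + X \<in> G" for m X
  proof (induction m)
    case (Suc m)
    have "mat 1 + (C ^^ Suc m) X = A ** (mat 1 + (C ^^ m) X) ** dag A"
      by (simp add: C_def matrix_add_ldistrib matrix_add_rdistrib U_dag_right[OF AU])
    then show ?case
      using dense_mult[OF G] dense_dag[OF G] A Suc by metis
  qed (use that in simp)
  have Peig: "(P ^^ m) v = (1 / c) ^ m *s v" if "A *v v = c *s v" "c \<noteq> 0" for v c m
  proof -
    have "v = c *s (dag A *v v)"
      using U_dag_cancel(1)[OF AU, of v] that by (simp add: vector_scalar_commute)
    then have "(1 / c) *s v = (1 / c) *s (c *s (dag A *v v))"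
      by simp
    then have Pv: "P v = (1 / c) *s v"
      using that by (simp add: P_def vector_smult_assoc)
    show ?thesis
      by (induction m) (use Pv in \<open>simp_all add: P_def vector_scalar_commute vector_smult_assoc mult.commute\<close>)
  qed
  note Pa = Peig[OF eig(1) k0(1)] and Pb = Peig[OF eig(2) k0(2)]
  \<comment> \<open>\<open>dag A\<close> preserves the complement of \<open>a\<close> and
    \<open>b\<close>, where the form is positive definite; \<open>form_coercive\<close> turns
    constant length into bounded norm.\<close>
  have Pe: "\<exists>B. \<forall>m. norm ((P ^^ m) e) \<le> B" if e: "H e a = 0" "H e b = 0" for e
  proof -
    have inv: "H ((P ^^ m) e) a = 0 \<and> H ((P ^^ m) e) b = 0 \<and> H ((P ^^ m) e) ((P ^^ m) e) = H e e" for m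
    proof (induction m)
      case (Suc m)
      then show ?case
        using U_herm[OF dag_U[OF AU]] by (simp add: P_def herm_dag_right[symmetric] eig herm_simps)
    qed (use e in simp)
    have "Re (H (1 *s a + 1 *s b) (1 *s a + 1 *s b)) < 0"
      by (subst null_pair_sum_negative[OF ab]) simp
    then obtain r :: real where r: "H (of_real r *s (1 *s a + 1 *s b)) (of_real r *s (1 *s a + 1 *s b)) = -1"
      using normalize_negative by blast
    obtain c where c: "0 < c"
      "\<And>v. c * (norm v)\<^sup>2 \<le> Re (H v v) + 2 * (cmod (H v (of_real r *s (1 *s a + 1 *s b))))\<^sup>2"
      using form_coercive[OF r] by metis
    have "norm ((P ^^ m) e) \<le> sqrt (Re (H e e) / c)" for m
    proof -
      have "c * (norm ((P ^^ m) e))\<^sup>2 \<le> Re (H e e)"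
        using c(2)[of "(P ^^ m) e"] inv[of m] by (simp add: herm_scale_right herm_add_right)
      then show ?thesis
        using c(1) by (intro real_le_rsqrt) (simp add: pos_le_divide_eq mult.commute)
    qed
    then show ?thesis by blast
  qed
  obtain K where K: "0 < K" "\<And>v w. norm (H v w) \<le> norm v * norm w * K"
    using bounded_bilinear.pos_bounded[OF bounded_bilinear_herm[of J]] by blast
  obtain K' where K': "0 < K'" "\<And>(A :: complex^'m^'m) v. norm (A *v v) \<le> norm A * norm v * K'"
    using bounded_bilinear.pos_bounded[OF bounded_bilinear_matrix_vector_mult_complex] by blast
  have form_bound: "cmod (H (X *v u) w) \<le> norm X * (norm u * norm w * (K' * K))"
    for X :: "complex^'m^'m" and u w
  proof -
    have "norm (X *v u) * norm w * K \<le> (norm X * norm u * K') * norm w * K"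
      using K K'(2)[of X u] by (intro mult_right_mono) auto
    then show ?thesis
      using K(2)[of "X *v u" w] by (simp add: mult_ac)
  qed
  define \<rho> where "\<rho> = norm A * norm (dag A)"
  have \<rho>0: "0 \<le> \<rho>" by (simp add: \<rho>_def)
  have C_norm: "norm (C X) \<le> \<rho> * norm X" for X
  proof -
    have "norm (C X) \<le> norm (A ** X) * norm (dag A)"
      unfolding C_def by (rule norm_matrix_mult_le)
    also have "\<dots> \<le> (norm A * norm X) * norm (dag A)"
      by (intro mult_right_mono norm_matrix_mult_le) auto
    finally show ?thesis by (simp add: \<rho>_def mult_ac)
  qed
  \<comment> \<open>One conjugation multiplies the norm by at most \<open>\<rho>\<close>, so at the
    first exit from the ball of radius \<open>\<epsilon>'\<close> the norm is still at most
    \<open>\<rho> * \<epsilon>' \<le> \<epsilon>\<close>.\<close>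
  define \<epsilon>' where "\<epsilon>' = \<epsilon> / (\<rho> + 1)"
  have \<epsilon>': "0 < \<epsilon>'" "\<rho> * \<epsilon>' \<le> \<epsilon>"
    using \<open>0 < \<epsilon>\<close> \<rho>0 by (simp_all add: \<epsilon>'_def field_simps)
  have step: "\<exists>X m. mat 1 + X \<in> G \<and> norm X < \<delta> \<and> \<epsilon>' \<le> norm ((C ^^ m) X) \<and> norm ((C ^^ m) X) \<le> \<rho> * \<epsilon>'"
    if \<delta>: "0 < \<delta>" "\<delta> < \<epsilon>'" for \<delta>
  proof -
    obtain h where h: "h \<in> G" "norm (h - mat 1) < \<delta>" "act h (cline b) \<noteq> cline b"
      using moves \<delta> by blast
    have hU: "h \<in> U" using dense_mem_U[OF G h(1)] .
    define X where "X = h - mat 1"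
    have "\<nexists>c. h *v b = c *s b"
      using h(3) act_fixed_iff[OF hU b0] by blast
    then have "H b (h *v b) \<noteq> 0"
      using null_nonorthogonal[of b "h *v b"] b0 ab U_herm[OF hU, of b b] by auto
    then have Hb: "H (X *v b) b \<noteq> 0"
      using ab H_eq_0_commute by (auto simp: X_def matrix_vector_mult_diff_rdistrib herm_simps)
    \<comment> \<open>The \<open>(b, b)\<close> entry grows by the factor
      \<open>|\<kappa>|^2\<close> at each step. It is nonzero because the null vectors
      \<open>b\<close> and \<open>h *v b\<close> are not proportional, so the ball is left.\<close>
    have "\<exists>m. \<epsilon>' \<le> norm ((C ^^ m) X)"
    proof (rule ccontr)
      assume "\<nexists>m. \<epsilon>' \<le> norm ((C ^^ m) X)"
      then have small: "norm ((C ^^ m) X) < \<epsilon>'" for m by (simp add: not_le)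
      have "(cmod \<kappa> ^ 2) ^ m * cmod (H (X *v b) b) \<le> \<epsilon>' * (norm b * norm b * (K' * K))" for m
      proof -
        have "1 / cmod \<mu> = cmod \<kappa>"
          using \<mu>norm k0 by (simp add: field_simps)
        then have eq: "cmod (H ((C ^^ m) X *v b) b) = (cmod \<kappa> ^ 2) ^ m * cmod (H (X *v b) b)"
          unfolding pull Pb
          by (simp add: vector_scalar_commute herm_simps norm_mult norm_power norm_divide
              power2_eq_square power_mult_distrib)
        have "cmod (H ((C ^^ m) X *v b) b) \<le> norm ((C ^^ m) X) * (norm b * norm b * (K' * K))"
          by (rule form_bound)
        also have "\<dots> \<le> \<epsilon>' * (norm b * norm b * (K' * K))"
          using small[of m] K K' by (intro mult_right_mono) auto
        finally show ?thesis by (simp only: eq)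
      qed
      moreover obtain m where "\<epsilon>' * (norm b * norm b * (K' * K)) / cmod (H (X *v b) b) < (cmod \<kappa> ^ 2) ^ m"
        using real_arch_pow[of "cmod \<kappa> ^ 2"] \<kappa>(1) by (meson one_less_power zero_less_numeral)
      ultimately show False
        using Hb by (simp add: divide_less_eq) (meson not_le)
    qed
    then obtain m where m: "\<epsilon>' \<le> norm ((C ^^ m) X)" "\<And>k. k < m \<Longrightarrow> \<not> \<epsilon>' \<le> norm ((C ^^ k) X)"
      using exists_least_iff[of "\<lambda>m. \<epsilon>' \<le> norm ((C ^^ m) X)"] by blast
    have "m \<noteq> 0"
      using m(1) h \<delta> by (auto simp: X_def)
    then obtain k where k: "m = Suc k" using not0_implies_Suc by blast
    have "norm ((C ^^ m) X) \<le> \<rho> * norm ((C ^^ k) X)"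
      using C_norm by (simp add: k)
    also have "\<dots> \<le> \<rho> * \<epsilon>'"
      using m(2)[of k] \<rho>0 by (intro mult_left_mono) (auto simp: k)
    finally show ?thesis
      using m h by (intro exI[of _ X] exI[of _ m]) (simp add: X_def)
  qed
  \<comment> \<open>The bound \<open>\<epsilon>' / 2\<close> keeps the initial difference inside the
    ball, and \<open>1 / (k + 1)\<close> makes it tend to 0.\<close>
  define d where "d = (\<lambda>k :: nat. min (\<epsilon>' / 2) (1 / real (Suc k)))"
  have "\<exists>X m. mat 1 + X \<in> G \<and> norm X < d k \<and> \<epsilon>' \<le> norm ((C ^^ m) X) \<and> norm ((C ^^ m) X) \<le> \<rho> * \<epsilon>'" for k
    using \<epsilon>' by (intro step) (auto simp: d_def min_def)
  then obtain X m where Xm: "\<And>k. mat 1 + X k \<in> G" "\<And>k. norm (X k) < d k"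
    "\<And>k. \<epsilon>' \<le> norm ((C ^^ m k) (X k))" "\<And>k. norm ((C ^^ m k) (X k)) \<le> \<rho> * \<epsilon>'"
    by metis
  define Z where "Z = (\<lambda>k. (C ^^ m k) (X k))"
  have "Z k \<in> cball 0 (\<rho> * \<epsilon>')" for k
    using Xm(4) by (simp add: Z_def)
  then obtain Y r where r: "strict_mono r" and lim0: "(Z \<circ> r) \<longlonglongrightarrow> Y"
    using compact_cball[of "0 :: complex^'m^'m" "\<rho> * \<epsilon>'", unfolded compact_def] by metis
  have lim: "(\<lambda>k. Z (r k)) \<longlonglongrightarrow> Y"
    using lim0 by (simp add: comp_def)
  have "\<epsilon>' \<le> norm Y"
    by (rule LIMSEQ_le_const[OF tendsto_norm[OF lim]]) (use Xm(3) in \<open>auto simp: Z_def\<close>)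
  then have Y0: "Y \<noteq> 0" using \<epsilon>' by auto
  have "norm Y \<le> \<rho> * \<epsilon>'"
    by (rule LIMSEQ_le_const2[OF tendsto_norm[OF lim]]) (use Xm(4) in \<open>auto simp: Z_def\<close>)
  then have Y\<epsilon>: "norm Y \<le> \<epsilon>" using \<epsilon>' by simp
  have Tlim: "(\<lambda>k. mat 1 + Z (r k)) \<longlonglongrightarrow> mat 1 + Y"
    by (intro tendsto_intros lim)
  have Tcl: "mat 1 + Y \<in> closure G"
    unfolding closure_sequential
    by (intro exI[of _ "\<lambda>k. mat 1 + Z (r k)"] conjI allI Tlim) (simp add: Z_def C_G[OF Xm(1)])
  have "closure G \<subseteq> U"
    using dense_mem_U[OF G] closed_U by (intro closure_minimal) auto
  then have TU: "mat 1 + Y \<in> U" using Tcl by blast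
  \<comment> \<open>Blocks whose pulled-back vectors have bounded product are dominated by the size
    of the initial difference, which tends to 0. Only the blocks \<open>(b, b)\<close>,
    \<open>(b, e)\<close> and \<open>(e, b)\<close> can survive, which are those of a Heisenberg
    translation.\<close>
  have vanish: "H (Y *v u) w = 0" if B: "\<And>n. norm ((P ^^ n) u) * norm ((P ^^ n) w) \<le> B" for u w B
  proof (rule LIMSEQ_unique)
    show "(\<lambda>k. H (Z (r k) *v u) w) \<longlonglongrightarrow> H (Y *v u) w"
      by (intro tendsto_intros lim)
    have le: "norm (H (Z (r k) *v u) w) \<le> (1 / real (Suc (r k))) * (B * (K' * K))" for k
    proof -
      have "0 \<le> B"
        using B[of 0] by (meson mult_nonneg_nonneg norm_ge_zero order_trans)
      have "norm (H (Z (r k) *v u) w) \<le> norm (X (r k)) * (norm ((P ^^ m (r k)) u) * norm ((P ^^ m (r k)) w) * (K' * K))"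
        unfolding Z_def pull by (rule form_bound)
      also have "\<dots> \<le> (1 / real (Suc (r k))) * (B * (K' * K))"
        using Xm(2)[of "r k"] B[of "m (r k)"] K K' \<open>0 \<le> B\<close>
        by (intro mult_mono) (auto simp: d_def)
      finally show ?thesis .
    qed
    have "(\<lambda>k. 1 / real (Suc k)) \<longlonglongrightarrow> 0"
      using LIMSEQ_inverse_real_of_nat by (simp add: inverse_eq_divide)
    then have "(\<lambda>k. 1 / real (Suc (r k))) \<longlonglongrightarrow> 0"
      using LIMSEQ_subseq_LIMSEQ[OF _ r] by (force simp: comp_def)
    then have "(\<lambda>k. (1 / real (Suc (r k))) * (B * (K' * K))) \<longlonglongrightarrow> 0"
      by (rule tendsto_mult_left_zero)
    then show "(\<lambda>k. H (Z (r k) *v u) w) \<longlonglongrightarrow> 0"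
      by (rule Lim_null_comparison[rotated]) (use le in simp)
  qed
  have na: "norm ((P ^^ n) a) \<le> norm a" for n
  proof -
    have "(1 / cmod \<kappa>) ^ n \<le> 1"
      using \<kappa>(1) by (intro power_le_one) (auto simp: divide_le_eq)
    from mult_right_mono[OF this norm_ge_zero[of a]] show ?thesis
      unfolding Pa norm_vector_smult norm_power norm_divide norm_one by simp
  qed
  have nab: "norm ((P ^^ n) a) * norm ((P ^^ n) b) \<le> norm a * norm b" for n
  proof -
    have "(1 / cmod \<kappa>) ^ n * (1 / cmod \<mu>) ^ n = 1"
      using \<mu>norm by (simp add: power_mult_distrib[symmetric])
    then have "norm ((P ^^ n) a) * norm ((P ^^ n) b) = 1 * (norm a * norm b)"
      unfolding Pa Pb norm_vector_smult norm_power norm_divide norm_one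
      by (metis (no_types, opaque_lifting) mult.assoc mult.left_commute)
    then show ?thesis by simp
  qed
  have Yaa: "H (Y *v a) a = 0"
    by (rule vanish[of _ _ "norm a * norm a"]) (auto intro!: mult_mono na)
  have Yab: "H (Y *v a) b = 0" "H (Y *v b) a = 0"
    using vanish[of a b "norm a * norm b"] vanish[of b a "norm a * norm b"] nab
    by (simp_all add: mult.commute)
  have Yae: "H (Y *v a) e = 0" "H (Y *v e) a = 0" if e: "H e a = 0" "H e b = 0" for e
  proof -
    obtain B where B: "\<And>n. norm ((P ^^ n) e) \<le> B" using Pe[OF e] by blast
    then have "0 \<le> B" using norm_ge_zero order_trans by blast
    then show "H (Y *v a) e = 0"
      by (intro vanish[of _ _ "norm a * B"] mult_mono na B) auto
    show "H (Y *v e) a = 0"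
      using \<open>0 \<le> B\<close> by (intro vanish[of _ _ "B * norm a"] mult_mono na B) auto
  qed
  have Yee: "H (Y *v e) e' = 0" if e: "H e a = 0" "H e b = 0" "H e' a = 0" "H e' b = 0" for e e'
  proof -
    obtain B where B: "\<And>n. norm ((P ^^ n) e) \<le> B" using Pe[OF e(1,2)] by blast
    obtain B' where B': "\<And>n. norm ((P ^^ n) e') \<le> B'" using Pe[OF e(3,4)] by blast
    have "0 \<le> B" using B norm_ge_zero order_trans by blast
    then show ?thesis
      by (intro vanish[of _ _ "B * B'"] mult_mono B B') auto
  qed
  have Ya: "H (Y *v a) w = 0" for w
  proof -
    obtain e where e: "w = (- H w b) *s a + (- H w a) *s b + e" "H e a = 0" "H e b = 0"
      using null_pair_decomp[OF ab] by metis
    show ?thesis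
      by (subst e(1)) (simp add: herm_add_right herm_scale_right herm_diff_right herm_minus_right Yaa Yab Yae[OF e(2,3)])
  qed
  obtain \<zeta> s where "heisenberg (mat 1 + Y) a \<zeta> s"
    using heisenberg_from_blocks[OF TU ab Ya Yab(2) Yae(2) Yee] by blast
  then show ?thesis
    using Tcl Y0 Y\<epsilon> by (intro bexI[of _ "mat 1 + Y"]) auto
qed

lemma dense_lox_near_one:
  assumes G: "zariski_dense_subgroup J G" and nd: "\<not> discrete G" and "0 < \<epsilon>"
  obtains g where "g \<in> G" "loxodromic J g" "norm (g - mat 1) < \<epsilon>"
proof -
  obtain b0 where b0: "b0 \<in> lox_fixed G"
    "\<And>\<delta>. 0 < \<delta> \<Longrightarrow> \<exists>h\<in>G. norm (h - mat 1) < \<delta> \<and> act h (cline b0) \<noteq> cline b0"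
    using ex_moved_lox_fixed[OF G nd] by metis
  obtain A a b \<kappa> \<mu> where A: "A \<in> G" and ab: "H a a = 0" "H b b = 0" "H a b = -1" "cline b = cline b0"
    and eig: "A *v a = \<kappa> *s a" "A *v b = \<mu> *s b" "1 < cmod \<kappa>" "\<kappa> * cnj \<mu> = 1"
    using lox_fixed_repelling[OF G b0(1)] by metis
  have a0: "a \<noteq> 0" using ab by auto
  obtain h where h: "h \<in> G" "act h (cline a) \<noteq> cline a"
    using dense_no_fixed_point[OF G a0] ab by blast
  have hU: "h \<in> U" using dense_mem_U[OF G h(1)] .
  have nprop: "\<nexists>c. h *v a = c *s a"
    using h act_fixed_iff[OF hU a0] by blast
  define \<phi> where "\<phi> = (\<lambda>T. T ** (h ** T ** dag h))"
  define \<psi> where "\<psi> = (\<lambda>T. T ** dag (h ** T ** dag h))"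
  have cont: "continuous_on UNIV \<phi>" "continuous_on UNIV \<psi>"
    unfolding \<phi>_def \<psi>_def by (intro continuous_intros)+
  have one: "\<phi> (mat 1) = mat 1" "\<psi> (mat 1) = mat 1"
    by (simp_all add: \<phi>_def \<psi>_def U_dag_right[OF hU])
  have "open {T. norm (\<phi> T - mat 1) < \<epsilon> \<and> norm (\<psi> T - mat 1) < \<epsilon>}"
    by (intro open_Collect_conj open_Collect_less continuous_intros cont)
  moreover have "mat 1 \<in> {T. norm (\<phi> T - mat 1) < \<epsilon> \<and> norm (\<psi> T - mat 1) < \<epsilon>}"
    using one \<open>0 < \<epsilon>\<close> by simp
  ultimately obtain e where e: "0 < e" "cball (mat 1) e \<subseteq> {T. norm (\<phi> T - mat 1) < \<epsilon> \<and> norm (\<psi> T - mat 1) < \<epsilon>}"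
    using open_contains_cball by blast
  obtain T \<zeta> s where T: "T \<in> closure G" "heisenberg T a \<zeta> s" "T \<noteq> mat 1" "norm (T - mat 1) \<le> e"
    using heisenberg_limit[OF G A ab(1-3) eig _ e(1)] b0(2) ab(4) by metis
  have "closure G \<subseteq> U"
    using dense_mem_U[OF G] closed_U by (intro closure_minimal) auto
  then have TU: "T \<in> U" using T by blast
  have near: "norm (\<phi> T - mat 1) < \<epsilon>" "norm (\<psi> T - mat 1) < \<epsilon>"
    using e(2) T(4) by (auto simp: dist_norm norm_minus_commute)
  have "h ** T ** dag h \<noteq> mat 1"
  proof
    assume "h ** T ** dag h = mat 1"
    then have "dag h ** (h ** T ** dag h) ** h = dag h ** h"
      by simp
    then show False
      using T(3) by (simp add: hU U_dag_left[OF hU] flip: matrix_mul_assoc)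
  qed
  then have "real CARD('m) < cmod (trace (\<phi> T)) \<or> real CARD('m) < cmod (trace (\<psi> T))"
    unfolding \<phi>_def \<psi>_def
    using trace_heisenberg_large[OF T(2) TU T(3) heisenberg_conj[OF T(2) hU] _ _ nprop] hU TU by simp
  then obtain F where F: "F = \<phi> \<or> F = \<psi>" "real CARD('m) < cmod (trace (F T))" "norm (F T - mat 1) < \<epsilon>"
    using near by blast
  have contF: "continuous_on UNIV F"
    using F(1) cont by auto
  \<comment> \<open>\<open>T\<close> itself need not lie in \<open>G\<close>; both conditions are
    open, so they hold for some element of \<open>G\<close> as well.\<close>
  have "open {T. real CARD('m) < cmod (trace (F T)) \<and> norm (F T - mat 1) < \<epsilon>}"
    by (intro open_Collect_conj open_Collect_less continuous_intros contF)
  then obtain g where g: "g \<in> G" "real CARD('m) < cmod (trace (F g))" "norm (F g - mat 1) < \<epsilon>"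
    using T(1) F open_Int_closure_eq_empty[of "{T. real CARD('m) < cmod (trace (F T)) \<and> norm (F T - mat 1) < \<epsilon>}" G] by blast
  have "F g \<in> G"
    using F(1) dense_mult[OF G] dense_dag[OF G] g(1) h(1) by (auto simp: \<phi>_def \<psi>_def)
  then show thesis
    using that loxodromic_if_large_trace[OF dense_mem_U[OF G]] g by blast
qed

text \<open>If all small loxodromic elements fixed \<open>[p]\<close>, a still smaller one would, by
  conjugation, also fix two further points of the orbit of \<open>[p]\<close>, one boundary point
  too many.\<close>

lemma dense_lox_near_one_moving:
  assumes G: "zariski_dense_subgroup J G" and nd: "\<not> discrete G" and "0 < \<epsilon>"
    and p: "p \<noteq> 0" "H p p = 0"
  obtains g where "g \<in> G" "loxodromic J g" "norm (g - mat 1) < \<epsilon>" "act g (cline p) \<noteq> cline p"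
proof (rule ccontr)
  note result = that
  assume "\<not> thesis"
  then have fixes_p: "act g (cline p) = cline p" if "g \<in> G" "loxodromic J g" "norm (g - mat 1) < \<epsilon>" for g
    using that result by blast
  obtain h1 h2 where h: "h1 \<in> G" "h2 \<in> G" "act h1 (cline p) \<noteq> cline p" "act h2 (cline p) \<noteq> cline p"
    "act h1 (cline p) \<noteq> act h2 (cline p)"
    using dense_boundary_orbit[OF G p] .
  define \<rho> where "\<rho> = (\<lambda>h. norm (dag h) * norm h)"
  have \<rho>0: "0 \<le> \<rho> k" for k by (simp add: \<rho>_def)
  \<comment> \<open>Small enough that conjugates by \<open>mat 1\<close>, \<open>h1\<close> and
    \<open>h2\<close> stay within \<open>\<epsilon>\<close>.\<close>
  define e where "e = \<epsilon> / (1 + \<rho> (mat 1) + \<rho> h1 + \<rho> h2)"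
  have pos: "0 < 1 + \<rho> (mat 1) + \<rho> h1 + \<rho> h2"
    using \<rho>0[of "mat 1"] \<rho>0[of h1] \<rho>0[of h2] by linarith
  then have "0 < e"
    using \<open>0 < \<epsilon>\<close> by (simp add: e_def)
  then obtain g where g: "g \<in> G" "loxodromic J g" "norm (g - mat 1) < e"
    using dense_lox_near_one[OF G nd] by metis
  have fixed: "act g (act k (cline p)) = act k (cline p)" if k: "k \<in> G" "\<rho> k \<le> \<rho> (mat 1) + \<rho> h1 + \<rho> h2" for k
  proof -
    have kU: "k \<in> U" using dense_mem_U[OF G k(1)] .
    have "norm (dag k ** g ** k - mat 1) = norm (dag k ** (g - mat 1) ** k)"
      by (simp add: matrix_diff_ldistrib matrix_diff_rdistrib U_dag_left[OF kU])
    also have "\<dots> \<le> norm (dag k ** (g - mat 1)) * norm k"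
      by (rule norm_matrix_mult_le)
    also have "\<dots> \<le> (norm (dag k) * norm (g - mat 1)) * norm k"
      by (intro mult_right_mono norm_matrix_mult_le) auto
    also have "\<dots> = \<rho> k * norm (g - mat 1)"
      by (simp add: \<rho>_def)
    also have "\<dots> \<le> (1 + \<rho> (mat 1) + \<rho> h1 + \<rho> h2) * norm (g - mat 1)"
      using k(2) by (intro mult_right_mono) auto
    also have "\<dots> < (1 + \<rho> (mat 1) + \<rho> h1 + \<rho> h2) * e"
      using g(3) pos by (intro mult_strict_left_mono)
    also have "\<dots> = \<epsilon>"
      using pos by (simp add: e_def)
    finally have "norm (dag k ** g ** k - mat 1) < \<epsilon>" .
    moreover have "loxodromic J (dag k ** g ** k)"
      using loxodromic_conj[OF g(2) dag_U[OF kU]] by simp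
    moreover have "dag k ** g ** k \<in> G"
      using dense_mult[OF G] dense_dag[OF G] g k by blast
    ultimately have "act (dag k ** g ** k) (cline p) = cline p"
      using fixes_p by blast
    then have "act k (act (dag k ** g ** k) (cline p)) = act k (cline p)"
      by simp
    then show ?thesis
      by (simp add: act_act kU matrix_mul_assoc U_dag_right[OF kU])
  qed
  have boundary: "act k (cline p) \<in> hyp_boundary J" if "k \<in> G" for k
  proof -
    have kU: "k \<in> U" using dense_mem_U[OF G that] .
    have "k *v p \<noteq> 0"
      using U_dag_cancel(1)[OF kU, of p] p by auto
    then show ?thesis
      using p hyp_boundary_iff by (simp add: act_cline U_herm[OF kU])
  qed
  have "{cline p, act h1 (cline p), act h2 (cline p)} \<subseteq> {x \<in> hyp_boundary J. act g x = x}"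
    using fixed[OF dense_one[OF G]] fixed[OF h(1)] fixed[OF h(2)] boundary[OF dense_one[OF G]]
      boundary[OF h(1)] boundary[OF h(2)] \<rho>0[of "mat 1"] \<rho>0[of h1] \<rho>0[of h2] by simp
  moreover have card: "card {x \<in> hyp_boundary J. act g x = x} = 2"
    using g(2) by (simp add: loxodromic_def)
  then have "finite {x \<in> hyp_boundary J. act g x = x}"
    by (intro card_ge_0_finite) simp
  ultimately have le: "card {cline p, act h1 (cline p), act h2 (cline p)} \<le> 2"
    unfolding card[symmetric] by (intro card_mono)
  have "card {cline p, act h1 (cline p), act h2 (cline p)} = 3"
    unfolding card_3_iff
    by (intro exI[of _ "cline p"] exI[of _ "act h1 (cline p)"] exI[of _ "act h2 (cline p)"] conjI refl
        h(3,4)[symmetric] h(5))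
  then show False
    using le by simp
qed

end

section \<open>Normal forms\<close>

text \<open>The vector \<open>p(A) v\<close> by Horner's scheme; polynomials over the ring of
  matrices are avoided.\<close>

definition poly_vec :: "complex^'m^'m::finite \<Rightarrow> complex^'m \<Rightarrow> complex poly \<Rightarrow> complex^'m" where
  "poly_vec A v p = fold_coeffs (\<lambda>c w. c *s v + A *v w) p 0"

lemma poly_vec_0 [simp]: "poly_vec A v 0 = 0"
  by (simp add: poly_vec_def)

lemma poly_vec_pCons [simp]: "poly_vec A v (pCons c p) = c *s v + A *v poly_vec A v p"
  by (cases "c = 0 \<and> p = 0")
    (auto simp: poly_vec_def fold_coeffs_pCons_coeff_not_0_eq fold_coeffs_pCons_not_0_0_eq)

lemma poly_vec_add: "poly_vec A v (p + q) = poly_vec A v p + poly_vec A v q"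
  by (induction p q rule: poly_induct2) (simp_all add: matrix_vector_right_distrib vector_sadd_rdistrib)

lemma poly_vec_smult: "poly_vec A v (smult c p) = c *s poly_vec A v p"
  by (induction p) (simp_all add: vector_add_ldistrib vector_smult_assoc vector_scalar_commute)

lemma poly_vec_sum: "poly_vec A v (\<Sum>i\<in>I. f i) = (\<Sum>i\<in>I. poly_vec A v (f i))"
  by (induction I rule: infinite_finite_induct) (simp_all add: poly_vec_add)

lemma poly_vec_diff: "poly_vec A v (p - q) = poly_vec A v p - poly_vec A v q"
proof -
  have "poly_vec A v (p + smult (-1) q) = poly_vec A v p + (-1) *s poly_vec A v q"
    by (simp only: poly_vec_add poly_vec_smult)
  then show ?thesis
    by (simp add: vector_sneg_minus1[symmetric])
qed

text \<open>Without an annihilating polynomial the vectors \<open>v\<close>, \<open>A v\<close>,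
  \<open>A^2 v\<close> and so on up to the power \<open>CARD('m)\<close> would be distinct and
  independent, one more than the dimension allows.\<close>

lemma ex_annihilating_poly:
  fixes A :: "complex^'m^'m::finite"
  shows "\<exists>p. p \<noteq> 0 \<and> poly_vec A v p = 0"
proof (rule ccontr)
  assume "\<nexists>p. p \<noteq> 0 \<and> poly_vec A v p = 0"
  then have inj0: "p = 0" if "poly_vec A v p = 0" for p
    using that by blast
  define f where "f = (\<lambda>k. poly_vec A v (monom 1 k))"
  have inj: "inj f"
  proof (rule injI)
    fix j k assume "f j = f k"
    then have "monom (1 :: complex) j - monom 1 k = 0"
      by (intro inj0) (simp add: f_def poly_vec_diff)
    then show "j = k"
      by (simp add: monom_eq_iff')
  qed
  have "vec.independent (f ` {..CARD('m)})"
  proof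
    assume "vec.dependent (f ` {..CARD('m)})"
    then obtain u j where u: "(\<Sum>w\<in>f ` {..CARD('m)}. u w *s w) = 0" and j: "j \<le> CARD('m)" "u (f j) \<noteq> 0"
      by (auto simp: vec.dependent_finite)
    define p where "p = (\<Sum>k\<le>CARD('m). monom (u (f k)) k)"
    have "poly_vec A v p = (\<Sum>k\<le>CARD('m). u (f k) *s f k)"
      by (simp add: p_def poly_vec_sum f_def flip: poly_vec_smult) (simp add: smult_monom)
    also have "\<dots> = 0"
      using u by (subst (asm) sum.reindex) (auto intro: inj_on_subset[OF inj] simp: comp_def)
    finally have "p = 0"
      by (rule inj0)
    then have "coeff p j = 0"
      by simp
    then show False
      using j by (simp add: p_def coeff_sum)
  qed
  then have "card (f ` {..CARD('m)}) \<le> CARD('m)"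
    using vec.independent_card_le_dim[of "f ` {..CARD('m)}" UNIV] by (simp add: card_cart_basis)
  then show False
    using inj by (simp add: card_image inj_on_subset)
qed

text \<open>Linear factors are divided out of an annihilating polynomial until the remaining
  \<open>q\<close> has \<open>q(A) v \<noteq> 0\<close>. That vector is an eigenvector, and like
  every \<open>p(A) v\<close> it lies in \<open>V\<close>.\<close>

lemma ex_eigenvector_in_invariant_subspace:
  fixes A :: "complex^'m^'m::finite"
  assumes V: "vec.subspace V" "\<And>w. w \<in> V \<Longrightarrow> A *v w \<in> V" and v: "v \<in> V" "v \<noteq> 0"
  obtains e c where "e \<in> V" "e \<noteq> 0" "A *v e = c *s e"
proof -
  have mem: "poly_vec A v p \<in> V" for p
    by (induction p) (use V v vec.subspace_0[OF V(1)] in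
        \<open>auto intro!: vec.subspace_add[OF V(1)] vec.subspace_scale[OF V(1)]\<close>)
  have "\<exists>e c. e \<in> V \<and> e \<noteq> 0 \<and> A *v e = c *s e" if "p \<noteq> 0" "poly_vec A v p = 0" for p
    using that
  proof (induction "degree p" arbitrary: p)
    case 0
    then obtain c where "p = [:c:]"
      by (metis degree_eq_zeroE)
    then show ?case
      using 0 v by simp
  next
    case (Suc n)
    then have "\<not> constant (poly p)"
      by (simp add: constant_degree)
    then obtain r where "poly p r = 0"
      using fundamental_theorem_of_algebra by blast
    then obtain q where q: "p = [:- r, 1:] * q"
      by (metis dvdE poly_eq_0_iff_dvd)
    have q0: "q \<noteq> 0"
      using Suc.prems q by auto
    have deg: "degree q = n"
      using Suc.hyps(2) q0 by (simp add: q degree_mult_eq del: mult_pCons_left)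
    have "p = pCons 0 q - smult r q"
      by (simp add: q)
    then have "A *v poly_vec A v q = r *s poly_vec A v q"
      using Suc.prems(2) by (simp only: poly_vec_diff poly_vec_smult poly_vec_pCons) simp
    then show ?case
      using mem Suc.hyps(1)[OF deg[symmetric] q0] by blast
  qed
  then show thesis
    using ex_annihilating_poly[of A v] that by blast
qed

lemma matrix_vector_mult_axis: "(A *v axis j 1) $ i = A $ i $ (j :: 'm::finite)" for A :: "complex^'m^'n"
  by (simp add: matrix_vector_mult_def axis_def sum_if_axis)

lemma diag_matrix_mult: "(A ** diag_matrix l) $ i $ j = A $ i $ j * l j"
  and diag_matrix_mult_left: "(diag_matrix l ** A) $ i $ j = l i * A $ i $ j"
  by (simp_all add: matrix_matrix_mult_def diag_matrix_def if_distrib if_distribR cong: if_cong)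

section \<open>Orthonormal eigenframes\<close>

context hermitian_form
begin

lemma matrix_inv_U:
  assumes "g \<in> U"
  shows "matrix_inv g = dag g"
proof -
  have "\<exists>A'. g ** A' = mat 1 \<and> A' ** g = mat 1"
    using U_dag_left U_dag_right assms by blast
  then have "g ** matrix_inv g = mat 1 \<and> matrix_inv g ** g = mat 1"
    unfolding matrix_inv_def by (rule someI_ex)
  then have "dag g ** (g ** matrix_inv g) = dag g"
    by simp
  then show ?thesis
    using assms by simp
qed

text \<open>A matrix whose rows are the functionals in question, padded by zero rows outside
  \<open>S\<close>, is singular.\<close>

lemma ex_orthogonal_vector:
  fixes S :: "'m set"
  assumes "S \<noteq> UNIV"
  obtains w where "w \<noteq> 0" "\<And>i. i \<in> S \<Longrightarrow> H w (c i) = 0"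
proof -
  obtain k where k: "k \<notin> S" using assms by blast
  define M where "M = (\<chi> i j. if i \<in> S then H (axis j 1) (c i) else 0)"
  have "row k M = 0"
    using k by (simp add: row_def M_def vec_eq_iff)
  then have "det M = 0"
    by (rule det_zero_row)
  then obtain w where w: "w \<noteq> 0" "M *v w = 0"
    by (rule ex_kernel_vector)
  have "H w (c i) = 0" if "i \<in> S" for i
  proof -
    have "H w (c i) = H (\<Sum>j\<in>UNIV. w $ j *s axis j 1) (c i)"
      by (simp add: basis_expansion)
    also have "\<dots> = (M *v w) $ i"
      using that by (simp add: herm_sum_left herm_scale_left M_def matrix_vector_mult_def mult.commute)
    finally show ?thesis
      using w by simp
  qed
  then show thesis using that w by blast
qed

text \<open>The complement of the frame built so far is invariant and positive definite, so it
  contains an eigenvector that can be normalised to length 1. Since \<open>J\<close> is the identity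
  outside \<open>S\<close>, the new vectors only have to be orthonormal.\<close>

lemma eigenframe_extend:
  assumes g: "g \<in> U"
    and J: "\<And>i j. i \<notin> S \<Longrightarrow> J $ i $ j = (if i = j then 1 else 0)"
      "\<And>i j. j \<notin> S \<Longrightarrow> J $ i $ j = (if i = j then 1 else 0)"
    and c: "\<And>i. i \<in> S \<Longrightarrow> g *v c i = l i *s c i" "\<And>i j. i \<in> S \<Longrightarrow> j \<in> S \<Longrightarrow> H (c j) (c i) = J $ i $ j"
    and pos: "\<And>w. w \<noteq> 0 \<Longrightarrow> (\<And>i. i \<in> S \<Longrightarrow> H w (c i) = 0) \<Longrightarrow> 0 < Re (H w w)"
  shows "\<exists>c' l'. (\<forall>i\<in>S. c' i = c i \<and> l' i = l i) \<and> (\<forall>i. g *v c' i = l' i *s c' i) \<and> (\<forall>i j. H (c' j) (c' i) = J $ i $ j)"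
  using J c pos
proof (induction "card (UNIV - S)" arbitrary: S c l)
  case 0
  then have "S = UNIV" by auto
  then show ?case
    using 0 by blast
next
  case (Suc n)
  then have "S \<noteq> UNIV" by auto
  then obtain k where k: "k \<notin> S" by blast
  define V where "V = {w. \<forall>i\<in>S. H w (c i) = 0}"
  have V: "vec.subspace V"
    by (auto simp: V_def vec.subspace_def herm_simps)
  have inv: "g *v w \<in> V" if w: "w \<in> V" for w
    unfolding V_def
  proof safe
    fix i assume i: "i \<in> S"
    have "c i = dag g *v (g *v c i)"
      using g by simp
    also have "\<dots> = l i *s (dag g *v c i)"
      by (simp add: Suc.prems(3)[OF i] vector_scalar_commute)
    finally have ci: "c i = l i *s (dag g *v c i)" .
    then have "0 = cnj (l i) * H w (dag g *v c i)"
      using w i by (metis (mono_tags, lifting) V_def mem_Collect_eq herm_scale_right)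
    moreover have "l i \<noteq> 0 \<or> c i = 0"
      using ci by auto
    ultimately show "H (g *v w) (c i) = 0"
      by (auto simp: herm_dag)
  qed
  obtain w where "w \<noteq> 0" "\<And>i. i \<in> S \<Longrightarrow> H w (c i) = 0"
    using ex_orthogonal_vector[OF \<open>S \<noteq> UNIV\<close>] by metis
  then have "w \<in> V" "w \<noteq> 0"
    by (simp_all add: V_def)
  then obtain e d where e: "e \<in> V" "e \<noteq> 0" "g *v e = d *s e"
    using ex_eigenvector_in_invariant_subspace[OF V inv] by blast
  have eS: "H e (c i) = 0" "H (c i) e = 0" if "i \<in> S" for i
    using e that H_eq_0_commute by (auto simp: V_def)
  have ee: "0 < Re (H e e)"
    using Suc.prems(5)[OF e(2)] eS by blast
  define r where "r = 1 / sqrt (Re (H e e))"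
  define e' where "e' = of_real r *s e"
  have "r\<^sup>2 * Re (H e e) = 1"
    using ee by (simp add: r_def power_divide)
  then have "of_real (r\<^sup>2) * H e e = 1"
    by (subst H_self) (metis of_real_mult of_real_1)
  then have e'e': "H e' e' = 1"
    by (simp add: e'_def herm_simps power2_eq_square mult.assoc)
  have e'S: "H e' (c i) = 0" "H (c i) e' = 0" if "i \<in> S" for i
    using eS[OF that] by (simp_all add: e'_def herm_simps)
  have ge': "g *v e' = d *s e'"
    by (simp add: e'_def e vector_scalar_commute vector_smult_assoc mult.commute)
  define c' where "c' = c(k := e')"
  define l' where "l' = l(k := d)"
  have c'S: "c' i = c i" "l' i = l i" if "i \<in> S" for i
    using that k by (auto simp: c'_def l'_def)
  have c'k: "c' k = e'" "l' k = d"
    by (simp_all add: c'_def l'_def)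
  have "UNIV - insert k S = (UNIV - S) - {k}" by blast
  then have "card (UNIV - insert k S) = card (UNIV - S) - 1"
    using k by simp
  then have card: "n = card (UNIV - insert k S)"
    using Suc.hyps(2) by simp
  have "\<exists>c'' l''. (\<forall>i\<in>insert k S. c'' i = c' i \<and> l'' i = l' i) \<and> (\<forall>i. g *v c'' i = l'' i *s c'' i)
      \<and> (\<forall>i j. H (c'' j) (c'' i) = J $ i $ j)"
  proof (rule Suc.hyps(1)[OF card])
    show "g *v c' i = l' i *s c' i" if "i \<in> insert k S" for i
      using that Suc.prems(3) c'S c'k ge' by auto
    show "H (c' j) (c' i) = J $ i $ j" if "i \<in> insert k S" "j \<in> insert k S" for i j
    proof (cases "i = k"; cases "j = k")
      assume "i = k" "j = k"
      then show ?thesis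
        using Suc.prems(1)[OF k, of k] c'k e'e' by simp
    next
      assume i: "i = k" and j: "j \<noteq> k"
      then have "j \<in> S" using that by blast
      then show ?thesis
        using Suc.prems(1)[OF k, of j] i j c'k c'S e'S by simp
    next
      assume i: "i \<noteq> k" and j: "j = k"
      then have "i \<in> S" using that by blast
      then show ?thesis
        using Suc.prems(2)[OF k, of i] i j c'k c'S e'S by simp
    next
      assume i: "i \<noteq> k" and j: "j \<noteq> k"
      then have "i \<in> S" "j \<in> S" using that by blast+
      then show ?thesis
        using Suc.prems(4) c'S by simp
    qed
    show "0 < Re (H w w)" if "w \<noteq> 0" "\<And>i. i \<in> insert k S \<Longrightarrow> H w (c' i) = 0" for w
      using that Suc.prems(5) c'S by (metis insertCI)
  qed (use Suc.prems(1,2) in auto)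
  then show ?case
    using c'S by (metis insertCI)
qed

text \<open>The frame vectors are the columns of a form-preserving \<open>C0\<close>, whose
  determinant is only known to have modulus 1. Multiplying by a root \<open>k\<close> of its
  inverse, again of modulus 1, corrects the determinant, and scalars cancel in the
  conjugation.\<close>

lemma diagonalisation:
  assumes g: "g \<in> U"
    and c: "\<And>i. g *v c i = l i *s c i" "\<And>i j. H (c j) (c i) = J $ i $ j"
  shows "conjugate_in_SU J g (diag_matrix l)"
proof -
  define C0 where "C0 = (\<chi> i j. c j $ i)"
  have entry: "(A *v c j) $ i = (A ** C0) $ i $ j" for A :: "complex^'m^'m" and i j
    by (simp add: C0_def matrix_vector_mult_def matrix_matrix_mult_def)
  have mult_entry: "(A ** B) $ i $ j = (\<Sum>k\<in>UNIV. A $ i $ k * B $ k $ j)" for A B :: "complex^'m^'m" and i j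
    by (simp add: matrix_matrix_mult_def)
  have "(conj_transpose C0 ** (J ** C0)) $ i $ j = H (c j) (c i)" for i j
    unfolding mult_entry entry[symmetric] herm_def
    by (simp add: conj_transpose_def C0_def matrix_vector_mult_def)
  then have CJ: "conj_transpose C0 ** J ** C0 = J"
    using c(2) by (simp add: vec_eq_iff matrix_mul_assoc)
  then have dagC0: "dag C0 ** C0 = mat 1"
    by (simp add: dag_def J_square flip: matrix_mul_assoc)
  have "det (dag C0) * det C0 = 1"
    by (metis dagC0 det_I det_mul)
  moreover have "det (dag C0) = cnj (det C0)"
  proof -
    have "det J * det J = 1"
      by (metis J_square det_I det_mul)
    then show ?thesis
      by (simp add: dag_def det_mul det_conj_transpose mult.commute mult.left_commute)
  qed
  ultimately have det1: "cnj (det C0) * det C0 = 1" by simp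
  then have "det C0 \<noteq> 0" by auto
  obtain k where k: "k ^ CARD('m) = inverse (det C0)"
  proof -
    have "card {z. z ^ CARD('m) = inverse (det C0)} = CARD('m)"
      using \<open>det C0 \<noteq> 0\<close> by (intro card_nth_roots) auto
    then have "{z. z ^ CARD('m) = inverse (det C0)} \<noteq> {}"
      by (metis card.empty zero_less_card_finite less_irrefl)
    then show thesis using that by blast
  qed
  have "cmod (det C0) = 1"
    using det1 by (intro cmod_eq_1I) (simp add: mult.commute)
  then have "cmod k ^ CARD('m) = 1"
    using k by (metis norm_inverse norm_power inverse_1)
  then have "cmod k = 1"
    using power_eq_imp_eq_base[of "cmod k" "CARD('m)" 1] by simp
  then have kk: "k * cnj k = 1"
    by (simp add: complex_norm_square[symmetric])
  define C where "C = (\<chi> i j. k * C0 $ i $ j)"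
  have Ck: "C ** B = (\<chi> i j. k * (C0 ** B) $ i $ j)" for B
    by (simp add: C_def matrix_matrix_mult_def vec_eq_iff sum_distrib_left mult.assoc)
  have kC: "B ** C = (\<chi> i j. k * (B ** C0) $ i $ j)" for B
    by (simp add: C_def matrix_matrix_mult_def vec_eq_iff sum_distrib_left mult.left_commute)
  have "C = C0 ** diag_matrix (\<lambda>_. k)"
    by (simp add: vec_eq_iff diag_matrix_mult C_def mult.commute)
  moreover have "det (diag_matrix (\<lambda>_ :: 'm. k)) = k ^ CARD('m)"
    by (subst det_diagonal) (simp_all add: diag_matrix_def)
  ultimately have detC: "det C = 1"
    using k \<open>det C0 \<noteq> 0\<close> by (simp add: det_mul)
  have "H (C *v v) (C *v w) = H v w" for v w
  proof -
    have Cv: "C *v v = k *s (C0 *v v)" for v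
      by (simp add: C_def matrix_vector_mult_def vec_eq_iff sum_distrib_left mult.assoc)
    have "H (C *v v) (C *v w) = (k * cnj k) * H (C0 *v v) (C0 *v w)"
      by (simp add: Cv herm_simps)
    then show ?thesis
      by (simp add: kk herm_dag matrix_vector_mul_assoc dagC0)
  qed
  then have "conj_transpose C ** J ** C = J"
    by (intro herm_matrix_eqI) (simp add: herm_adjoint_gen[symmetric])
  then have CU: "C \<in> U"
    using detC by (simp add: SU_def)
  have "(g ** C) $ i $ j = (C ** diag_matrix l) $ i $ j" for i j
  proof -
    have "(g ** C) $ i $ j = k * (g *v c j) $ i"
      by (simp add: kC entry)
    also have "\<dots> = (C ** diag_matrix l) $ i $ j"
      by (simp add: c diag_matrix_mult) (simp add: C_def C0_def)
    finally show ?thesis .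
  qed
  then have "g ** C = C ** diag_matrix l"
    by (simp add: vec_eq_iff)
  then have "g = C ** diag_matrix l ** dag C"
    using CU by (metis U_cancel_mult(3))
  then show ?thesis
    using CU by (auto simp: conjugate_in_SU_def matrix_inv_U)
qed

end

section \<open>The two model forms and the existence of the normal forms\<close>

lemma J1_vector: "(J1 p *v v) $ i = (if i = p then - v $ i else v $ i)"
proof -
  have "J1 p $ i $ j * v $ j = (if j = i then (if i = p then - v $ j else v $ j) else 0)" for j
    by (auto simp: J1_def)
  then show ?thesis
    by (simp add: matrix_vector_mult_def)
qed

lemma herm_J1: "herm (J1 p) v w = - (v $ p * cnj (w $ p)) + (\<Sum>i\<in>UNIV - {p}. v $ i * cnj (w $ i))"
proof -
  have "herm (J1 p) v w = (\<Sum>i\<in>insert p (UNIV - {p}). cnj (w $ i) * (if i = p then - v $ i else v $ i))"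
    unfolding herm_def J1_vector by (simp add: insert_absorb)
  also have "\<dots> = - (v $ p * cnj (w $ p)) + (\<Sum>i\<in>UNIV - {p}. v $ i * cnj (w $ i))"
    by (subst sum.insert) (auto intro!: sum.cong simp: mult.commute)
  finally show ?thesis .
qed

lemma hermitian_form_J1: "hermitian_form (J1 p)"
proof
  show "conj_transpose (J1 p) = J1 p"
    by (simp add: vec_eq_iff conj_transpose_def J1_def)
  have "J1 p *v (J1 p *v v) = v" for v
    by (simp add: vec_eq_iff J1_vector)
  then show "J1 p ** J1 p = mat 1"
    by (simp add: matrix_eq matrix_vector_mul_assoc)
  show "\<exists>v. Re (herm (J1 p) v v) < 0 \<and>
      (\<forall>w. herm (J1 p) w v = 0 \<longrightarrow> w \<noteq> 0 \<longrightarrow> 0 < Re (herm (J1 p) w w))"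
  proof (intro exI[of _ "axis p 1"] conjI allI impI)
    have e: "herm (J1 p) w (axis p 1) = - w $ p" for w
      by (auto simp: herm_J1 axis_def intro!: sum.neutral)
    show "Re (herm (J1 p) (axis p 1) (axis p 1)) < 0"
      by (simp add: e)
    fix w assume "herm (J1 p) w (axis p 1) = 0" and w0: "w \<noteq> 0"
    then have wp: "w $ p = 0"
      by (simp add: e)
    then have eq: "Re (herm (J1 p) w w) = (\<Sum>i\<in>UNIV - {p}. (cmod (w $ i))\<^sup>2)"
      by (simp add: herm_J1 complex_norm_square[symmetric] del: of_real_power)
    obtain k where "w $ k \<noteq> 0"
      using w0 by (auto simp: vec_eq_iff)
    then show "0 < Re (herm (J1 p) w w)"
      unfolding eq using wp by (intro sum_pos2[of _ k]) auto
  qed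
qed

lemma J2_vector:
  assumes "p \<noteq> q"
  shows "(J2 p q *v v) $ i = (if i = p then - v $ q else if i = q then - v $ p else v $ i)"
proof -
  have "J2 p q $ i $ j * v $ j = (if j = (if i = p then q else if i = q then p else i)
      then (if i = p \<or> i = q then - v $ j else v $ j) else 0)" for j
    using assms by (auto simp: J2_def)
  then show ?thesis
    by (simp add: matrix_vector_mult_def)
qed

lemma herm_J2:
  assumes "p \<noteq> q"
  shows "herm (J2 p q) v w = - (v $ q * cnj (w $ p)) - v $ p * cnj (w $ q)
    + (\<Sum>i\<in>UNIV - {p, q}. v $ i * cnj (w $ i))"
proof -
  have "herm (J2 p q) v w = (\<Sum>i\<in>UNIV. cnj (w $ i) * (if i = p then - v $ q else if i = q then - v $ p else v $ i))"
    unfolding herm_def J2_vector[OF assms] ..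
  also have "UNIV = insert p (insert q (UNIV - {p, q}))" by blast
  also have "(\<Sum>i\<in>insert p (insert q (UNIV - {p, q})). cnj (w $ i) * (if i = p then - v $ q else if i = q then - v $ p else v $ i))
    = - (v $ q * cnj (w $ p)) - v $ p * cnj (w $ q) + (\<Sum>i\<in>UNIV - {p, q}. v $ i * cnj (w $ i))"
    using assms by (subst sum.insert) (auto intro!: sum.cong simp: mult.commute)
  finally show ?thesis .
qed

lemma hermitian_form_J2:
  assumes pq: "p \<noteq> q"
  shows "hermitian_form (J2 p q)"
proof
  show "conj_transpose (J2 p q) = J2 p q"
    by (auto simp: vec_eq_iff conj_transpose_def J2_def)
  have "J2 p q *v (J2 p q *v v) = v" for v
    using pq by (simp add: vec_eq_iff J2_vector[OF pq])
  then show "J2 p q ** J2 p q = mat 1"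
    by (simp add: matrix_eq matrix_vector_mul_assoc)
  show "\<exists>v. Re (herm (J2 p q) v v) < 0 \<and>
      (\<forall>w. herm (J2 p q) w v = 0 \<longrightarrow> w \<noteq> 0 \<longrightarrow> 0 < Re (herm (J2 p q) w w))"
  \<comment> \<open>The negative vector is the sum of the two null axes. Orthogonality to it means
    \<open>w $ q = - w $ p\<close>, which turns the mixed terms into
    \<open>2 |w $ p|^2\<close>.\<close>
  proof (intro exI[of _ "axis p 1 + axis q 1"] conjI allI impI)
    have e: "herm (J2 p q) w (axis p 1 + axis q 1) = - w $ q - w $ p" for w
      using pq by (simp add: herm_J2[OF pq] axis_def)
    show "Re (herm (J2 p q) (axis p 1 + axis q 1) (axis p 1 + axis q 1)) < 0"
      using pq by (simp add: e) (simp add: axis_def)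
    fix w assume "herm (J2 p q) w (axis p 1 + axis q 1) = 0" and w0: "w \<noteq> 0"
    then have wq: "w $ q = - w $ p"
      by (simp add: e) (metis add.inverse_inverse diff_0 eq_iff_diff_eq_0)
    have "herm (J2 p q) w w = of_real (2 * (cmod (w $ p))\<^sup>2 + (\<Sum>i\<in>UNIV - {p, q}. (cmod (w $ i))\<^sup>2))"
      by (simp add: herm_J2[OF pq] wq complex_norm_square del: of_real_power)
    then have eq: "Re (herm (J2 p q) w w) = 2 * (cmod (w $ p))\<^sup>2 + (\<Sum>i\<in>UNIV - {p, q}. (cmod (w $ i))\<^sup>2)"
      by simp
    show "0 < Re (herm (J2 p q) w w)"
    proof (cases "w $ p = 0")
      case True
      obtain k where k: "w $ k \<noteq> 0"
        using w0 by (auto simp: vec_eq_iff)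
      then have "k \<in> UNIV - {p, q}"
        using True wq by auto
      then have "0 < (\<Sum>i\<in>UNIV - {p, q}. (cmod (w $ i))\<^sup>2)"
        using k by (intro sum_pos2) auto
      then show ?thesis
        by (simp add: eq add_nonneg_pos)
    next
      case False
      then show ?thesis
        unfolding eq by (intro add_pos_nonneg sum_nonneg) auto
    qed
  qed
qed

text \<open>Existence gives the choice of \<open>l\<close> in \<open>delta_cp\<close> and
  \<open>lox_M\<close> its meaning. The fixed null pair of \<open>f\<close> occupies the indices
  \<open>p\<close> and \<open>q\<close>, where \<open>J2\<close> prescribes exactly the products of
  a null pair.\<close>

lemma ex_loxodromic_normal_form:
  assumes pq: "p \<noteq> q" and f: "loxodromic (J2 p q) f"
  shows "\<exists>l. loxodromic_normal_form p q f l"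
proof -
  interpret hermitian_form "J2 p q"
    by (rule hermitian_form_J2[OF pq])
  obtain a b \<kappa> \<mu> where fU: "f \<in> U" and ab: "H a a = 0" "H b b = 0" "H a b = -1"
    and eig: "f *v a = \<kappa> *s a" "f *v b = \<mu> *s b" and \<kappa>: "1 < cmod \<kappa>" "\<kappa> * cnj \<mu> = 1"
    using loxodromicE[OF f] by metis
  have ba: "H b a = -1"
    using ab H_commute[of b a] by simp
  define c where "c = (\<lambda>i. if i = p then a else b)"
  define l where "l = (\<lambda>i. if i = p then \<kappa> else \<mu>)"
  have "\<exists>c' l'. (\<forall>i\<in>{p, q}. c' i = c i \<and> l' i = l i) \<and> (\<forall>i. f *v c' i = l' i *s c' i)
      \<and> (\<forall>i j. H (c' j) (c' i) = J2 p q $ i $ j)"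
  proof (rule eigenframe_extend[OF fU])
    show "0 < Re (H w w)" if "w \<noteq> 0" "\<And>i. i \<in> {p, q} \<Longrightarrow> H w (c i) = 0" for w
      using null_pair_perp_positive[OF ab, of w] that(1) that(2)[of p] that(2)[of q] pq by (simp add: c_def)
  qed (use pq eig ab ba in \<open>auto simp: c_def l_def J2_def\<close>)
  then obtain c' l' where c': "\<forall>i\<in>{p, q}. c' i = c i \<and> l' i = l i" "\<forall>i. f *v c' i = l' i *s c' i"
    "\<forall>i j. H (c' j) (c' i) = J2 p q $ i $ j"
    by blast
  have "conjugate_in_SU (J2 p q) f (diag_matrix l')"
    by (rule diagonalisation[OF fU]) (use c' in blast)+
  moreover have "l' p = \<kappa>" "l' q = \<mu>"
    using c'(1) pq by (auto simp: l_def)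
  moreover have "\<mu> = inverse (cnj \<kappa>)"
  proof -
    have "cnj \<kappa> * \<mu> = 1"
      using \<kappa>(2) by (metis complex_cnj_cnj complex_cnj_mult complex_cnj_one)
    then show ?thesis
      by (metis inverse_unique)
  qed
  moreover have "cmod (l' i) = 1" if "i \<noteq> p" "i \<noteq> q" for i
  proof -
    have "H (c' i) (c' i) = 1"
      using c'(3) that by (simp add: J2_def)
    then show ?thesis
      using eigenvectors_herm[OF fU, of "c' i" "l' i" "c' i" "l' i"] c'(2) by (simp add: cmod_eq_1I)
  qed
  ultimately show ?thesis
    using \<kappa> by (auto simp: loxodromic_normal_form_def)
qed

text \<open>Existence justifies the choice in \<open>ell_delta\<close>. The frame starts from a
  fixed negative vector at the index \<open>p\<close>.\<close>

lemma ex_elliptic_normal_form: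
  assumes f: "elliptic (J1 p) f"
  shows "\<exists>l. elliptic_normal_form p f l"
proof -
  interpret hermitian_form "J1 p"
    by (rule hermitian_form_J1)
  obtain x where fU: "f \<in> U" and x: "x \<in> hyp_space (J1 p)" "act f x = x"
    using f by (auto simp: elliptic_def)
  obtain z where z: "x = cline z" "H z z = -1"
    using hyp_space_normalized[OF x(1)] .
  then have "z \<noteq> 0" by auto
  then obtain \<kappa> where \<kappa>: "f *v z = \<kappa> *s z"
    using act_fixed_iff[OF fU] x z by blast
  have "\<exists>c' l'. (\<forall>i\<in>{p}. c' i = (\<lambda>_. z) i \<and> l' i = (\<lambda>_. \<kappa>) i) \<and> (\<forall>i. f *v c' i = l' i *s c' i)
      \<and> (\<forall>i j. H (c' j) (c' i) = J1 p $ i $ j)"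
  proof (rule eigenframe_extend[OF fU])
    show "0 < Re (H w w)" if "w \<noteq> 0" "\<And>i. i \<in> {p} \<Longrightarrow> H w z = 0" for w
      using negative_orthogonal_positive[of z w] that z by simp
  qed (use z \<kappa> in \<open>auto simp: J1_def\<close>)
  then obtain c' l' where c': "\<forall>i. f *v c' i = l' i *s c' i" "\<forall>i j. H (c' j) (c' i) = J1 p $ i $ j"
    by blast
  have "conjugate_in_SU (J1 p) f (diag_matrix l')"
    by (rule diagonalisation[OF fU]) (use c' in blast)+
  moreover have "cmod (l' i) = 1" for i
  proof -
    have "H (c' i) (c' i) \<noteq> 0"
      using c'(2) by (simp add: J1_def)
    then show ?thesis
      using eigenvectors_herm[OF fU, of "c' i" "l' i" "c' i" "l' i"] c'(1) by (simp add: cmod_eq_1I)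
  qed
  ultimately show ?thesis
    by (auto simp: elliptic_normal_form_def)
qed

section \<open>Iterated commutators and conjugates\<close>

lemma norm_matrix_entrywise_le:
  fixes A B :: "complex^'n^'m"
  assumes "0 \<le> c" "\<And>i j. cmod (A $ i $ j) \<le> c * cmod (B $ i $ j)"
  shows "norm A \<le> c * norm B"
proof -
  have "norm (A $ i) \<le> c * norm (B $ i)" for i
  proof -
    have "norm (A $ i) \<le> L2_set (\<lambda>j. c * cmod (B $ i $ j)) UNIV"
      unfolding norm_vec_def by (rule L2_set_mono) (use assms in auto)
    then show ?thesis
      using assms(1) by (simp add: norm_vec_def L2_set_right_distrib)
  qed
  then have "norm A \<le> L2_set (\<lambda>i. c * norm (B $ i)) UNIV"
    unfolding norm_vec_def[of A] by (intro L2_set_mono) auto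
  then show ?thesis
    using assms(1) by (simp add: norm_vec_def[of B] L2_set_right_distrib)
qed

context hermitian_form
begin

section \<open>Discrete subgroups and contracting words\<close>

lemma U_mem_subgroup:
  assumes "subgroup \<Gamma> (SU J)"
  shows "h \<in> \<Gamma> \<Longrightarrow> h \<in> U" "g \<in> \<Gamma> \<Longrightarrow> h \<in> \<Gamma> \<Longrightarrow> g ** h \<in> \<Gamma>" "h \<in> \<Gamma> \<Longrightarrow> dag h \<in> \<Gamma>" "mat 1 \<in> \<Gamma>"
  using subgroup.mem_carrier[OF assms] subgroup.m_closed[OF assms] subgroup.m_inv_closed[OF assms]
    subgroup.one_closed[OF assms] inv_SU
  by (simp_all add: mult_SU one_SU)

lemma subgroup_generate_pair:
  "f \<in> U \<Longrightarrow> g \<in> U \<Longrightarrow> subgroup (generate (SU J) {f, g}) (SU J)"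
  by (rule group.generate_is_subgroup[OF group_SU]) auto

lemma discrete_subgroup_gap:
  assumes "subgroup \<Gamma> (SU J)" "discrete \<Gamma>"
  obtains \<epsilon> where "0 < \<epsilon>" "\<And>h. h \<in> \<Gamma> \<Longrightarrow> norm (h - mat 1) < \<epsilon> \<Longrightarrow> h = mat 1"
proof -
  have "mat 1 isolated_in \<Gamma>"
    using discreteD[OF assms(2)] U_mem_subgroup(4)[OF assms(1)] by blast
  then obtain \<epsilon> where "0 < \<epsilon>" "\<forall>y\<in>\<Gamma>. dist (mat 1) y < \<epsilon> \<longrightarrow> y = mat 1"
    by (auto simp: isolated_in_dist_Ex_iff)
  then show thesis
    using that by (metis dist_norm norm_minus_commute)
qed

lemma conj_mult:
  assumes "C \<in> U"
  shows "dag C ** (x ** y) ** C = (dag C ** x ** C) ** (dag C ** y ** C)"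
  using assms by (simp add: matrix_mul_assoc U_dag_right)

lemma conj_dag: "dag C ** dag x ** C = dag (dag C ** x ** C)"
  by (simp add: dag_mult matrix_mul_assoc)

lemma conj_near_one:
  assumes C: "C \<in> U" and g: "norm (g - mat 1) < \<epsilon> / (norm (dag C) * norm C + 1)"
  shows "norm (dag C ** g ** C - mat 1) < \<epsilon>"
proof -
  have "dag C ** g ** C - mat 1 = dag C ** (g - mat 1) ** C"
    by (simp add: matrix_diff_ldistrib matrix_diff_rdistrib U_dag_left[OF C])
  also have "norm \<dots> \<le> norm (dag C ** (g - mat 1)) * norm C"
    by (rule norm_matrix_mult_le)
  also have "\<dots> \<le> (norm (dag C) * norm (g - mat 1)) * norm C"
    by (intro mult_right_mono norm_matrix_mult_le) auto
  also have "\<dots> \<le> (norm (dag C) * norm C + 1) * norm (g - mat 1)"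
    by (simp add: algebra_simps)
  also have "\<dots> < \<epsilon>"
    using g by (simp add: pos_less_divide_eq add_nonneg_pos mult.commute)
  finally show ?thesis .
qed

text \<open>Contraction is measured in coordinates \<open>C\<close> adapted to \<open>f\<close>;
  conjugation is continuous, so the iterates tend to 1 in \<open>\<Gamma>\<close> itself. The gap of
  a discrete group around 1 turns convergence into equality.\<close>

lemma iterate_reaches_one:
  assumes \<Gamma>: "subgroup \<Gamma> (SU J)" "discrete \<Gamma>" and C: "C \<in> U" and g: "g \<in> \<Gamma>"
    and \<Psi>: "\<And>h. h \<in> \<Gamma> \<Longrightarrow> \<Psi> h \<in> \<Gamma>"
    and contr: "\<And>h. h \<in> U \<Longrightarrow> norm (dag C ** h ** C - mat 1) < \<epsilon>
      \<Longrightarrow> norm (dag C ** \<Psi> h ** C - mat 1) \<le> c * norm (dag C ** h ** C - mat 1)"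
    and c: "0 \<le> c" "c < 1" and near: "norm (dag C ** g ** C - mat 1) < \<epsilon>"
  shows "\<exists>k. (\<Psi> ^^ k) g = mat 1"
proof -
  obtain e where e: "0 < e" "\<And>h. h \<in> \<Gamma> \<Longrightarrow> norm (h - mat 1) < e \<Longrightarrow> h = mat 1"
    using discrete_subgroup_gap[OF \<Gamma>] by metis
  have mem: "(\<Psi> ^^ k) g \<in> \<Gamma>" for k
    by (induction k) (use g \<Psi> in auto)
  define x where "x = (\<lambda>k. dag C ** (\<Psi> ^^ k) g ** C)"
  have bound: "norm (x k - mat 1) \<le> c ^ k * norm (x 0 - mat 1) \<and> norm (x k - mat 1) < \<epsilon>" for k
  proof (induction k)
    case 0
    then show ?case using near by (simp add: x_def)
  next
    case (Suc k)
    have "norm (x (Suc k) - mat 1) \<le> c * norm (x k - mat 1)"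
      using contr[of "(\<Psi> ^^ k) g"] Suc U_mem_subgroup(1)[OF \<Gamma>(1) mem] by (simp add: x_def)
    moreover have "c * norm (x k - mat 1) \<le> c * (c ^ k * norm (x 0 - mat 1))"
      using Suc c by (intro mult_left_mono) auto
    moreover have "c * norm (x k - mat 1) \<le> 1 * norm (x k - mat 1)"
      using c by (intro mult_right_mono) auto
    ultimately show ?case
      using Suc by (simp add: mult.assoc)
  qed
  have "(\<lambda>k. c ^ k * norm (x 0 - mat 1)) \<longlonglongrightarrow> 0"
    using tendsto_mult_left_zero[OF LIMSEQ_power_zero[of c]] c by simp
  then have "(\<lambda>k. x k - mat 1) \<longlonglongrightarrow> 0"
    by (rule Lim_null_comparison[rotated]) (use bound in simp)
  then have "x \<longlonglongrightarrow> mat 1"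
    by (simp add: LIM_zero_iff)
  then have "(\<lambda>k. C ** x k ** dag C) \<longlonglongrightarrow> C ** mat 1 ** dag C"
    by (intro tendsto_intros)
  moreover have "C ** x k ** dag C = (\<Psi> ^^ k) g" for k
    using C by (simp add: x_def matrix_mul_assoc U_dag_right[OF C])
  ultimately have "(\<lambda>k. (\<Psi> ^^ k) g) \<longlonglongrightarrow> mat 1"
    by (simp add: U_dag_right[OF C])
  then obtain k where "norm ((\<Psi> ^^ k) g - mat 1) < e"
    using e(1) by (meson LIMSEQ_D order_refl)
  then show ?thesis
    using e(2) mem by blast
qed

text \<open>The difference of the commutator from 1 is
  \<open>(Y ** X - X ** Y) ** dag T ** dag x\<close> with \<open>X = x - mat 1\<close> and
  \<open>Y = T - mat 1\<close>, hence of second order. \<open>M\<close> bounds the inverses, and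
  \<open>\<eta>\<close> is chosen to make \<open>2 M^2 |Y| \<le> 1 / 2\<close>.\<close>

lemma commutator_contraction:
  obtains \<eta> where "0 < \<eta>"
    "\<And>T x. T \<in> U \<Longrightarrow> norm (T - mat 1) < \<eta> \<Longrightarrow> x \<in> U \<Longrightarrow> norm (x - mat 1) < 1
      \<Longrightarrow> norm (T ** x ** dag T ** dag x - mat 1) \<le> 1 / 2 * norm (x - mat 1)"
proof -
  obtain K where K: "0 < K" "\<And>x. norm (dag x) \<le> norm x * K"
    using bounded_linear.pos_bounded[OF bounded_linear_dag] by blast
  define M where "M = (norm (mat 1 :: complex^'m^'m) + 1) * K"
  have M0: "0 < M"
    using K by (simp add: M_def add_nonneg_pos)
  have dag_le: "norm (dag x) \<le> M" if "norm (x - mat 1) < 1" for x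
  proof -
    have "norm x \<le> norm (mat 1 :: complex^'m^'m) + 1"
      using norm_triangle_sub[of x "mat 1"] that by simp
    then show ?thesis
      using K(2)[of x] K(1) unfolding M_def by (meson mult_right_mono less_imp_le order_trans)
  qed
  define \<eta> where "\<eta> = min 1 (1 / (4 * M\<^sup>2))"
  show thesis
  proof (rule that)
    show "0 < \<eta>"
      using M0 by (simp add: \<eta>_def)
    fix T x assume T: "T \<in> U" "norm (T - mat 1) < \<eta>" and x: "x \<in> U" "norm (x - mat 1) < 1"
    define X where "X = x - mat 1"
    define Y where "Y = T - mat 1"
    have "T ** x ** dag T ** dag x - mat 1 = (T ** x - x ** T) ** dag T ** dag x"
      using T x by (simp add: matrix_diff_rdistrib U_dag_right)
    also have "T ** x - x ** T = Y ** X - X ** Y"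
      by (simp add: X_def Y_def matrix_diff_ldistrib matrix_diff_rdistrib)
    finally have "norm (T ** x ** dag T ** dag x - mat 1) \<le> norm ((Y ** X - X ** Y) ** dag T) * norm (dag x)"
      using norm_matrix_mult_le by metis
    also have "\<dots> \<le> (norm (Y ** X - X ** Y) * norm (dag T)) * norm (dag x)"
      by (intro mult_right_mono norm_matrix_mult_le) auto
    also have "\<dots> \<le> ((2 * norm Y * norm X) * M) * M"
    proof (intro mult_mono)
      have "norm (Y ** X - X ** Y) \<le> norm (Y ** X) + norm (X ** Y)"
        by (rule norm_triangle_ineq4)
      also have "\<dots> \<le> norm Y * norm X + norm X * norm Y"
        by (intro add_mono norm_matrix_mult_le)
      finally show "norm (Y ** X - X ** Y) \<le> 2 * norm Y * norm X"
        by (simp add: mult_ac)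
      show "norm (dag T) \<le> M" "norm (dag x) \<le> M"
        using T x by (auto intro!: dag_le simp: \<eta>_def)
    qed (use M0 in auto)
    also have "\<dots> = (2 * M\<^sup>2 * norm Y) * norm X"
      by (simp add: power2_eq_square)
    also have "\<dots> \<le> 1 / 2 * norm X"
    proof (rule mult_right_mono)
      have "norm Y \<le> 1 / (4 * M\<^sup>2)"
        using T by (simp add: Y_def \<eta>_def)
      then have "2 * M\<^sup>2 * norm Y \<le> 2 * M\<^sup>2 * (1 / (4 * M\<^sup>2))"
        by (intro mult_left_mono) auto
      then show "2 * M\<^sup>2 * norm Y \<le> 1 / 2"
        using M0 by simp
    qed simp
    finally show "norm (T ** x ** dag T ** dag x - mat 1) \<le> 1 / 2 * norm (x - mat 1)"
      by (simp add: X_def)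
  qed
qed

lemma dag_diag_matrix:
  assumes D: "diag_matrix l \<in> U"
  shows "\<And>i. l i \<noteq> 0" "dag (diag_matrix l) = diag_matrix (\<lambda>i. 1 / l i)"
proof -
  have "det (diag_matrix l) = (\<Prod>i\<in>UNIV. l i)"
    by (subst det_diagonal) (simp_all add: diag_matrix_def)
  then have "(\<Prod>i\<in>UNIV. l i) \<noteq> 0"
    using U_det[OF D] by simp
  then show l: "l i \<noteq> 0" for i
    by (simp add: prod_zero_iff)
  have "diag_matrix (\<lambda>i. 1 / l i) ** diag_matrix l = mat 1"
    using l by (simp add: vec_eq_iff diag_matrix_mult) (simp add: diag_matrix_def mat_def l)
  then have "diag_matrix (\<lambda>i. 1 / l i) ** diag_matrix l ** dag (diag_matrix l) = mat 1 ** dag (diag_matrix l)"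
    by simp
  then show "dag (diag_matrix l) = diag_matrix (\<lambda>i. 1 / l i)"
    using D by simp
qed

text \<open>The derivative at \<open>1\<close> of \<open>x \<mapsto> D\<^sup>-\<^sup>1 [D, [D, x]] D\<close> multiplies the entry \<open>(i, j)\<close> by
  \<open>(l\<^sub>i / l\<^sub>j - 1)\<^sup>2 l\<^sub>j / l\<^sub>i\<close>. The conjugation by \<open>D\<^sup>-\<^sup>1\<close> is needed: a single commutator multiplies
  the entry \<open>(p, q)\<close> by \<open>|l\<^sub>p|\<^sup>2 - 1\<close>, which may exceed \<open>1\<close>.\<close>

lemma double_commutator_contraction:
  assumes D: "D = diag_matrix l" "D \<in> U"
    and c: "0 \<le> c" "c < 1" "\<And>i j. (cmod (l i - l j))\<^sup>2 \<le> c * (cmod (l i) * cmod (l j))"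
  obtains \<epsilon> where "0 < \<epsilon>"
    "\<And>x u. x \<in> U \<Longrightarrow> norm (x - mat 1) < \<epsilon> \<Longrightarrow> u = D ** x ** dag D ** dag x
      \<Longrightarrow> norm (dag D ** (D ** u ** dag D ** dag u) ** D - mat 1) \<le> (1 + c) / 2 * norm (x - mat 1)"
proof -
  note l0 = dag_diag_matrix(1)[OF D(2)[unfolded D(1)]]
  have dagD: "dag D = diag_matrix (\<lambda>i. 1 / l i)"
    using dag_diag_matrix(2) D by blast
  \<comment> \<open>The linear part of the commutator: \<open>[D, x] - 1\<close> equals
    \<open>L (x - mat 1) ** dag x\<close> exactly, so the double commutator has linear part
    \<open>L (L X)\<close>.\<close>
  define L where "L = (\<lambda>Z. D ** Z ** dag D - Z)"
  have L_add: "L (Y + Z) = L Y + L Z" for Y Z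
    by (simp add: L_def matrix_add_ldistrib matrix_add_rdistrib)
  define k where "k = norm D * norm (dag D) + 1"
  have k0: "0 \<le> k" by (simp add: k_def)
  have L_norm: "norm (L Z) \<le> k * norm Z" for Z
  proof -
    have "norm (L Z) \<le> norm (D ** Z ** dag D) + norm Z"
      unfolding L_def by (rule norm_triangle_ineq4)
    also have "norm (D ** Z ** dag D) \<le> norm (D ** Z) * norm (dag D)"
      by (rule norm_matrix_mult_le)
    also have "\<dots> \<le> (norm D * norm Z) * norm (dag D)"
      by (intro mult_right_mono norm_matrix_mult_le) auto
    finally show ?thesis by (simp add: k_def algebra_simps)
  qed
  have main: "norm (dag D ** L (L Z) ** D) \<le> c * norm Z" for Z
  proof (rule norm_matrix_entrywise_le[OF c(1)])
    fix i j
    have "(dag D ** L (L Z) ** D) $ i $ j = 1 / l i * ((l i / l j - 1) * ((l i / l j - 1) * Z $ i $ j)) * l j"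
      using l0 by (simp add: dagD[unfolded D(1)] D(1) L_def diag_matrix_mult diag_matrix_mult_left left_diff_distrib)
    also have "\<dots> = (l i - l j)\<^sup>2 / (l i * l j) * Z $ i $ j"
      using l0[of i] l0[of j] by (simp add: field_simps power2_eq_square)
    also have "cmod \<dots> = (cmod (l i - l j))\<^sup>2 / (cmod (l i) * cmod (l j)) * cmod (Z $ i $ j)"
      by (simp add: norm_mult norm_divide norm_power)
    also have "\<dots> \<le> c * cmod (Z $ i $ j)"
      using c(3)[of i j] l0[of i] l0[of j] by (intro mult_right_mono) (simp_all add: divide_le_eq)
    finally show "cmod ((dag D ** L (L Z) ** D) $ i $ j) \<le> c * cmod (Z $ i $ j)" .
  qed
  obtain K where K: "0 < K" "\<And>x. norm (dag x) \<le> norm x * K"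
    using bounded_linear.pos_bounded[OF bounded_linear_dag] by blast
  define M where "M = (norm (mat 1 :: complex^'m^'m) + 1) * K"
  have M0: "0 < M"
    using K by (simp add: M_def add_nonneg_pos)
  \<comment> \<open>\<open>B\<close> collects the constants of the two second-order terms in
    \<open>E\<close> below, and \<open>N\<close> includes the outer conjugation. The radius
    \<open>\<epsilon>\<close> then keeps the remainder below half of the gap between
    \<open>c\<close> and 1.\<close>
  define B where "B = k * k * K + k * (k * M) * (K * (k * M))"
  have B0: "0 \<le> B"
    using k0 K M0 by (simp add: B_def)
  define N where "N = norm (dag D) * norm D * B + 1"
  have N0: "0 < N"
    using B0 by (simp add: N_def add_nonneg_pos)
  define \<epsilon> where "\<epsilon> = min 1 ((1 - c) / (2 * N))"
  show thesis
  proof (rule that)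
    show "0 < \<epsilon>"
      using N0 c by (simp add: \<epsilon>_def)
    fix x u assume x: "x \<in> U" "norm (x - mat 1) < \<epsilon>" and u: "u = D ** x ** dag D ** dag x"
    define X where "X = x - mat 1"
    have X1: "norm X < 1"
      using x by (simp add: X_def \<epsilon>_def)
    have dag_diff: "dag (y - mat 1) = dag y - mat 1" for y
      using linear_diff[OF bounded_linear.linear[OF bounded_linear_dag], of y "mat 1"] by simp
    have dagX: "norm (dag x - mat 1) \<le> K * norm X"
      using K(2)[of X] by (simp add: X_def dag_diff mult.commute)
    have "norm x \<le> norm (mat 1 :: complex^'m^'m) + 1"
      using norm_triangle_sub[of x "mat 1"] X1 by (simp add: X_def)
    then have dagx: "norm (dag x) \<le> M"
      using K(2)[of x] K(1) unfolding M_def by (meson mult_right_mono less_imp_le order_trans)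
    have uU: "u \<in> U"
      using u x D by simp
    have comm: "D ** y ** dag D ** dag y - mat 1 = L (y - mat 1) ** dag y" if "y \<in> U" for y
      using that D(2)
      by (simp add: L_def matrix_diff_ldistrib matrix_diff_rdistrib U_dag_right)
    have uX: "u - mat 1 = L X ** dag x"
      using comm[OF x(1)] by (simp add: u X_def)
    have "norm (L X ** dag x) \<le> norm (L X) * norm (dag x)"
      by (rule norm_matrix_mult_le)
    also have "\<dots> \<le> (k * norm X) * M"
      using k0 by (intro mult_mono L_norm dagx) auto
    finally have LXx: "norm (L X ** dag x) \<le> k * M * norm X"
      by (simp add: mult_ac)
    have dagu: "norm (dag u - mat 1) \<le> K * (k * M * norm X)"
    proof -
      have "norm (dag u - mat 1) \<le> norm (u - mat 1) * K"
        using K(2)[of "u - mat 1"] by (simp add: dag_diff)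
      also have "\<dots> \<le> (k * M * norm X) * K"
        using LXx K by (intro mult_right_mono) (auto simp: uX)
      finally show ?thesis by (simp add: mult_ac)
    qed
    define E where "E = L (L X ** (dag x - mat 1)) + L (L X ** dag x) ** (dag u - mat 1)"
    have split: "L (L X ** dag x) = L (L X) + L (L X ** (dag x - mat 1))"
      unfolding L_add[symmetric] by (simp add: matrix_diff_ldistrib)
    have "D ** u ** dag D ** dag u - mat 1 = L (L X ** dag x) ** dag u"
      using comm[OF uU] by (simp add: uX)
    also have "\<dots> = L (L X ** dag x) + L (L X ** dag x) ** (dag u - mat 1)"
      by (simp add: matrix_diff_ldistrib)
    finally have w: "D ** u ** dag D ** dag u - mat 1 = L (L X) + E"
      by (simp add: E_def split)
    have "norm (L (L X ** (dag x - mat 1))) \<le> k * norm (L X ** (dag x - mat 1))"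
      by (rule L_norm)
    also have "\<dots> \<le> k * (norm (L X) * norm (dag x - mat 1))"
      using k0 by (intro mult_left_mono norm_matrix_mult_le)
    also have "\<dots> \<le> k * ((k * norm X) * (K * norm X))"
      using k0 by (intro mult_left_mono mult_mono L_norm dagX) auto
    finally have E1: "norm (L (L X ** (dag x - mat 1))) \<le> k * k * K * norm X * norm X"
      by (simp add: mult_ac)
    have "norm (L (L X ** dag x) ** (dag u - mat 1)) \<le> norm (L (L X ** dag x)) * norm (dag u - mat 1)"
      by (rule norm_matrix_mult_le)
    also have "\<dots> \<le> (k * (k * M * norm X)) * (K * (k * M * norm X))"
    proof (rule mult_mono[OF _ dagu])
      show "norm (L (L X ** dag x)) \<le> k * (k * M * norm X)"
        using L_norm[of "L X ** dag x"] LXx k0 by (meson mult_left_mono order_trans)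
    qed (use k0 M0 in auto)
    finally have E2: "norm (L (L X ** dag x) ** (dag u - mat 1)) \<le> k * (k * M) * (K * (k * M)) * norm X * norm X"
      by (simp add: mult_ac)
    have "norm E \<le> norm (L (L X ** (dag x - mat 1))) + norm (L (L X ** dag x) ** (dag u - mat 1))"
      unfolding E_def by (rule norm_triangle_ineq)
    also have "\<dots> \<le> B * norm X * norm X"
      using E1 E2 by (simp add: B_def distrib_right)
    finally have E: "norm E \<le> B * norm X * norm X" .
    have "norm (dag D ** E ** D) \<le> norm (dag D ** E) * norm D"
      by (rule norm_matrix_mult_le)
    also have "\<dots> \<le> (norm (dag D) * norm E) * norm D"
      by (intro mult_right_mono norm_matrix_mult_le) auto
    also have "\<dots> \<le> (norm (dag D) * (B * norm X * norm X)) * norm D"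
      using E by (intro mult_right_mono mult_left_mono) auto
    also have "\<dots> \<le> N * norm X * norm X"
      by (simp add: N_def algebra_simps)
    also have "\<dots> \<le> (1 - c) / 2 * norm X"
    proof (rule mult_right_mono)
      have "norm X \<le> (1 - c) / (2 * N)"
        using x by (simp add: X_def \<epsilon>_def)
      then have "N * norm X \<le> N * ((1 - c) / (2 * N))"
        using N0 by (intro mult_left_mono) auto
      then show "N * norm X \<le> (1 - c) / 2"
        using N0 by simp
    qed simp
    finally have err: "norm (dag D ** E ** D) \<le> (1 - c) / 2 * norm X" .
    have "dag D ** (D ** u ** dag D ** dag u) ** D - mat 1 = dag D ** (D ** u ** dag D ** dag u - mat 1) ** D"
      by (simp add: matrix_diff_ldistrib matrix_diff_rdistrib U_dag_left[OF D(2)])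
    also have "\<dots> = dag D ** L (L X) ** D + dag D ** E ** D"
      by (simp add: w matrix_add_ldistrib matrix_add_rdistrib)
    finally have "norm (dag D ** (D ** u ** dag D ** dag u) ** D - mat 1) \<le> norm (dag D ** L (L X) ** D) + norm (dag D ** E ** D)"
      by (metis norm_triangle_ineq)
    also have "\<dots> \<le> c * norm X + (1 - c) / 2 * norm X"
      using main err by (intro add_mono)
    also have "\<dots> = (1 + c) / 2 * norm X"
      by (simp add: field_simps)
    finally show "norm (dag D ** (D ** u ** dag D ** dag u) ** D - mat 1) \<le> (1 + c) / 2 * norm (x - mat 1)"
      by (simp add: X_def)
  qed
qed

section \<open>Fixed points of words, and properness of the action\<close>

lemma act_image: "act g ` act h ` Z = act (g ** h) ` Z"
  by (simp add: image_image act_act)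

lemma act_boundary:
  assumes "g \<in> U" "x \<in> hyp_boundary J"
  shows "act g x \<in> hyp_boundary J"
proof -
  obtain v where v: "x = cline v" "v \<noteq> 0" "H v v = 0"
    using assms(2) by (auto simp: hyp_boundary_def)
  moreover have "g *v v \<noteq> 0"
    using U_dag_cancel(1)[OF assms(1), of v] v by auto
  ultimately show ?thesis
    by (simp add: act_cline hyp_boundary_iff U_herm[OF assms(1)])
qed

lemma act_hyp_space: "g \<in> U \<Longrightarrow> x \<in> hyp_space J \<Longrightarrow> act g x \<in> hyp_space J"
  by (auto simp: hyp_space_def act_cline U_herm)

text \<open>The square of \<open>g\<close> fixes \<open>x\<close> and \<open>y\<close> separately,
  and it is loxodromic with the fixed points of \<open>g\<close>.\<close>

lemma preserved_pair:
  assumes g: "g \<in> U" and ab: "H a a = 0" "H b b = 0" "H a b = -1"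
    and eig: "g *v a = \<kappa> *s a" "g *v b = \<mu> *s b" and \<kappa>: "cmod \<kappa> \<noteq> 1"
    and xy: "x \<in> hyp_boundary J" "y \<in> hyp_boundary J" "x \<noteq> y" and pres: "act g ` {x, y} = {x, y}"
  shows "{x, y} = {cline a, cline b}"
proof -
  have "{act g x, act g y} = {x, y}"
    using pres by simp
  then have "(act g x = x \<and> act g y = y) \<or> (act g x = y \<and> act g y = x)"
    unfolding doubleton_eq_iff .
  then have "act (g ** g) x = x" "act (g ** g) y = y"
    by (auto simp: act_act[symmetric])
  moreover have "{x \<in> hyp_boundary J. act (g ** g) x = x} = {cline a, cline b}"
  proof (rule loxodromicI(2)[OF mult_U[OF g g] ab])
    show "(g ** g) *v a = (\<kappa> * \<kappa>) *s a" "(g ** g) *v b = (\<mu> * \<mu>) *s b"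
      by (simp_all add: matrix_vector_mul_assoc[symmetric] eig vector_scalar_commute vector_smult_assoc)
    show "cmod (\<kappa> * \<kappa>) \<noteq> 1"
      using \<kappa> by (auto simp: norm_mult square_eq_1_iff) (smt (verit) norm_ge_zero)
  qed
  ultimately have "x \<in> {cline a, cline b}" "y \<in> {cline a, cline b}"
    using xy by blast+
  then show ?thesis
    using xy(3) by auto
qed

text \<open>\<open>h ** dag f ** dag h\<close> is \<open>dag f\<close> times the commutator, so it
  preserves \<open>Z\<close>. Hence \<open>f\<close> preserves the preimage of \<open>Z\<close>
  under \<open>h\<close>, and by \<open>preserved_pair\<close> that preimage is
  \<open>Z\<close>.\<close>

lemma commutator_preserves_pair:
  assumes f: "f \<in> U" and ab: "H a a = 0" "H b b = 0" "H a b = -1"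
    and eig: "f *v a = \<kappa> *s a" "f *v b = \<mu> *s b" and \<kappa>: "cmod \<kappa> \<noteq> 1"
    and h: "h \<in> U" and Z: "Z = {cline a, cline b}" and pres: "act (f ** h ** dag f ** dag h) ` Z = Z"
  shows "act h ` Z = Z"
proof -
  have nz: "a \<noteq> 0" "b \<noteq> 0" using ab by auto
  have ne: "cline a \<noteq> cline b"
    using cline_eq_iff[OF nz(1), of b] ab by (auto simp: herm_simps)
  have "act f (cline a) = cline a" "act f (cline b) = cline b"
    using act_fixed_iff[OF f] nz eig by blast+
  then have fZ: "act f ` Z = Z" by (simp add: Z)
  have dfZ: "act (dag f) ` Z = Z"
    by (metis fZ act_image U_dag_left[OF f] act_mat_1 image_cong image_ident)
  define W where "W = act (dag h) ` Z"
  have "h ** dag f ** dag h = dag f ** (f ** h ** dag f ** dag h)"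
    using f by (simp add: matrix_mul_assoc U_dag_left)
  then have kZ: "act (h ** dag f ** dag h) ` Z = Z"
    using pres dfZ by (metis act_image)
  have "act f ` W = act f ` act (dag h) ` act (h ** dag f ** dag h) ` Z"
    by (simp add: kZ W_def)
  also have "\<dots> = act (f ** (dag h ** (h ** dag f ** dag h))) ` Z"
    by (simp only: act_image)
  also have "f ** (dag h ** (h ** dag f ** dag h)) = dag h"
    using f h by (simp add: matrix_mul_assoc U_dag_left U_dag_right)
  finally have fW: "act f ` W = W"
    by (simp add: W_def)
  have W: "W = {act (dag h) (cline a), act (dag h) (cline b)}"
    by (simp add: W_def Z)
  have "W = {cline a, cline b}"
    unfolding W
  proof (rule preserved_pair[OF f ab eig \<kappa>])
    show "act (dag h) (cline a) \<in> hyp_boundary J" "act (dag h) (cline b) \<in> hyp_boundary J"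
      using nz ab h by (auto intro!: act_boundary simp: hyp_boundary_iff)
    show "act (dag h) (cline a) \<noteq> act (dag h) (cline b)"
      by (metis ne act_act act_mat_1 U_dag_right[OF h])
    show "act f ` {act (dag h) (cline a), act (dag h) (cline b)} = {act (dag h) (cline a), act (dag h) (cline b)}"
      using fW by (simp add: W)
  qed
  then have "act h ` Z = act h ` act (dag h) ` Z"
    by (simp add: W_def Z)
  also have "\<dots> = Z"
    by (simp add: act_image U_dag_right[OF h])
  finally show ?thesis .
qed

text \<open>A bound on \<open>H (h *v z) z\<close> bounds \<open>dag h *v z\<close> by
  \<open>form_coercive\<close>, hence \<open>H (h *v w) z\<close> for every \<open>w\<close>, and
  then \<open>h *v w\<close> by \<open>form_coercive\<close> again.\<close>

lemma bounded_if_bounded_at_point: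
  assumes z: "H z z = -1"
  shows "bounded {h \<in> U. cmod (H (h *v z) z) \<le> R}"
proof -
  obtain c where c: "0 < c" "\<And>v. c * (norm v)\<^sup>2 \<le> Re (H v v) + 2 * (cmod (H v z))\<^sup>2"
    using form_coercive[OF z] by metis
  obtain K where K: "0 < K" "\<And>v w. norm (H v w) \<le> norm v * norm w * K"
    using bounded_bilinear.pos_bounded[OF bounded_bilinear_herm[of J]] by blast
  define R1 where "R1 = sqrt (2 * R\<^sup>2 / c)"
  define R2 where "R2 = (\<lambda>w. sqrt ((Re (H w w) + 2 * (norm w * R1 * K)\<^sup>2) / c))"
  have bound: "norm (h *v w) \<le> R2 w" if h: "h \<in> U" "cmod (H (h *v z) z) \<le> R" for h w
  proof -
    have "cmod (H (dag h *v z) z) = cmod (H (h *v z) z)"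
      by (metis herm_dag dag_dag H_commute complex_mod_cnj)
    then have "(cmod (H (dag h *v z) z))\<^sup>2 \<le> R\<^sup>2"
      using h by (intro power_mono) auto
    then have "c * (norm (dag h *v z))\<^sup>2 \<le> 2 * R\<^sup>2"
      using c(2)[of "dag h *v z"] by (simp add: U_herm[OF dag_U[OF h(1)]] z)
    then have R1: "norm (dag h *v z) \<le> R1"
      unfolding R1_def using c(1) by (intro real_le_rsqrt) (simp add: pos_le_divide_eq mult.commute)
    have "cmod (H (h *v w) z) \<le> norm w * norm (dag h *v z) * K"
      using K(2)[of w "dag h *v z"] by (simp add: herm_dag)
    also have "\<dots> \<le> norm w * R1 * K"
      using R1 K by (intro mult_right_mono mult_left_mono) auto
    finally have "(cmod (H (h *v w) z))\<^sup>2 \<le> (norm w * R1 * K)\<^sup>2"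
      by (intro power_mono) auto
    then have "c * (norm (h *v w))\<^sup>2 \<le> Re (H w w) + 2 * (norm w * R1 * K)\<^sup>2"
      using c(2)[of "h *v w"] by (simp add: U_herm[OF h(1)])
    then show ?thesis
      unfolding R2_def using c(1) by (intro real_le_rsqrt) (simp add: pos_le_divide_eq mult.commute)
  qed
  have "norm h \<le> (\<Sum>i\<in>(UNIV :: 'm set). \<Sum>j\<in>UNIV. R2 (axis j 1))"
    if h: "h \<in> U" "cmod (H (h *v z) z) \<le> R" for h
  proof -
    have "norm h \<le> (\<Sum>i\<in>UNIV. norm (h $ i))"
      unfolding norm_vec_def by (rule L2_set_le_sum) auto
    also have "\<dots> \<le> (\<Sum>i\<in>UNIV. \<Sum>j\<in>UNIV. cmod (h $ i $ j))"
      unfolding norm_vec_def by (intro sum_mono L2_set_le_sum) auto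
    also have "\<dots> \<le> (\<Sum>i\<in>(UNIV :: 'm set). \<Sum>j\<in>UNIV. R2 (axis j 1))"
    proof (intro sum_mono)
      fix i j
      have "cmod (h $ i $ j) \<le> norm (h *v axis j 1)"
        using Finite_Cartesian_Product.norm_nth_le[of "h *v axis j 1" i] by (simp only: matrix_vector_mult_axis)
      also have "\<dots> \<le> R2 (axis j 1)"
        by (rule bound[OF h])
      finally show "cmod (h $ i $ j) \<le> R2 (axis j 1)" .
    qed
    finally show ?thesis .
  qed
  then show ?thesis
    unfolding bounded_iff by blast
qed

text \<open>The stabiliser of \<open>[z]\<close> is compact, so in a discrete group orbit points that converge to
  \<open>[z]\<close> eventually equal \<open>[z]\<close>.\<close>

lemma discrete_orbit_reaches:
  assumes \<Gamma>: "subgroup \<Gamma> (SU J)" "discrete \<Gamma>" and z: "H z z = -1"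
    and h: "\<And>k :: nat. h k \<in> \<Gamma>" and lim: "(\<lambda>k. cmod (H (h k *v z) z)) \<longlonglongrightarrow> 1"
  shows "\<exists>k. act (h k) (cline z) = cline z"
proof -
  have hU: "h k \<in> U" for k
    using U_mem_subgroup(1)[OF \<Gamma>(1) h] .
  obtain R where R: "\<And>k. cmod (H (h k *v z) z) \<le> R"
    using Bseq_def[of "\<lambda>k. cmod (H (h k *v z) z)"] convergent_imp_Bseq[OF convergentI[OF lim]] by auto
  have "bounded (range h)"
    by (rule bounded_subset[OF bounded_if_bounded_at_point[OF z, of R]]) (use hU R in auto)
  then have "compact (closure (range h))"
    by (simp add: compact_closure)
  then obtain L r where r: "strict_mono r" and lim0: "(h \<circ> r) \<longlonglongrightarrow> L"
    unfolding compact_def using closure_subset by (metis rangeI subsetD)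
  have hr: "(\<lambda>k. h (r k)) \<longlonglongrightarrow> L"
    using lim0 by (simp add: comp_def)
  have LU: "L \<in> U"
    using closed_sequentially[OF closed_U _ hr] hU by blast
  obtain e where e: "0 < e" "\<And>g. g \<in> \<Gamma> \<Longrightarrow> norm (g - mat 1) < e \<Longrightarrow> g = mat 1"
    using discrete_subgroup_gap[OF \<Gamma>] by metis
  have "(\<lambda>k. h (r (Suc k))) \<longlonglongrightarrow> L"
    by (rule LIMSEQ_Suc[OF hr])
  \<comment> \<open>Successive quotients of a convergent subsequence tend to 1, so by the gap they
    eventually equal 1. The subsequence is then constant, and its value attains the limit of the
    displacements.\<close>
  then have "(\<lambda>k. dag (h (r k)) ** h (r (Suc k))) \<longlonglongrightarrow> dag L ** L"
    by (intro tendsto_intros hr)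
  then have "(\<lambda>k. dag (h (r k)) ** h (r (Suc k))) \<longlonglongrightarrow> mat 1"
    by (simp add: U_dag_left[OF LU])
  then obtain N where N: "\<And>k. N \<le> k \<Longrightarrow> norm (dag (h (r k)) ** h (r (Suc k)) - mat 1) < e"
    using e(1) by (meson LIMSEQ_D)
  have step: "h (r (Suc k)) = h (r k)" if "N \<le> k" for k
  proof -
    have "dag (h (r k)) ** h (r (Suc k)) = mat 1"
      using e(2) N[OF that] U_mem_subgroup(2,3)[OF \<Gamma>(1)] h by blast
    then have "h (r k) ** (dag (h (r k)) ** h (r (Suc k))) = h (r k)"
      by simp
    then show ?thesis
      using hU by simp
  qed
  have const: "h (r (N + k)) = h (r N)" for k
    by (induction k) (use step in auto)
  have "(\<lambda>k. cmod (H (h (r k) *v z) z)) \<longlonglongrightarrow> 1"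
    using LIMSEQ_subseq_LIMSEQ[OF lim r] by (simp add: comp_def)
  then have "(\<lambda>k. cmod (H (h (r (N + k)) *v z) z)) \<longlonglongrightarrow> 1"
    using LIMSEQ_ignore_initial_segment[of _ 1 N] by (simp add: add.commute)
  then have "cmod (H (h (r N) *v z) z) = 1"
    by (simp add: const LIMSEQ_const_iff)
  then have "cmod (H z (h (r N) *v z)) = 1"
    by (metis H_commute complex_mod_cnj)
  moreover have "H (h (r N) *v z) (h (r N) *v z) = -1"
    by (simp add: U_herm[OF hU] z)
  ultimately have "\<exists>c. h (r N) *v z = c *s z"
    using reverse_Cauchy_Schwarz(2)[OF z] by blast
  moreover have "z \<noteq> 0" using z by auto
  ultimately show ?thesis
    using act_fixed_iff[OF hU] by blast
qed

lemma conjugate_in_SU_iff: "conjugate_in_SU J f B \<longleftrightarrow> (\<exists>C\<in>U. f = C ** B ** dag C)"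
  by (auto simp: conjugate_in_SU_def matrix_inv_U)

end

section \<open>The three discreteness criteria\<close>

lemma J2_axis_null_pair:
  assumes "p \<noteq> q"
  shows "herm (J2 p q) (axis p 1) (axis p 1) = 0" "herm (J2 p q) (axis q 1) (axis q 1) = 0"
    "herm (J2 p q) (axis p 1) (axis q 1) = -1"
  using assms by (auto simp: herm_J2 axis_def intro!: sum.neutral)

lemma diag_matrix_axis: "diag_matrix l *v axis i 1 = l i *s axis i 1"
  by (simp add: vec_eq_iff matrix_vector_mult_axis) (simp add: diag_matrix_def axis_def)

lemma diag_matrix_vector: "(diag_matrix l *v v) $ i = l i * v $ i"
proof -
  have "diag_matrix l $ i $ j * v $ j = (if j = i then l i * v $ i else 0)" for j
    by (simp add: diag_matrix_def)
  then show ?thesis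
    by (simp add: matrix_vector_mult_def)
qed

text \<open>As \<open>|l_p| |l_q| = 1\<close>, only pairs with exactly one of \<open>p\<close>,
  \<open>q\<close> need care. For \<open>(p, i)\<close> the factor \<open>|l_p| > 1\<close> is on
  the favourable side. For \<open>(q, i)\<close> the difference is that of \<open>(p, i)\<close>
  divided by \<open>|l_p|\<close>, which compensates for \<open>|l_q| = 1 / |l_p|\<close>.\<close>

lemma loxodromic_multipliers:
  fixes l :: "'m::finite \<Rightarrow> complex"
  assumes pq: "p \<noteq> q" and lp: "1 < cmod (l p)" and lq: "l q = inverse (cnj (l p))"
    and l1: "\<And>i. i \<noteq> p \<Longrightarrow> i \<noteq> q \<Longrightarrow> cmod (l i) = 1"
    and \<delta>: "\<And>i. i \<noteq> p \<Longrightarrow> i \<noteq> q \<Longrightarrow> cmod (l i - 1) \<le> \<delta>" "0 \<le> \<delta>"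
    and m: "m = 2 * \<delta> + cmod (l p - 1) + cmod (l q - 1)"
  shows "(cmod (l i - l j))\<^sup>2 \<le> m\<^sup>2 * (cmod (l i) * cmod (l j))"
proof -
  have lp0: "l p \<noteq> 0" using lp by auto
  have m0: "0 \<le> m" using \<delta> by (simp add: m)
  have tri: "cmod (l i - l j) \<le> cmod (l i - 1) + cmod (l j - 1)" for i j
    using norm_triangle_ineq4[of "l i - 1" "l j - 1"] by simp
  have nq: "cmod (l q) = 1 / cmod (l p)"
    unfolding lq norm_inverse complex_mod_cnj by (rule inverse_eq_divide)
  have pi: "cmod (l p - l i) \<le> m" if "i \<noteq> p" "i \<noteq> q" for i
  proof -
    have "cmod (l p - l i) \<le> cmod (l p - 1) + \<delta>"
      using tri[of p i] \<delta>(1)[OF that] by linarith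
    then show ?thesis
      using \<delta>(2) norm_ge_zero[of "l q - 1"] unfolding m by linarith
  qed
  have A: "(cmod (l i - l j))\<^sup>2 \<le> m\<^sup>2 * (cmod (l i) * cmod (l j))"
    if "i \<noteq> p" "i \<noteq> q" "j \<noteq> p" "j \<noteq> q" for i j
  proof -
    have "cmod (l i - l j) \<le> m"
      using tri[of i j] \<delta>(1)[OF that(1,2)] \<delta>(1)[OF that(3,4)] norm_ge_zero[of "l q - 1"]
        norm_ge_zero[of "l p - 1"] unfolding m by linarith
    then show ?thesis
      using l1 that by (simp add: power_mono)
  qed
  have B: "(cmod (l p - l q))\<^sup>2 \<le> m\<^sup>2 * (cmod (l p) * cmod (l q))"
  proof -
    have "cmod (l p - l q) \<le> m"
      using tri[of p q] \<delta>(2) unfolding m by linarith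
    then show ?thesis
      using lp0 by (simp add: nq power_mono)
  qed
  have C: "(cmod (l p - l i))\<^sup>2 \<le> m\<^sup>2 * (cmod (l p) * cmod (l i))" if "i \<noteq> p" "i \<noteq> q" for i
  proof -
    have "(cmod (l p - l i))\<^sup>2 \<le> m\<^sup>2 * 1"
      using pi[OF that] by (simp add: power_mono)
    also have "\<dots> \<le> m\<^sup>2 * (cmod (l p) * cmod (l i))"
      using lp l1[OF that] by (intro mult_left_mono) auto
    finally show ?thesis .
  qed
  have D: "(cmod (l q - l i))\<^sup>2 \<le> m\<^sup>2 * (cmod (l q) * cmod (l i))" if i: "i \<noteq> p" "i \<noteq> q" for i
  proof -
    have li: "l i * cnj (l i) = 1"
      using l1[OF i] by (simp add: complex_norm_square[symmetric])
    \<comment> \<open>Reflection in the unit circle fixes the unimodular \<open>l i\<close> and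
      sends \<open>l p\<close> to \<open>l q\<close>.\<close>
    have "l q - l i = l i * (cnj (l i) - cnj (l p)) / cnj (l p)"
      using lp0 li by (simp add: lq field_simps)
    then have "cmod (l q - l i) = cmod (cnj (l i - l p)) / cmod (l p)"
      using l1[OF i] by (simp add: norm_mult norm_divide)
    then have eq: "cmod (l q - l i) = cmod (l p - l i) / cmod (l p)"
      by (simp only: complex_mod_cnj norm_minus_commute)
    have "(cmod (l q - l i))\<^sup>2 \<le> m\<^sup>2 / (cmod (l p))\<^sup>2"
      unfolding eq power_divide using pi[OF i] by (intro divide_right_mono power_mono) auto
    also have "\<dots> \<le> m\<^sup>2 / cmod (l p)"
      using lp lp0 mult_left_mono[of 1 "cmod (l p)" "cmod (l p)"]
      by (intro divide_left_mono) (simp_all add: power2_eq_square)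
    finally show ?thesis
      using l1[OF i] by (simp add: nq)
  qed
  have sym: "(cmod (l i - l j))\<^sup>2 \<le> m\<^sup>2 * (cmod (l i) * cmod (l j))
      \<longleftrightarrow> (cmod (l j - l i))\<^sup>2 \<le> m\<^sup>2 * (cmod (l j) * cmod (l i))" for i j
    by (simp add: norm_minus_commute mult.commute)
  consider "i = j" | "i \<noteq> p" "i \<noteq> q" "j \<noteq> p" "j \<noteq> q" | "i = p" "j = q" | "i = q" "j = p"
    | "i = p" "j \<noteq> p" "j \<noteq> q" | "i = q" "j \<noteq> p" "j \<noteq> q" | "j = p" "i \<noteq> p" "i \<noteq> q" | "j = q" "i \<noteq> p" "i \<noteq> q"
    by blast
  then show ?thesis
  proof cases
    case 1
    then show ?thesis by simp
  next
    case 2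
    then show ?thesis by (rule A)
  next
    case 3
    then show ?thesis using B by simp
  next
    case 4
    then show ?thesis using B sym[of q p] by simp
  next
    case 5
    then show ?thesis using C[of j] by simp
  next
    case 6
    then show ?thesis using D[of j] by simp
  next
    case 7
    then show ?thesis using C[of i] sym[of i p] by simp
  next
    case 8
    then show ?thesis using D[of i] sym[of i q] by simp
  qed
qed

lemma discrete_if_loxodromic_test:
  assumes pq: "p \<noteq> q" and G: "zariski_dense_subgroup (J2 p q) G"
    and f: "loxodromic (J2 p q) f" "lox_M p q f < 1"
    and test: "\<And>g. g \<in> G \<Longrightarrow> loxodromic (J2 p q) g \<Longrightarrow> discrete (generate (SU (J2 p q)) {f, g})"
  shows "discrete G"
proof (rule ccontr)
  assume nd: "\<not> discrete G"
  interpret hermitian_form "J2 p q"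
    by (rule hermitian_form_J2[OF pq])
  have fU: "f \<in> U" using f by (simp add: loxodromic_def)
  \<comment> \<open>The same choice as in \<open>delta_cp\<close> and \<open>lox_M\<close>, so both
    invariants refer to this normal form.\<close>
  define l where "l = (SOME l. loxodromic_normal_form p q f l)"
  have nf: "loxodromic_normal_form p q f l"
    unfolding l_def using ex_loxodromic_normal_form[OF pq f(1)] by (rule someI_ex)
  define D where "D = diag_matrix l"
  obtain C where C: "C \<in> U" and fC: "f = C ** D ** dag C"
    using nf by (auto simp: loxodromic_normal_form_def conjugate_in_SU_iff D_def)
  have DC: "D = dag C ** f ** C"
    using C by (simp add: fC matrix_mul_assoc U_dag_left)
  have DU: "D \<in> U"
    unfolding DC using C fU by simp
  define \<delta> where "\<delta> = delta_cp p q f"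
  have \<delta>_eq: "\<delta> = Max (insert 0 {cmod (l i - 1) | i. i \<noteq> p \<and> i \<noteq> q})"
    by (simp add: \<delta>_def delta_cp_def l_def Let_def)
  have fin: "finite {cmod (l i - 1) | i. i \<noteq> p \<and> i \<noteq> q}"
    by simp
  have \<delta>0: "0 \<le> \<delta>" and \<delta>: "\<And>i. i \<noteq> p \<Longrightarrow> i \<noteq> q \<Longrightarrow> cmod (l i - 1) \<le> \<delta>"
    unfolding \<delta>_eq using fin by (auto intro!: Max_ge)
  have l: "1 < cmod (l p)" "l q = inverse (cnj (l p))" "\<And>i. i \<noteq> p \<Longrightarrow> i \<noteq> q \<Longrightarrow> cmod (l i) = 1"
    using nf by (auto simp: loxodromic_normal_form_def)
  define m where "m = 2 * \<delta> + cmod (l p - 1) + cmod (l q - 1)"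
  have "m = lox_M p q f"
    unfolding lox_M_def Let_def l_def[symmetric] \<delta>_def[symmetric] m_def l(2) ..
  then have "m < 1"
    using f(2) by simp
  moreover have "0 \<le> m"
    using \<delta>0 by (simp add: m_def)
  ultimately have m: "0 \<le> m" "m < 1"
    by simp_all
  have m2: "0 \<le> m\<^sup>2" "m\<^sup>2 < 1"
    using m power_strict_mono[of m 1 2] by simp_all
  obtain \<epsilon> where \<epsilon>: "0 < \<epsilon>"
    and contr: "\<And>x u. x \<in> U \<Longrightarrow> norm (x - mat 1) < \<epsilon> \<Longrightarrow> u = D ** x ** dag D ** dag x
      \<Longrightarrow> norm (dag D ** (D ** u ** dag D ** dag u) ** D - mat 1) \<le> (1 + m\<^sup>2) / 2 * norm (x - mat 1)"
    using double_commutator_contraction[OF D_def DU m2 loxodromic_multipliers[OF pq l \<delta> \<delta>0 m_def]] by blast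
  define a where "a = C *v axis p 1"
  define b where "b = C *v axis q 1"
  have ab: "H a a = 0" "H b b = 0" "H a b = -1"
    using J2_axis_null_pair[OF pq] by (simp_all add: a_def b_def U_herm[OF C])
  have a0: "a \<noteq> 0" "b \<noteq> 0" using ab by auto
  have fC_axis: "f *v (C *v axis i 1) = l i *s (C *v axis i 1)" for i
  proof -
    have "f *v (C *v axis i 1) = C *v (D *v (dag C *v (C *v axis i 1)))"
      by (simp add: fC matrix_vector_mul_assoc matrix_mul_assoc)
    then show ?thesis
      using C by (simp add: D_def diag_matrix_axis vector_scalar_commute)
  qed
  have eig: "f *v a = l p *s a" "f *v b = l q *s b"
    by (simp_all add: a_def b_def fC_axis)
  have lp: "cmod (l p) \<noteq> 1" using l by simp
  define \<eta> where "\<eta> = \<epsilon> / (norm (dag C) * norm C + 1)"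
  have \<eta>: "0 < \<eta>"
    using \<epsilon> by (simp add: \<eta>_def add_nonneg_pos)
  obtain g where g: "g \<in> G" "loxodromic (J2 p q) g" "norm (g - mat 1) < \<eta>" "act g (cline a) \<noteq> cline a"
    using dense_lox_near_one_moving[OF G nd \<eta> a0(1) ab(1)] by metis
  have gU: "g \<in> U" using dense_mem_U[OF G g(1)] .
  define \<Gamma> where "\<Gamma> = generate (SU (J2 p q)) {f, g}"
  have \<Gamma>: "subgroup \<Gamma> (SU (J2 p q))" "discrete \<Gamma>"
    using subgroup_generate_pair[OF fU gU] test[OF g(1,2)] by (simp_all add: \<Gamma>_def)
  have mem: "f \<in> \<Gamma>" "g \<in> \<Gamma>"
    by (auto simp: \<Gamma>_def intro: generate.incl)
  define K where "K = (\<lambda>h. f ** h ** dag f ** dag h)"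
  define \<Psi> where "\<Psi> = (\<lambda>h. dag f ** K (K h) ** f)"
  have K\<Gamma>: "K h \<in> \<Gamma>" if "h \<in> \<Gamma>" for h
    unfolding K_def by (intro U_mem_subgroup(2,3)[OF \<Gamma>(1)] that mem)
  have \<Psi>\<Gamma>: "\<Psi> h \<in> \<Gamma>" if "h \<in> \<Gamma>" for h
    unfolding \<Psi>_def by (intro U_mem_subgroup(2,3)[OF \<Gamma>(1)] K\<Gamma> that mem)
  have contr\<Psi>: "norm (dag C ** \<Psi> h ** C - mat 1) \<le> (1 + m\<^sup>2) / 2 * norm (dag C ** h ** C - mat 1)"
    if h: "h \<in> U" "norm (dag C ** h ** C - mat 1) < \<epsilon>" for h
  proof -
    have K: "dag C ** K h ** C = D ** (dag C ** h ** C) ** dag D ** dag (dag C ** h ** C)" for h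
      by (simp only: K_def conj_mult[OF C] conj_dag DC)
    have "dag C ** \<Psi> h ** C = dag D ** (dag C ** K (K h) ** C) ** D"
      by (simp only: \<Psi>_def conj_mult[OF C] conj_dag DC)
    then have "dag C ** \<Psi> h ** C = dag D ** (D ** (dag C ** K h ** C) ** dag D ** dag (dag C ** K h ** C)) ** D"
      by (simp only: K[of "K h"])
    then show ?thesis
      using contr[OF _ h(2) K] h(1) C by simp
  qed
  have near: "norm (dag C ** g ** C - mat 1) < \<epsilon>"
    using conj_near_one[OF C] g(3) by (simp add: \<eta>_def)
  obtain k where k: "(\<Psi> ^^ k) g = mat 1"
    using iterate_reaches_one[OF \<Gamma> C mem(2) \<Psi>\<Gamma> contr\<Psi> _ _ near] m2 by auto
  define Z where "Z = {cline a, cline b}"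
  have fZ: "act f ` Z = Z"
    using a0 eig act_fixed_iff[OF fU] by (auto simp: Z_def)
  have dfZ: "act (dag f) ` Z = Z"
    by (metis fZ act_image U_dag_left[OF fU] act_mat_1 image_cong image_ident)
  have pull_back: "act h ` Z = Z" if h: "h \<in> \<Gamma>" "act (\<Psi> h) ` Z = Z" for h
  proof -
    have "K (K h) = f ** \<Psi> h ** dag f"
      using fU by (simp add: \<Psi>_def matrix_mul_assoc U_dag_right)
    then have "act (K (K h)) ` Z = Z"
      using h(2) fZ dfZ by (metis act_image)
    then have "act (K h) ` Z = Z"
      using commutator_preserves_pair[OF fU ab eig lp _ Z_def, of "K h"] K\<Gamma>[OF h(1)] U_mem_subgroup(1)[OF \<Gamma>(1)]
      by (simp add: K_def)
    then show ?thesis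
      using commutator_preserves_pair[OF fU ab eig lp _ Z_def, of h] h(1) U_mem_subgroup(1)[OF \<Gamma>(1)]
      by (simp add: K_def)
  qed
  have "act ((\<Psi> ^^ n) g) ` Z = Z \<Longrightarrow> act g ` Z = Z" for n
  proof (induction n)
    case (Suc n)
    moreover have "(\<Psi> ^^ n) g \<in> \<Gamma>"
      by (induction n) (use mem \<Psi>\<Gamma> in auto)
    ultimately show ?case
      using pull_back[of "(\<Psi> ^^ n) g"] by simp
  qed simp
  from this[of k] have gZ: "act g ` Z = Z"
    by (simp add: k)
  \<comment> \<open>The iteration gives invariance of \<open>Z\<close> only as a set. Since
    \<open>g\<close> is loxodromic, an invariant pair consists of its own fixed points, so
    \<open>g\<close> fixes \<open>[a]\<close>.\<close>
  obtain a' b' \<kappa> \<mu> where g': "H a' a' = 0" "H b' b' = 0" "H a' b' = -1"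
    "g *v a' = \<kappa> *s a'" "g *v b' = \<mu> *s b'" "1 < cmod \<kappa>"
    using loxodromicE[OF g(2)] by metis
  have ne: "cline a \<noteq> cline b"
    using cline_eq_iff[OF a0(1), of b] ab by (auto simp: herm_simps)
  have "Z = {cline a', cline b'}"
    unfolding Z_def
    by (rule preserved_pair[OF gU g'(1-5)]) (use g' a0 ab ne gZ in \<open>auto simp: hyp_boundary_iff Z_def\<close>)
  moreover have "a' \<noteq> 0" "b' \<noteq> 0" using g' by auto
  then have "act g (cline a') = cline a'" "act g (cline b') = cline b'"
    using g' act_fixed_iff[OF gU] by blast+
  ultimately have "act g (cline a) = cline a"
    by (auto simp: Z_def doubleton_eq_iff)
  then show False
    using g(4) by simp
qed

lemma heis_matrix_scaling:
  fixes \<zeta> :: "complex^'m::finite"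
  assumes pq: "p \<noteq> q" and \<zeta>: "\<zeta> $ p = 0" "\<zeta> $ q = 0" and r: "0 < (r :: real)"
    and S: "S = diag_matrix (\<lambda>i. if i = p then of_real r else if i = q then of_real (1 / r) else 1)"
  shows "S \<in> carrier (SU (J2 p q))"
    "heis_matrix p q s \<zeta> ** S = S ** heis_matrix p q (of_real (r\<^sup>2) * s) (of_real r *s \<zeta>)"
proof -
  define l where "l = (\<lambda>i. if i = p then complex_of_real r else if i = q then of_real (1 / r) else 1)"
  have "det S = (\<Prod>i\<in>UNIV. l i)"
    unfolding S l_def[symmetric] by (subst det_diagonal) (simp_all add: diag_matrix_def)
  also have "\<dots> = (\<Prod>i\<in>{p, q}. l i)"
    by (rule prod.mono_neutral_right) (auto simp: l_def)
  also have "\<dots> = 1"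
    using pq r by (simp add: l_def)
  finally have det: "det S = 1" .
  have ct: "conj_transpose S = diag_matrix l"
    by (auto simp: S l_def conj_transpose_def diag_matrix_def vec_eq_iff)
  have "conj_transpose S ** J2 p q ** S = J2 p q"
    unfolding ct unfolding S l_def[symmetric]
    using pq r by (auto simp: vec_eq_iff diag_matrix_mult diag_matrix_mult_left J2_def l_def)
  then show "S \<in> carrier (SU (J2 p q))"
    using det by (simp add: SU_def)
  show "heis_matrix p q s \<zeta> ** S = S ** heis_matrix p q (of_real (r\<^sup>2) * s) (of_real r *s \<zeta>)"
    unfolding S l_def[symmetric]
    using pq r \<zeta> by (auto simp: vec_eq_iff diag_matrix_mult diag_matrix_mult_left heis_matrix_def l_def
        power2_eq_square)
qed

lemma heis_matrix_near_one:
  fixes \<zeta> :: "complex^'m::finite"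
  assumes "p \<noteq> q" "0 < \<eta>"
  obtains r :: real where "0 < r"
    "norm (heis_matrix p q (of_real (r\<^sup>2) * s) (of_real r *s \<zeta>) - mat 1) < \<eta>"
proof -
  define N where "N = norm (heis_matrix p q s \<zeta> - mat 1)"
  \<comment> \<open>\<open>r \<le> 1\<close> gives \<open>r^2 \<le> r\<close>, so every entry of the
    difference from 1 shrinks at least by the factor \<open>r\<close>.\<close>
  define r where "r = min 1 (\<eta> / (N + 1))"
  have N0: "0 \<le> N" by (simp add: N_def)
  have r: "0 < r" "r \<le> 1"
    using assms N0 by (simp_all add: r_def add_nonneg_pos)
  have "r\<^sup>2 \<le> r"
    using r by (simp add: power2_eq_square mult_left_le)
  then have "norm (heis_matrix p q (of_real (r\<^sup>2) * s) (of_real r *s \<zeta>) - mat 1) \<le> r * N"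
    unfolding N_def using r assms(1)
    by (intro norm_matrix_entrywise_le)
      (auto simp: heis_matrix_def mat_def norm_mult norm_power intro!: mult_right_mono simp del: of_real_power)
  also have "\<dots> < \<eta>"
  proof -
    have "r * N \<le> \<eta> / (N + 1) * N"
      using N0 by (intro mult_right_mono) (simp_all add: r_def)
    also have "\<dots> < \<eta>"
      using N0 assms(2) by (simp add: field_simps add_nonneg_pos)
    finally show ?thesis .
  qed
  finally show thesis
    using that r by blast
qed

text \<open>A conjugate of a Heisenberg translation by \<open>diag (r, 1/r, 1, \<dots>, 1)\<close> is as close to \<open>1\<close> as
  desired, so its commutators contract.\<close>

lemma discrete_if_heisenberg_test:
  assumes pq: "p \<noteq> q" and G: "zariski_dense_subgroup (J2 p q) G"
    and f: "parabolic (J2 p q) f" "heisenberg_normal_form p q f s \<zeta>"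
    and test: "\<And>g. g \<in> G \<Longrightarrow> loxodromic (J2 p q) g \<Longrightarrow> discrete (generate (SU (J2 p q)) {f, g})"
  shows "discrete G"
proof (rule ccontr)
  assume nd: "\<not> discrete G"
  interpret hermitian_form "J2 p q"
    by (rule hermitian_form_J2[OF pq])
  have fU: "f \<in> U" using f by (simp add: parabolic_def)
  obtain C0 where C0: "C0 \<in> U" and f0: "f = C0 ** heis_matrix p q s \<zeta> ** dag C0" and \<zeta>: "\<zeta> $ p = 0" "\<zeta> $ q = 0"
    using f(2) by (auto simp: heisenberg_normal_form_def conjugate_in_SU_iff)
  obtain \<eta> where \<eta>: "0 < \<eta>" and contr: "\<And>T x. T \<in> U \<Longrightarrow> norm (T - mat 1) < \<eta> \<Longrightarrow> x \<in> U \<Longrightarrow> norm (x - mat 1) < 1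
      \<Longrightarrow> norm (T ** x ** dag T ** dag x - mat 1) \<le> 1 / 2 * norm (x - mat 1)"
    using commutator_contraction by metis
  obtain r :: real where r: "0 < r" "norm (heis_matrix p q (of_real (r\<^sup>2) * s) (of_real r *s \<zeta>) - mat 1) < \<eta>"
    using heis_matrix_near_one[OF pq \<eta>] by metis
  define S where "S = diag_matrix (\<lambda>i. if i = p then complex_of_real r else if i = q then of_real (1 / r) else 1)"
  note scaling = heis_matrix_scaling(1)[OF pq \<zeta> r(1) S_def] heis_matrix_scaling(2)[OF pq \<zeta> r(1) S_def, of s]
  define T where "T = heis_matrix p q (of_real (r\<^sup>2) * s) (of_real r *s \<zeta>)"
  define C where "C = C0 ** S"
  have C: "C \<in> U"
    using C0 scaling(1) by (simp add: C_def)
  have "dag C ** f ** C = dag S ** (dag C0 ** C0) ** heis_matrix p q s \<zeta> ** (dag C0 ** C0) ** S"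
    by (simp add: C_def f0 dag_mult matrix_mul_assoc)
  also have "\<dots> = dag S ** (heis_matrix p q s \<zeta> ** S)"
    by (simp add: U_dag_left[OF C0] matrix_mul_assoc)
  also have "\<dots> = T"
    using scaling by (simp add: T_def)
  finally have TC: "T = dag C ** f ** C" by simp
  then have TU: "T \<in> U"
    using C fU by simp
  obtain x0 where x0: "{x \<in> hyp_boundary (J2 p q). act f x = x} = {x0}"
    using f(1) by (auto simp: parabolic_def card_1_singleton_iff)
  then have "x0 \<in> hyp_boundary (J2 p q)"
    by blast
  then obtain v where v: "x0 = cline v" "v \<noteq> 0" "H v v = 0"
    by (auto simp: hyp_boundary_def)
  define \<epsilon> where "\<epsilon> = 1 / (norm (dag C) * norm C + 1)"
  have \<epsilon>: "0 < \<epsilon>"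
    by (simp add: \<epsilon>_def add_nonneg_pos)
  obtain g where g: "g \<in> G" "loxodromic (J2 p q) g" "norm (g - mat 1) < \<epsilon>" "act g (cline v) \<noteq> cline v"
    using dense_lox_near_one_moving[OF G nd \<epsilon> v(2,3)] by metis
  have gU: "g \<in> U" using dense_mem_U[OF G g(1)] .
  define \<Gamma> where "\<Gamma> = generate (SU (J2 p q)) {f, g}"
  have \<Gamma>: "subgroup \<Gamma> (SU (J2 p q))" "discrete \<Gamma>"
    using subgroup_generate_pair[OF fU gU] test[OF g(1,2)] by (simp_all add: \<Gamma>_def)
  have mem: "f \<in> \<Gamma>" "g \<in> \<Gamma>"
    by (auto simp: \<Gamma>_def intro: generate.incl)
  define K where "K = (\<lambda>h. f ** h ** dag f ** dag h)"
  have K\<Gamma>: "K h \<in> \<Gamma>" if "h \<in> \<Gamma>" for h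
    unfolding K_def by (intro U_mem_subgroup(2,3)[OF \<Gamma>(1)] that mem)
  have contrK: "norm (dag C ** K h ** C - mat 1) \<le> 1 / 2 * norm (dag C ** h ** C - mat 1)"
    if h: "h \<in> U" "norm (dag C ** h ** C - mat 1) < 1" for h
  proof -
    have "dag C ** K h ** C = T ** (dag C ** h ** C) ** dag T ** dag (dag C ** h ** C)"
      by (simp only: K_def conj_mult[OF C] conj_dag TC)
    then show ?thesis
      using contr[OF TU _ _ h(2)] r(2) h(1) C by (simp add: T_def)
  qed
  have near: "norm (dag C ** g ** C - mat 1) < 1"
    using conj_near_one[OF C] g(3) by (simp add: \<epsilon>_def)
  obtain k where k: "(K ^^ k) g = mat 1"
    using iterate_reaches_one[OF \<Gamma> C mem(2) K\<Gamma> contrK _ _ near] by auto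
  have fx0: "act f x0 = x0" and x0b: "x0 \<in> hyp_boundary (J2 p q)"
    using x0 by auto
  have dfx0: "act (dag f) x0 = x0"
    by (metis fx0 act_act act_mat_1 U_dag_left[OF fU])
  \<comment> \<open>If the commutator fixes \<open>x0\<close>, then \<open>f\<close> fixes the
    preimage of \<open>x0\<close> under \<open>h\<close>, which must be \<open>x0\<close>, the only
    boundary fixed point of a parabolic element.\<close>
  have pull_back: "act h x0 = x0" if h: "h \<in> \<Gamma>" "act (K h) x0 = x0" for h
  proof -
    have hU: "h \<in> U" using h U_mem_subgroup(1)[OF \<Gamma>(1)] by blast
    have "h ** dag f ** dag h = dag f ** K h"
      using fU by (simp add: K_def matrix_mul_assoc U_dag_left)
    then have "act (h ** dag f ** dag h) x0 = x0"
      using h(2) dfx0 by (metis act_act)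
    moreover have "f ** dag h ** (h ** dag f ** dag h) = dag h"
      using fU hU by (simp add: matrix_mul_assoc U_dag_right)
    ultimately have "act f (act (dag h) x0) = act (dag h) x0"
      by (metis act_act)
    moreover have "act (dag h) x0 \<in> hyp_boundary (J2 p q)"
      using act_boundary[OF dag_U[OF hU] x0b] .
    ultimately have "act (dag h) x0 = x0"
      using x0 by blast
    then show ?thesis
      by (metis act_act act_mat_1 U_dag_right[OF hU])
  qed
  have "act ((K ^^ n) g) x0 = x0 \<Longrightarrow> act g x0 = x0" for n
  proof (induction n)
    case (Suc n)
    moreover have "(K ^^ n) g \<in> \<Gamma>"
      by (induction n) (use mem K\<Gamma> in auto)
    ultimately show ?case
      using pull_back[of "(K ^^ n) g"] by simp
  qed simp
  from this[of k] show False
    using g(4) v by (simp add: k)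
qed

text \<open>\<open>\<tau>\<close> is the squared sinh of half the distance from \<open>[v]\<close>
  to the fixed point. Dividing the eigenvalues by \<open>l p\<close> turns the product into
  \<open>-1 + w\<close>, where \<open>w\<close> is the sum of the
  \<open>(u i - 1) |v $ i|^2\<close>. As \<open>-2 Re (u - 1) = |u - 1|^2\<close> for unimodular
  \<open>u\<close>, both terms of \<open>|-1 + w|^2 - 1\<close> are quadratic in
  \<open>m\<close>.\<close>

lemma elliptic_displacement:
  fixes l :: "'m::finite \<Rightarrow> complex"
  assumes l1: "\<And>i. cmod (l i) = 1" and m: "\<And>i. i \<noteq> p \<Longrightarrow> cmod (l i - l p) \<le> m" "0 \<le> m"
    and v: "herm (J1 p) v v = -1" and \<tau>: "\<tau> = (cmod (v $ p))\<^sup>2 - 1"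
  shows "(cmod (herm (J1 p) (diag_matrix l *v v) v))\<^sup>2 - 1 \<le> m\<^sup>2 * (1 + \<tau>) * \<tau>"
proof -
  define s where "s = (\<lambda>i. (cmod (v $ i))\<^sup>2)"
  define I where "I = UNIV - {p}"
  have s0: "0 \<le> s i" for i by (simp add: s_def)
  have herm_diag: "herm (J1 p) (diag_matrix l *v v) v = - (l p * of_real (s p)) + (\<Sum>i\<in>I. l i * of_real (s i))" for l
    unfolding herm_J1 diag_matrix_vector I_def s_def complex_norm_square by (simp add: mult.assoc)
  have "herm (J1 p) v v = of_real (- s p + (\<Sum>i\<in>I. s i))"
    unfolding herm_J1 I_def s_def by (simp add: complex_norm_square del: of_real_power)
  then have "- s p + (\<Sum>i\<in>I. s i) = -1"
    using v by (metis of_real_eq_iff of_real_1 of_real_minus)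
  then have sum_s: "(\<Sum>i\<in>I. s i) = \<tau>" and sp: "s p = 1 + \<tau>"
    by (simp_all add: \<tau> s_def)
  have \<tau>0: "0 \<le> \<tau>"
    unfolding sum_s[symmetric] by (intro sum_nonneg s0)
  define u where "u = (\<lambda>i. cnj (l p) * l i)"
  have lp: "cnj (l p) * l p = 1"
    using l1[of p] complex_norm_square[of "l p"] by (simp add: mult.commute)
  have u1: "cmod (u i) = 1" for i
    by (simp add: u_def norm_mult l1)
  have um: "cmod (u i - 1) \<le> m" if "i \<in> I" for i
  proof -
    have "u i - 1 = cnj (l p) * (l i - l p)"
      by (simp add: u_def right_diff_distrib lp)
    then show ?thesis
      using m(1)[of i] that by (simp add: norm_mult l1 I_def)
  qed
  define w where "w = (\<Sum>i\<in>I. (u i - 1) * of_real (s i))"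
  have "cnj (l p) * herm (J1 p) (diag_matrix l *v v) v = - of_real (s p) + (\<Sum>i\<in>I. u i * of_real (s i))"
    unfolding herm_diag by (simp add: right_diff_distrib mult.assoc[symmetric] lp sum_distrib_left u_def)
  also have "\<dots> = -1 + w"
    by (simp add: w_def left_diff_distrib sum_subtractf sp sum_s flip: of_real_sum)
  finally have eq: "cnj (l p) * herm (J1 p) (diag_matrix l *v v) v = -1 + w" .
  then have "cmod (-1 + w) = cmod (cnj (l p)) * cmod (herm (J1 p) (diag_matrix l *v v) v)"
    by (metis norm_mult)
  then have "cmod (herm (J1 p) (diag_matrix l *v v) v) = cmod (-1 + w)"
    by (simp add: l1)
  moreover have "(cmod (-1 + w))\<^sup>2 = (cmod w)\<^sup>2 + 1 - 2 * Re w"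
    unfolding cmod_power2 by (simp add: power2_eq_square algebra_simps)
  ultimately have "(cmod (herm (J1 p) (diag_matrix l *v v) v))\<^sup>2 - 1 = (cmod w)\<^sup>2 - 2 * Re w"
    by simp
  also have "- 2 * Re w = (\<Sum>i\<in>I. (cmod (u i - 1))\<^sup>2 * s i)"
  proof -
    have sq: "(cmod (u i - 1))\<^sup>2 = - 2 * Re (u i - 1)" for i
    proof -
      have "(Re (u i))\<^sup>2 + (Im (u i))\<^sup>2 = 1"
        using u1[of i] cmod_power2[of "u i"] by simp
      moreover have "(cmod (u i - 1))\<^sup>2 = (Re (u i))\<^sup>2 + (Im (u i))\<^sup>2 + 1 - 2 * Re (u i)"
        by (simp add: cmod_power2 power2_diff)
      ultimately show ?thesis
        by simp
    qed
    show ?thesis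
      unfolding sq by (simp add: w_def sum_distrib_left left_diff_distrib right_diff_distrib mult.assoc)
  qed
  then have "(cmod w)\<^sup>2 - 2 * Re w = (cmod w)\<^sup>2 + (\<Sum>i\<in>I. (cmod (u i - 1))\<^sup>2 * s i)"
    by simp
  also have "\<dots> \<le> (m * \<tau>)\<^sup>2 + m\<^sup>2 * \<tau>"
  proof (rule add_mono)
    have "cmod w \<le> (\<Sum>i\<in>I. cmod ((u i - 1) * of_real (s i)))"
      unfolding w_def by (rule norm_sum)
    also have "\<dots> \<le> (\<Sum>i\<in>I. m * s i)"
      using um s0 by (intro sum_mono) (simp add: norm_mult mult_right_mono)
    also have "\<dots> = m * \<tau>"
      by (simp add: sum_distrib_left[symmetric] sum_s)
    finally show "(cmod w)\<^sup>2 \<le> (m * \<tau>)\<^sup>2"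
      by (intro power_mono) auto
    have "(\<Sum>i\<in>I. (cmod (u i - 1))\<^sup>2 * s i) \<le> (\<Sum>i\<in>I. m\<^sup>2 * s i)"
      using um s0 by (intro sum_mono mult_right_mono power_mono) auto
    then show "(\<Sum>i\<in>I. (cmod (u i - 1))\<^sup>2 * s i) \<le> m\<^sup>2 * \<tau>"
      by (simp add: sum_distrib_left[symmetric] sum_s)
  qed
  also have "\<dots> = m\<^sup>2 * (1 + \<tau>) * \<tau>"
    by (simp add: power2_eq_square algebra_simps)
  finally show ?thesis .
qed

text \<open>Unlike in the loxodromic case, the iterates need not tend to \<open>1\<close>: \<open>|l\<^sub>i - l\<^sub>j|\<close> may exceed \<open>1\<close>
  for two positive-type eigenvalues. Only the orbit point of the fixed point of \<open>f\<close> is controlled.\<close>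

lemma discrete_if_elliptic_test:
  assumes pq: "p \<noteq> q" and G: "zariski_dense_subgroup (J1 p) G"
    and f: "regular_elliptic (J1 p) f" "ell_delta p f < 1"
    and test: "\<And>g. g \<in> G \<Longrightarrow> loxodromic (J1 p) g \<Longrightarrow> discrete (generate (SU (J1 p)) {f, g})"
  shows "discrete G"
proof (rule ccontr)
  assume nd: "\<not> discrete G"
  interpret hermitian_form "J1 p"
    by (rule hermitian_form_J1)
  have ell: "elliptic (J1 p) f" and uniq: "\<exists>!x. x \<in> hyp_space (J1 p) \<and> act f x = x"
    using f by (simp_all add: regular_elliptic_def)
  have fU: "f \<in> U" using ell by (simp add: elliptic_def)
  define l where "l = (SOME l. elliptic_normal_form p f l)"
  have nf: "elliptic_normal_form p f l"
    unfolding l_def using ex_elliptic_normal_form[OF ell] by (rule someI_ex)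
  define D where "D = diag_matrix l"
  obtain C where C: "C \<in> U" and fC: "f = C ** D ** dag C"
    using nf by (auto simp: elliptic_normal_form_def conjugate_in_SU_iff D_def)
  have l1: "cmod (l i) = 1" for i
    using nf by (simp add: elliptic_normal_form_def)
  define m where "m = ell_delta p f"
  have m_eq: "m = Max {cmod (l i - 1) + cmod (l p - 1) | i. i \<noteq> p}"
    by (simp add: m_def ell_delta_def l_def Let_def)
  have le_m: "cmod (l i - 1) + cmod (l p - 1) \<le> m" if "i \<noteq> p" for i
    unfolding m_eq using that by (intro Max_ge) auto
  \<comment> \<open>\<open>q\<close> provides an index other than \<open>p\<close>, so the maximum
    is taken over a nonempty set.\<close>
  have m0: "0 \<le> m"
    using le_m[OF pq[symmetric]] norm_ge_zero[of "l q - 1"] norm_ge_zero[of "l p - 1"] by linarith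
  have m1: "m < 1" using f by (simp add: m_def)
  have lm: "cmod (l i - l p) \<le> m" if "i \<noteq> p" for i
    using norm_triangle_ineq4[of "l i - 1" "l p - 1"] le_m[OF that] by simp
  define z where "z = C *v axis p 1"
  have axis: "H (axis p 1) (axis p 1) = -1"
    by (simp add: herm_J1) (simp add: axis_def)
  have zz: "H z z = -1"
    using axis by (simp add: z_def U_herm[OF C])
  have z0: "z \<noteq> 0" using zz by auto
  have "f *v z = C *v (D *v (dag C *v (C *v axis p 1)))"
    by (simp add: z_def fC matrix_vector_mul_assoc matrix_mul_assoc)
  then have "f *v z = l p *s z"
    using C by (simp add: z_def D_def diag_matrix_axis vector_scalar_commute)
  then have fz: "act f (cline z) = cline z"
    using act_fixed_iff[OF fU z0] by blast
  have zH: "cline z \<in> hyp_space (J1 p)"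
    by (simp add: hyp_space_iff zz)
  \<comment> \<open>The squared sinh of half the distance from \<open>[z]\<close> to its image under
    \<open>h\<close>.\<close>
  define \<tau> where "\<tau> = (\<lambda>h. (cmod (H (h *v z) z))\<^sup>2 - 1)"
  have \<tau>0: "0 \<le> \<tau> h" if "h \<in> U" for h
    using reverse_Cauchy_Schwarz(1)[of "h *v z" z] zz that by (simp add: \<tau>_def U_herm one_le_power)
  \<comment> \<open>\<open>h f h^-1\<close> displaces \<open>[z]\<close> as far as \<open>f\<close>
    displaces the preimage of \<open>[z]\<close> under \<open>h\<close>, a point as far from
    \<open>[z]\<close> as the image is. In the coordinates \<open>C\<close> this preimage is
    \<open>v\<close>.\<close>
  have step: "\<tau> (h ** f ** dag h) \<le> m\<^sup>2 * (1 + \<tau> h) * \<tau> h" if h: "h \<in> U" for h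
  proof -
    define v where "v = dag C *v (dag h *v z)"
    have vv: "H v v = -1"
      using zz by (simp add: v_def U_herm[OF dag_U[OF C]] U_herm[OF dag_U[OF h]])
    have "H (dag h *v z) z = H v (axis p 1)"
      unfolding v_def z_def by (simp add: herm_dag)
    moreover have "H v (axis p 1) = - v $ p"
      by (simp add: herm_J1) (simp add: axis_def)
    moreover have "cmod (H (dag h *v z) z) = cmod (H (h *v z) z)"
      by (metis herm_dag dag_dag H_commute complex_mod_cnj)
    ultimately have vp: "\<tau> h = (cmod (v $ p))\<^sup>2 - 1"
      by (simp add: \<tau>_def)
    have "(h ** f ** dag h) *v z = h *v (C *v (D *v v))"
      by (simp add: fC v_def matrix_vector_mul_assoc matrix_mul_assoc)
    then have "H ((h ** f ** dag h) *v z) z = H (D *v v) v"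
      by (simp add: herm_dag v_def)
    then show ?thesis
      using elliptic_displacement[where l = l and p = p and m = m and v = v and \<tau> = "\<tau> h", OF l1 lm m0 vv vp] by (simp add: \<tau>_def D_def)
  qed
  define c where "c = (1 + m\<^sup>2) / 2"
  have m2: "m\<^sup>2 < 1"
    using m0 m1 power_strict_mono[of m 1 2] by simp
  have c: "0 \<le> c" "c < 1"
    using m2 by (simp_all add: c_def)
  \<comment> \<open>Half of \<open>1 - m^2\<close>: for \<open>t < \<eta>\<close> this gives
    \<open>m^2 (1 + t) \<le> m^2 + \<eta> = c\<close>.\<close>
  define \<eta> where "\<eta> = (1 - m\<^sup>2) / 2"
  have \<eta>: "0 < \<eta>" using m2 by (simp add: \<eta>_def)
  have m2\<eta>: "m\<^sup>2 * (1 + t) \<le> c" if "t < \<eta>" "0 \<le> t" for t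
  proof -
    have "m\<^sup>2 * t \<le> 1 * t"
      using m2 that by (intro mult_right_mono) auto
    then show ?thesis
      using that by (simp add: \<eta>_def c_def distrib_left)
  qed
  have "open {h. \<tau> h < \<eta>}"
    unfolding \<tau>_def by (intro open_Collect_less continuous_intros)
  moreover have "mat 1 \<in> {h. \<tau> h < \<eta>}"
    using \<eta> by (simp add: \<tau>_def zz)
  ultimately obtain \<epsilon> where \<epsilon>: "0 < \<epsilon>" "ball (mat 1) \<epsilon> \<subseteq> {h. \<tau> h < \<eta>}"
    using openE by blast
  obtain g where g: "g \<in> G" "loxodromic (J1 p) g" "norm (g - mat 1) < \<epsilon>"
    using dense_lox_near_one[OF G nd \<epsilon>(1)] by metis
  have \<tau>g: "\<tau> g < \<eta>"
    using \<epsilon>(2) g(3) by (auto simp: dist_norm norm_minus_commute)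
  have gU: "g \<in> U" using dense_mem_U[OF G g(1)] .
  define \<Gamma> where "\<Gamma> = generate (SU (J1 p)) {f, g}"
  have \<Gamma>: "subgroup \<Gamma> (SU (J1 p))" "discrete \<Gamma>"
    using subgroup_generate_pair[OF fU gU] test[OF g(1,2)] by (simp_all add: \<Gamma>_def)
  have mem: "f \<in> \<Gamma>" "g \<in> \<Gamma>"
    by (auto simp: \<Gamma>_def intro: generate.incl)
  define \<Psi> where "\<Psi> = (\<lambda>h. h ** f ** dag h)"
  have iter\<Gamma>: "(\<Psi> ^^ k) g \<in> \<Gamma>" for k
    by (induction k) (use mem U_mem_subgroup[OF \<Gamma>(1)] in \<open>auto simp: \<Psi>_def\<close>)
  have iterU: "(\<Psi> ^^ k) g \<in> U" for k
    using U_mem_subgroup(1)[OF \<Gamma>(1) iter\<Gamma>] .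
  have decay: "\<tau> ((\<Psi> ^^ k) g) \<le> c ^ k * \<tau> g \<and> \<tau> ((\<Psi> ^^ k) g) < \<eta>" for k
  proof (induction k)
    case 0
    then show ?case using \<tau>g by simp
  next
    case (Suc k)
    have t0: "0 \<le> \<tau> ((\<Psi> ^^ k) g)" using \<tau>0[OF iterU] .
    have "\<tau> ((\<Psi> ^^ Suc k) g) \<le> m\<^sup>2 * (1 + \<tau> ((\<Psi> ^^ k) g)) * \<tau> ((\<Psi> ^^ k) g)"
      using step[OF iterU[of k]] by (simp add: \<Psi>_def)
    also have "\<dots> \<le> c * \<tau> ((\<Psi> ^^ k) g)"
      using m2\<eta>[OF _ t0] Suc t0 by (intro mult_right_mono) auto
    finally have le: "\<tau> ((\<Psi> ^^ Suc k) g) \<le> c * \<tau> ((\<Psi> ^^ k) g)" .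
    moreover have "c * \<tau> ((\<Psi> ^^ k) g) \<le> c * (c ^ k * \<tau> g)"
      using Suc c by (intro mult_left_mono) auto
    moreover have "c * \<tau> ((\<Psi> ^^ k) g) \<le> 1 * \<tau> ((\<Psi> ^^ k) g)"
      using c t0 by (intro mult_right_mono) auto
    ultimately show ?case
      using Suc by (simp add: mult.assoc)
  qed
  have "(\<lambda>k. c ^ k * \<tau> g) \<longlonglongrightarrow> 0"
    using tendsto_mult_left_zero[OF LIMSEQ_power_zero[of c]] c by simp
  then have "(\<lambda>k. \<tau> ((\<Psi> ^^ k) g)) \<longlonglongrightarrow> 0"
    by (rule Lim_null_comparison[rotated]) (use decay \<tau>0[OF iterU] in simp)
  then have "(\<lambda>k. sqrt (\<tau> ((\<Psi> ^^ k) g) + 1)) \<longlonglongrightarrow> sqrt (0 + 1)"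
    by (intro tendsto_intros)
  then have "(\<lambda>k. cmod (H ((\<Psi> ^^ k) g *v z) z)) \<longlonglongrightarrow> 1"
    by (simp add: \<tau>_def)
  then obtain k where k: "act ((\<Psi> ^^ k) g) (cline z) = cline z"
    using discrete_orbit_reaches[where h = "\<lambda>k. (\<Psi> ^^ k) g", OF \<Gamma> zz iter\<Gamma>] by blast
  \<comment> \<open>Regularity enters here: if \<open>h f h^-1\<close> fixes \<open>[z]\<close>,
    then \<open>f\<close> fixes the preimage of \<open>[z]\<close> under \<open>h\<close>, and
    \<open>[z]\<close> is the only fixed point of \<open>f\<close>.\<close>
  have pull_back: "act h (cline z) = cline z" if h: "h \<in> U" "act (\<Psi> h) (cline z) = cline z" for h
  proof -
    have "dag h ** \<Psi> h = f ** dag h"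
      using h(1) by (simp add: \<Psi>_def matrix_mul_assoc U_dag_left)
    then have "act f (act (dag h) (cline z)) = act (dag h) (cline z)"
      using h(2) by (metis act_act)
    moreover have "act (dag h) (cline z) \<in> hyp_space (J1 p)"
      using act_hyp_space[OF dag_U[OF h(1)] zH] .
    ultimately have "act (dag h) (cline z) = cline z"
      using uniq fz zH by blast
    then show ?thesis
      by (metis act_act act_mat_1 U_dag_right[OF h(1)])
  qed
  have "act ((\<Psi> ^^ n) g) (cline z) = cline z \<Longrightarrow> act g (cline z) = cline z" for n
    by (induction n) (use pull_back iterU in auto)
  then have "act g (cline z) = cline z"
    using k by blast
  then show False
    using g(2) zH by (auto simp: loxodromic_def)
qed

theorem corollary1p4:
  fixes p q :: "'m::finite"
  assumes "p \<noteq> q"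
  shows
   "(\<forall>G f. zariski_dense_subgroup (J2 p q) G \<and> f \<in> carrier (SU (J2 p q)) \<and>
        loxodromic (J2 p q) f \<and> lox_M p q f < 1 \<and>
        (\<forall>g\<in>G. loxodromic (J2 p q) g \<longrightarrow> discrete (generate (SU (J2 p q)) {f, g}))
      \<longrightarrow> discrete G) \<and>
    (\<forall>G f s \<zeta>. zariski_dense_subgroup (J2 p q) G \<and> f \<in> carrier (SU (J2 p q)) \<and>
        heisenberg_translation (J2 p q) f \<and>
        heisenberg_normal_form p q f s \<zeta> \<and> norm \<zeta> < 1 / 2 \<and>
        (\<forall>g\<in>G. loxodromic (J2 p q) g \<longrightarrow> discrete (generate (SU (J2 p q)) {f, g}))
      \<longrightarrow> discrete G) \<and>
    (\<forall>G f. zariski_dense_subgroup (J1 p) G \<and> f \<in> carrier (SU (J1 p)) \<and>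
        regular_elliptic (J1 p) f \<and> ell_delta p f < 1 \<and>
        (\<forall>g\<in>G. loxodromic (J1 p) g \<longrightarrow> discrete (generate (SU (J1 p)) {f, g}))
      \<longrightarrow> discrete G)"
  using discrete_if_loxodromic_test[OF assms] discrete_if_heisenberg_test[OF assms]
    discrete_if_elliptic_test[OF assms]
  by (auto simp: heisenberg_translation_def)

end
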